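(* Let $\vec p=(p_1,\dots,p_n)$ with $1<\vec p<\infty$, and let either $1<\frac{n}{\sum_{i=1}^n 1/p_i}<t<r<\infty$ or $1<\frac{n}{\sum_{i=1}^n 1/p_i}\le t<r=\infty$. Then the Hardy-Littlewood maximal operator $\mathcal M$ is bounded on $M_{\vec p}^{t,r}$.
   Context: Functions are complex-valued and measurable on $\mathbb R^n$. Inequalities for vectors are componentwise. Mixed Lebesgue space: $L^{\vec p}$ is the set of measurable $f$ with $$\|f\|_{L^{\vec p}}=\Big(\int_{\mathbb R}\cdots\Big(\int_{\mathbb R}|f(x_1,\dots,x_n)|^{p_1}dx_1\Big)^{p_2/p_1}\cdots dx_n\Big)^{1/p_n}<\infty.$$ $\mathcal D$ is the family of all dyadic cubes $\prod_{i=1}^n[2^{-j}m_i,2^{-j}(m_i+1))$, $j\in\mathbb Z$, $m\in\mathbb Z^n$. Mixed Bourgain-Morrey space: $M_{\vec p}^{t,r}$ is the set of measurable $f$ with $$\|f\|_{M_{\vec p}^{t,r}}=\Big(\sum_{Q\in\mathcal D}|Q|^{\frac rt-\frac rn\sum_{i=1}^n\frac1{p_i}}\|f\chi_Q\|_{L^{\vec p}}^r\Big)^{1/r}<\infty$$ (supremum over $Q\in\mathcal D$ of $|Q|^{\frac1t-\frac1n\sum_i\frac1{p_i}}\|f\chi_Q\|_{L^{\vec p}}$ if $r=\infty$). Hardy-Littlewood maximal operator: $\mathcal Mf(x)=\sup_{B\ni x}\frac1{|B|}\int_B|f(y)|\,dy$, the supremum being over all balls $B$ containing $x\in\mathbb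 R^n$. Bounded on a space $X$ means $\|\mathcal Mf\|_X\le C\|f\|_X$ for all $f\in X$, with $C$ independent of $f$. *)

theory Defs
  imports "HOL-Analysis.Analysis"
begin

text \<open>
  Points of $n$-dimensional space are vectors of type \<^typ>\<open>real ^ 'n\<close>, where the finite linear order on
  the index type \<^typ>\<open>'n\<close> says which variable is the first, the second, and so on.
  The norms act on functions with values in \<^typ>\<open>ennreal\<close>, so that they apply both to the modulus of
  a complex-valued function and to a maximal function, which may take the value \<^term>\<open>\<infinity> :: ennreal\<close>.
\<close>

text \<open>Real powers on $[0,\infty]$, meant for exponents \<open>a > 0\<close>.\<close>

definition ennreal_powr :: "ennreal \<Rightarrow> real \<Rightarrow> ennreal" where
  "ennreal_powr y a = (if y = \<infinity> then \<infinity> else ennreal (enn2real y powr a))"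

definition vec_upd :: "real ^ 'n \<Rightarrow> 'n \<Rightarrow> real \<Rightarrow> real ^ 'n" where
  "vec_upd x i s = (\<chi> k. if k = i then s else x $ k)"

text \<open>
  The iterated integral in the mixed norm: the variables in the list are integrated out one after the
  other, and \<open>q\<close> is the exponent belonging to the variable integrated most recently, so that the powers
  applied are $p_1$, $p_2/p_1$, \dots, $p_n/p_{n-1}$ and finally $1/p_n$ when one starts with \<open>q = 1\<close>.
\<close>

primrec mixed_iter ::
  "real ^ 'n \<Rightarrow> 'n list \<Rightarrow> real \<Rightarrow> (real ^ 'n \<Rightarrow> ennreal) \<Rightarrow> real ^ 'n \<Rightarrow> ennreal" where
  "mixed_iter p [] q F = (\<lambda>x. ennreal_powr (F x) (1 / q))"
| "mixed_iter p (i # is) q F =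
     mixed_iter p is (p $ i)
       (\<lambda>x. \<integral>\<^sup>+ s. ennreal_powr (F (vec_upd x i s)) (p $ i / q) \<partial>lebesgue)"

text \<open>
  Once all variables are integrated out the result no longer depends on the point, so evaluating at
  \<open>0\<close> is no restriction.
\<close>

definition mixed_norm :: "real ^ 'n::{finite,linorder} \<Rightarrow> (real ^ 'n::{finite,linorder} \<Rightarrow> ennreal) \<Rightarrow> ennreal" where
  "mixed_norm p F = mixed_iter p (sorted_list_of_set UNIV) 1 F 0"

definition dyadic_cube :: "int \<Rightarrow> int ^ 'n \<Rightarrow> (real ^ 'n) set" where
  "dyadic_cube j m =
     {x. \<forall>i. 2 powi (- j) * of_int (m $ i) \<le> x $ i \<and> x $ i < 2 powi (- j) * (of_int (m $ i) + 1)}"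

definition dyadic_cubes :: "(real ^ 'n) set set" where
  "dyadic_cubes = {dyadic_cube j m | j m. True}"

definition bourgain_morrey_norm ::
  "real ^ 'n::{finite,linorder} \<Rightarrow> real \<Rightarrow> ereal \<Rightarrow> (real ^ 'n::{finite,linorder} \<Rightarrow> ennreal) \<Rightarrow> ennreal" where
  "bourgain_morrey_norm p t r F =
     (if r = \<infinity> then
        (SUP Q\<in>dyadic_cubes.
           ennreal (measure lebesgue Q powr (1 / t - 1 / real CARD('n) * (\<Sum>i\<in>UNIV. 1 / p $ i)))
           * mixed_norm p (\<lambda>x. F x * indicator Q x))
      else
        (let \<rho> = real_of_ereal r in
         ennreal_powr
           (\<Sum>\<^sub>\<infinity>Q\<in>dyadic_cubes.
              ennreal (measure lebesgue Q powr (\<rho> / t - \<rho> / real CARD('n) * (\<Sum>i\<in>UNIV. 1 / p $ i)))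
              * ennreal_powr (mixed_norm p (\<lambda>x. F x * indicator Q x)) \<rho>)
           (1 / \<rho>)))"

definition bourgain_morrey ::
  "real ^ 'n::{finite,linorder} \<Rightarrow> real \<Rightarrow> ereal \<Rightarrow> (real ^ 'n::{finite,linorder} \<Rightarrow> complex) set" where
  "bourgain_morrey p t r =
     {f \<in> borel_measurable lebesgue. bourgain_morrey_norm p t r (\<lambda>x. ennreal (cmod (f x))) < \<infinity>}"

definition hl_maximal :: "(real ^ 'n \<Rightarrow> complex) \<Rightarrow> real ^ 'n \<Rightarrow> ennreal" where
  "hl_maximal f x =
     (SUP (c, \<rho>)\<in>{(c, \<rho>). 0 < \<rho> \<and> x \<in> ball c \<rho>}.
        (\<integral>\<^sup>+ y\<in>ball c \<rho>. ennreal (cmod (f y)) \<partial>lebesgue) / emeasure lebesgue (ball c \<rho>))"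

text \<open>Maximal functions are lower semicontinuous, hence measurable, so that their norms make sense.\<close>

lemma open_hl_maximal_greater: "open {x. a < hl_maximal f x}"
proof -
  have "{x. a < hl_maximal f x} =
    (\<Union>(c, \<rho>)\<in>{(c, \<rho>). 0 < \<rho> \<and>
        a < (\<integral>\<^sup>+ y\<in>ball c \<rho>. ennreal (cmod (f y)) \<partial>lebesgue) / emeasure lebesgue (ball c \<rho>)}. ball c \<rho>)"
    unfolding hl_maximal_def less_SUP_iff by (auto simp del: mem_ball)
  then show ?thesis by (auto intro!: open_UN)
qed

lemma borel_measurable_hl_maximal: "hl_maximal f \<in> borel_measurable lebesgue"
proof -
  have "hl_maximal f \<in> borel_measurable borel"
    by (rule borel_measurableI_greater) (use open_hl_maximal_greater[of _ f] in \<open>simp add: borel_open\<close>)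
  then show ?thesis by (simp add: measurable_completion)
qed

end

theory Submission
  imports Defs
begin

text \<open>
  A ball is contained in a box of comparable volume with rational corners, so the maximal function
  is dominated by the composition of the one-dimensional maximal operators \<open>M\<^sub>k\<close> in the single
  variables. Each \<open>M\<^sub>k\<close> is bounded on the mixed space: by Muckenhoupt's theorem it is bounded on
  weighted Lebesgue spaces in \<open>x\<^sub>k\<close>, and the inner norms are added one at a time by Fubini's theorem at
  the matching exponent followed by Rubio de Francia extrapolation in \<open>x\<^sub>k\<close>, which recovers all other
  exponents and weights. On the line everything rests on the fact that, for any locally finite measure, the
  uncentred maximal operator over intervals is of weak type \<open>(1, 1)\<close>, because a finite family of
  intervals has a subfamily with the same union that covers no point more than twice.

  For the Morrey norm, let \<open>Q\<close> be a dyadic cube of side \<open>\<ell>\<close>. On \<open>Q\<close> the maximal function of \<open>f\<close> is at most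
  that of \<open>f\<close> restricted to the neighbours of \<open>Q\<close>, plus a constant times the supremum over \<open>l\<close> of the
  averages of \<open>|f|\<close> over the neighbours of the ancestor of \<open>Q\<close> of side \<open>2\<^sup>l\<ell>\<close>. By Hoelder's
  inequality, the contribution of generation \<open>l\<close> to the coefficient of \<open>Q\<close> is at most
  \<open>2 powr (- l n / t)\<close> times the coefficients of these neighbours. Each cube is the ancestor in generation
  \<open>l\<close> of \<open>2 powr (l n)\<close> cubes, so the sum of the \<open>r\<close>-th powers converges as \<open>t < r\<close>.
\<close>

section \<open>Powers in the extended nonnegative reals\<close>

text \<open>The obstacle is the fixed order of integration in the mixed norm. On the variables
  integrated before x_k, the bound for M_k is a vector-valued inequality, and integrals can be
  interchanged only where two exponents agree. This is what brings weights into a statement that has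
  none: extrapolation trades one exponent for another, at the price of knowing the inequality for
  all Muckenhoupt weights of one exponent. The weight it uses is manufactured from the two functions
  being compared, so constants may depend on a weight only through a bound \<open>K\<close> for its
  Muckenhoupt constant, and \<open>K\<close> is carried along explicitly. The variables integrated
  after x_k call only for monotonicity of the norm. In the Morrey part, the distant part of the
  function enters through a supremum over generations rather than a sum. The r-th power of a
  supremum is at most the sum of the r-th powers, so the generations are added only after powers
  have been taken. Triangle inequalities are then applied to boundedly many terms, and constants
  that grow with their number are harmless.\<close>

notation ennreal_powr (infixr "\<up>" 80)

lemma ennreal_powr_top [simp]: "top \<up> a = top"
  by (simp add: ennreal_powr_def)

lemma ennreal_powr_0 [simp]: "0 \<up> a = 0"
  by (simp add: ennreal_powr_def)

lemma ennreal_powr_1 [simp]: "1 \<up> a = 1"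
  by (simp add: ennreal_powr_def)

lemma ennreal_powr_ennreal: "0 \<le> x \<Longrightarrow> ennreal x \<up> a = ennreal (x powr a)"
  by (simp add: ennreal_powr_def)

lemma ennreal_powr_one [simp]: "x \<up> 1 = x"
  by (cases x) (auto simp: ennreal_powr_ennreal)

lemma ennreal_powr_eq_top_iff [simp]: "x \<up> a = top \<longleftrightarrow> x = top"
  by (cases x) (auto simp: ennreal_powr_ennreal)

lemma ennreal_powr_eq_0_iff [simp]: "x \<up> a = 0 \<longleftrightarrow> x = 0"
  by (cases x) (auto simp: ennreal_powr_ennreal)

lemma ennreal_powr_mult: "(x * y) \<up> a = x \<up> a * y \<up> a"
  by (cases x; cases y)
     (auto simp: ennreal_powr_ennreal powr_mult ennreal_mult[symmetric] ennreal_mult_top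
       ennreal_top_mult powr_eq_0_iff ennreal_eq_0_iff not_le split: if_splits)

lemma ennreal_powr_powr: "(x \<up> a) \<up> b = x \<up> (a * b)"
  by (cases x) (auto simp: ennreal_powr_ennreal powr_powr)

lemma ennreal_powr_add: "x \<up> a * x \<up> b = x \<up> (a + b)"
  by (cases x) (auto simp: ennreal_powr_ennreal powr_add ennreal_mult[symmetric])

lemma ennreal_powr_mono: "x \<le> y \<Longrightarrow> 0 \<le> a \<Longrightarrow> x \<up> a \<le> y \<up> a"
  by (cases x; cases y) (auto simp: ennreal_powr_ennreal top_unique intro!: ennreal_leI powr_mono2)

lemma ennreal_powr_cancel [simp]:
  "a \<noteq> 0 \<Longrightarrow> (x \<up> a) \<up> (1 / a) = x" "a \<noteq> 0 \<Longrightarrow> (x \<up> (1 / a)) \<up> a = x"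
  by (simp_all add: ennreal_powr_powr)

lemma ennreal_powr_less_iff: "0 < a \<Longrightarrow> x \<up> a < y \<up> a \<longleftrightarrow> x < y"
  by (metis ennreal_powr_cancel(1) ennreal_powr_mono less_imp_le less_irrefl not_le
      zero_less_divide_1_iff)

lemma ennreal_powr_le_iff: "0 < a \<Longrightarrow> x \<up> a \<le> y \<up> a \<longleftrightarrow> x \<le> y"
  using ennreal_powr_less_iff[of a y x] by (simp add: not_less[symmetric])

lemma ennreal_le_powr_iff: "0 < a \<Longrightarrow> x \<le> y \<up> (1 / a) \<longleftrightarrow> x \<up> a \<le> y"
  using ennreal_powr_le_iff[of a x "y \<up> (1 / a)"] by simp

lemma borel_measurable_ennreal_powr [measurable (raw)]:
  assumes [measurable]: "f \<in> borel_measurable M"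
  shows "(\<lambda>x. f x \<up> a) \<in> borel_measurable M"
  unfolding ennreal_powr_def by measurable

lemma ennreal_powr_indicator: "(x * indicator A y) \<up> a = x \<up> a * indicator A y"
  by (simp split: split_indicator)

text \<open>Moving the power to the other side as \<open>1 / a\<close> leaves a statement about
  upper bounds of the \<open>g i\<close> only.\<close>

lemma ennreal_powr_SUP_le:
  fixes g :: "'i \<Rightarrow> ennreal"
  assumes "0 < a" "\<And>i. i \<in> I \<Longrightarrow> g i \<up> a \<le> z"
  shows "(SUP i\<in>I. g i) \<up> a \<le> z"
proof -
  have "(SUP i\<in>I. g i) \<le> z \<up> (1 / a)"
    using assms by (intro SUP_least) (simp add: ennreal_le_powr_iff)
  then show ?thesis using assms(1) by (simp add: ennreal_le_powr_iff)
qed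

text \<open>Comparison with the maximum gives a constant for every \<open>a > 0\<close>, so the
  lemma serves both a power \<open>q\<close> and the root \<open>1 / q\<close>.\<close>

lemma ennreal_powr_add_le:
  assumes "0 < a"
  shows "(x + y) \<up> a \<le> 2 \<up> a * (x \<up> a + y \<up> a)"
proof -
  have "(x + y) \<up> a \<le> (2 * max x y) \<up> a"
    using assms by (intro ennreal_powr_mono) (auto simp: mult_2 intro!: add_mono)
  also have "\<dots> = 2 \<up> a * max x y \<up> a" by (rule ennreal_powr_mult)
  also have "max x y \<up> a \<le> x \<up> a + y \<up> a" by (auto simp: max_def add_increasing add_increasing2)
  finally show ?thesis by (simp add: mult_left_mono)
qed

lemma ennreal_Youngs_inequality:
  assumes "1 < p" "1 < q" "1 / p + 1 / q = 1"
  shows "x * y \<le> ennreal (1 / p) * x \<up> p + ennreal (1 / q) * y \<up> q"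
proof (cases "x = top \<or> y = top")
  case True
  then show ?thesis using assms by (auto simp: ennreal_mult_top)
next
  case False
  then obtain a b where ab: "x = ennreal a" "0 \<le> a" "y = ennreal b" "0 \<le> b"
    by (cases x; cases y) auto
  have "ennreal (a * b) \<le> ennreal (a powr p / p + b powr q / q)"
    by (intro ennreal_leI Youngs_inequality assms ab)
  then show ?thesis
    using assms ab by (simp add: ennreal_powr_ennreal ennreal_mult[symmetric] ennreal_plus[symmetric]
        del: ennreal_plus)
qed

text \<open>Young's inequality for the two factors divided by their norms. The case of a vanishing
  integral comes first because \<open>0 * top = 0\<close>: the product is then zero almost
  everywhere, whatever the other integral is.\<close>

lemma Holder_nn_integral:
  fixes p q :: real
  assumes pq: "1 < p" "1 < q" "1 / p + 1 / q = 1"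
    and [measurable]: "f \<in> borel_measurable M" "g \<in> borel_measurable M"
  shows "(\<integral>\<^sup>+x. f x * g x \<partial>M) \<le> (\<integral>\<^sup>+x. f x \<up> p \<partial>M) \<up> (1 / p) * (\<integral>\<^sup>+x. g x \<up> q \<partial>M) \<up> (1 / q)"
proof -
  define F G where "F = (\<integral>\<^sup>+x. f x \<up> p \<partial>M)" and "G = (\<integral>\<^sup>+x. g x \<up> q \<partial>M)"
  consider "F = 0 \<or> G = 0" | "F \<noteq> 0" "G \<noteq> 0" "F = top \<or> G = top"
    | "F \<noteq> 0" "G \<noteq> 0" "F \<noteq> top" "G \<noteq> top" by blast
  then show ?thesis
  proof cases
    case 1
    then have "AE x in M. f x * g x = 0"
    proof
      assume "F = 0"
      then have "AE x in M. f x \<up> p = 0" unfolding F_def by (subst (asm) nn_integral_0_iff_AE) auto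
      then show ?thesis by eventually_elim auto
    next
      assume "G = 0"
      then have "AE x in M. g x \<up> q = 0" unfolding G_def by (subst (asm) nn_integral_0_iff_AE) auto
      then show ?thesis by eventually_elim auto
    qed
    then have "(\<integral>\<^sup>+x. f x * g x \<partial>M) = 0" by (subst nn_integral_0_iff_AE) auto
    then show ?thesis by simp
  next
    case 2
    then show ?thesis by (auto simp: F_def[symmetric] G_def[symmetric] ennreal_mult_top ennreal_top_mult)
  next
    case 3
    then obtain a b where ab: "F = ennreal a" "0 < a" "G = ennreal b" "0 < b"
      by (cases F; cases G) auto
    define u v where "u = a powr (1 / p)" and "v = b powr (1 / q)"
    have uv: "u > 0" "v > 0" using ab by (auto simp: u_def v_def)
    have "(\<integral>\<^sup>+x. f x * g x \<partial>M) = (\<integral>\<^sup>+x. ennreal (u * v) * ((ennreal (1 / u) * f x) * (ennreal (1 / v) * g x)) \<partial>M)"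
    proof (intro nn_integral_cong)
      fix x
      have "ennreal (u * v) * ((ennreal (1 / u) * f x) * (ennreal (1 / v) * g x))
        = (ennreal (u * v) * ennreal (1 / u) * ennreal (1 / v)) * (f x * g x)"
        by (simp add: mult_ac)
      also have "ennreal (u * v) * ennreal (1 / u) * ennreal (1 / v) = 1"
        using uv by (simp add: ennreal_mult[symmetric])
      finally show "f x * g x = ennreal (u * v) * ((ennreal (1 / u) * f x) * (ennreal (1 / v) * g x))"
        by simp
    qed
    also have "\<dots> \<le> (\<integral>\<^sup>+x. ennreal (u * v) *
       (ennreal (1 / p) * (ennreal (1 / u) * f x) \<up> p + ennreal (1 / q) * (ennreal (1 / v) * g x) \<up> q) \<partial>M)"
      by (intro nn_integral_mono mult_left_mono ennreal_Youngs_inequality pq) auto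
    also have "\<dots> = ennreal (u * v) * (ennreal (1 / p) * (ennreal (1 / u) \<up> p * F)
        + ennreal (1 / q) * (ennreal (1 / v) \<up> q * G))"
      by (simp add: nn_integral_cmult nn_integral_add ennreal_powr_mult F_def G_def)
    also have "ennreal (1 / u) \<up> p * F = 1"
      using ab pq uv by (simp add: ennreal_powr_ennreal u_def powr_divide powr_powr ennreal_mult[symmetric])
    also have "ennreal (1 / v) \<up> q * G = 1"
      using ab pq uv by (simp add: ennreal_powr_ennreal v_def powr_divide powr_powr ennreal_mult[symmetric])
    also have "ennreal (u * v) * (ennreal (1 / p) * 1 + ennreal (1 / q) * 1) = ennreal u * ennreal v"
      using uv pq by (simp add: ennreal_mult[symmetric] ennreal_plus[symmetric] del: ennreal_plus)
    also have "\<dots> = F \<up> (1 / p) * G \<up> (1 / q)"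
      using ab by (simp add: u_def v_def ennreal_powr_ennreal)
    finally show ?thesis by (simp add: F_def G_def)
  qed
qed

text \<open>The layer-cake formula for a single value. With \<open>y\<close> a value of a function,
  and followed by Fubini, it turns the integral of an \<open>s\<close>-th power into an integral
  over super-level sets. The comparison takes place in \<open>ennreal\<close>, so that
  \<open>y = top\<close> is covered.\<close>

lemma nn_integral_powr_Ioc:
  assumes s: "0 < s"
  shows "(\<integral>\<^sup>+x. ennreal (s * x powr (s - 1)) * indicator {0<..} x * indicator {x. ennreal x < y} x \<partial>lborel) = y \<up> s"
proof -
  have fin: "(\<integral>\<^sup>+x. ennreal (s * x powr (s - 1)) * indicator {0<..<c} x \<partial>lborel) = ennreal (c powr s)"
    if c: "0 \<le> c" for c :: real
  proof -
    have "((\<lambda>x. s * x powr (s - 1)) has_integral (s * (c powr (s - 1 + 1) / (s - 1 + 1)))) {0..c}"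
      using s c by (intro has_integral_mult_right has_integral_powr_from_0) auto
    then have "integral\<^sup>N lborel (\<lambda>x. ennreal (indicator {0..c} x * (s * x powr (s - 1)))) = ennreal (c powr s)"
      using s by (intro nn_integral_has_integral_lebesgue) auto
    moreover have "AE x in lborel. ennreal (s * x powr (s - 1)) * indicator {0<..<c} x
        = ennreal (indicator {0..c} x * (s * x powr (s - 1)))"
      using AE_lborel_singleton[of 0] AE_lborel_singleton[of c]
      by eventually_elim (auto split: split_indicator)
    then have "(\<integral>\<^sup>+x. ennreal (s * x powr (s - 1)) * indicator {0<..<c} x \<partial>lborel)
       = integral\<^sup>N lborel (\<lambda>x. ennreal (indicator {0..c} x * (s * x powr (s - 1))))"
      by (rule nn_integral_cong_AE)
    ultimately show ?thesis by simp
  qed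
  show ?thesis
  proof (cases y)
    case (real c)
    have "(\<integral>\<^sup>+x. ennreal (s * x powr (s - 1)) * indicator {0<..} x * indicator {x. ennreal x < y} x \<partial>lborel)
      = (\<integral>\<^sup>+x. ennreal (s * x powr (s - 1)) * indicator {0<..<c} x \<partial>lborel)"
      using real by (intro nn_integral_cong) (auto split: split_indicator simp: ennreal_less_iff)
    then show ?thesis using fin real by (simp add: ennreal_powr_ennreal)
  next
    case top
    have "of_nat n \<le> (\<integral>\<^sup>+x. ennreal (s * x powr (s - 1)) * indicator {0<..} x * indicator {x. ennreal x < y} x \<partial>lborel)" for n
    proof -
      \<comment> \<open>Cutting the integral at the \<open>s\<close>-th root of \<open>n\<close>
        gives exactly \<open>n\<close>, so the full integral is at least every natural
        number.\<close>
      have "of_nat n = ennreal ((real n powr (1 / s)) powr s)"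
        using s by (simp add: powr_powr ennreal_of_nat_eq_real_of_nat)
      also have "\<dots> = (\<integral>\<^sup>+x. ennreal (s * x powr (s - 1)) * indicator {0<..<real n powr (1 / s)} x \<partial>lborel)"
        by (rule fin[symmetric]) simp
      also have "\<dots> \<le> (\<integral>\<^sup>+x. ennreal (s * x powr (s - 1)) * indicator {0<..} x * indicator {x. ennreal x < y} x \<partial>lborel)"
        using top by (intro nn_integral_mono) (auto split: split_indicator)
      finally show ?thesis .
    qed
    then have "(\<integral>\<^sup>+x. ennreal (s * x powr (s - 1)) * indicator {0<..} x * indicator {x. ennreal x < y} x \<partial>lborel) = top"
      using ennreal_SUP_of_nat_eq_top by (intro top_unique[THEN iffD1]) (auto intro!: SUP_least simp flip: ennreal_SUP_of_nat_eq_top)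
    then show ?thesis using top by simp
  qed
qed

section \<open>Weighted maximal functions on the line\<close>

text \<open>Take a subfamily with the same union and as few members as possible. Of three intervals
  through a common point, one lies in the union of the one reaching farthest left and the one
  reaching farthest right, so it could be removed.\<close>

lemma interval_subcover_overlap2:
  fixes S :: "(real \<times> real) set"
  assumes "finite S"
  obtains S' where "S' \<subseteq> S" "(\<Union>(a, b)\<in>S'. {a<..<b}) = (\<Union>(a, b)\<in>S. {a<..<b})"
    "\<And>x. card {I\<in>S'. x \<in> {fst I<..<snd I}} \<le> 2"
proof -
  define P where "P S' \<longleftrightarrow> S' \<subseteq> S \<and> (\<Union>(a, b)\<in>S'. {a<..<b}) = (\<Union>(a, b)\<in>S. {a<..<b})" for S'
  have "P S" by (simp add: P_def)
  then obtain S' where S': "P S'" and min: "\<And>T. P T \<Longrightarrow> card S' \<le> card T"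
    using ex_has_least_nat[of P S card] by auto
  have fin: "finite S'" using S' assms finite_subset unfolding P_def by auto
  have "card {I\<in>S'. x \<in> {fst I<..<snd I}} \<le> 2" for x
  proof (rule ccontr)
    assume "\<not> ?thesis"
    then have c: "card {I\<in>S'. x \<in> {fst I<..<snd I}} > 2" by simp
    define T where "T = {I\<in>S'. x \<in> {fst I<..<snd I}}"
    have cT: "card T > 2" and finT: "finite T" and memT: "\<And>I. I \<in> T \<longleftrightarrow> I \<in> S' \<and> x \<in> {fst I<..<snd I}"
      using c fin by (auto simp: T_def)
    have neT: "T \<noteq> {}" using cT by auto
    have "Min (fst ` T) \<in> fst ` T" using finT neT by (intro Min_in) auto
    then obtain I1 where I1': "Min (fst ` T) = fst I1" "I1 \<in> T" by (rule imageE)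
    have "Max (snd ` T) \<in> snd ` T" using finT neT by (intro Max_in) auto
    then obtain I2 where I2': "Max (snd ` T) = snd I2" "I2 \<in> T" by (rule imageE)
    have I1: "fst I1 \<le> fst I" if "I \<in> T" for I
      unfolding I1'(1)[symmetric] using that finT by (intro Min_le) auto
    have I2: "snd I \<le> snd I2" if "I \<in> T" for I
      unfolding I2'(1)[symmetric] using that finT by (intro Max_ge) auto
    \<comment> \<open>\<open>I1\<close> and \<open>I2\<close> may coincide; more than two members
      still leave one that differs from both.\<close>
    have "card {I1, I2} \<le> 2" by (simp add: card_insert_if)
    then have "\<not> T \<subseteq> {I1, I2}"
      using card_mono[of "{I1, I2}" T] cT by auto
    then obtain I3 where I3: "I3 \<in> T" "I3 \<noteq> I1" "I3 \<noteq> I2" by auto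
    note mem = I1'(2)[unfolded memT] I2'(2)[unfolded memT] I3(1)[unfolded memT]
    have sub: "{fst I3<..<snd I3} \<subseteq> {fst I1<..<snd I1} \<union> {fst I2<..<snd I2}"
    proof
      fix y assume y: "y \<in> {fst I3<..<snd I3}"
      show "y \<in> {fst I1<..<snd I1} \<union> {fst I2<..<snd I2}"
        using y mem I1[OF I3(1)] I2[OF I3(1)] by (cases "y \<le> x") auto
    qed
    have "(\<Union>(a, b)\<in>S' - {I3}. {a<..<b}) = (\<Union>(a, b)\<in>S'. {a<..<b})"
    proof
      show "(\<Union>(a, b)\<in>S'. {a<..<b}) \<subseteq> (\<Union>(a, b)\<in>S' - {I3}. {a<..<b})"
      proof
        fix y assume "y \<in> (\<Union>(a, b)\<in>S'. {a<..<b})"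
        then obtain I where I: "I \<in> S'" "y \<in> {fst I<..<snd I}" by auto
        have "\<exists>J\<in>S' - {I3}. y \<in> {fst J<..<snd J}"
        proof (cases "I = I3")
          case True
          then have "y \<in> {fst I1<..<snd I1} \<or> y \<in> {fst I2<..<snd I2}" using sub I by auto
          then show ?thesis using mem I3 by blast
        qed (use I in auto)
        then show "y \<in> (\<Union>(a, b)\<in>S' - {I3}. {a<..<b})" by (auto simp: split_beta)
      qed
    qed auto
    then have "P (S' - {I3})" using S' unfolding P_def by auto
    from min[OF this] show False using mem(3) fin card_Diff1_less[of S' I3] by simp
  qed
  then show ?thesis using that S' unfolding P_def by blast
qed

section \<open>Maximal functions with respect to a weight\<close>

text \<open>Rational endpoints make the family countable, which yields measurability of the suprema
  below. Passing from balls to such intervals costs only a constant.\<close>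

definition rat_ivls :: "(real \<times> real) set" where
  "rat_ivls = {(a, b). a \<in> \<rat> \<and> b \<in> \<rat> \<and> a < b}"

lemma countable_rat_ivls: "countable rat_ivls"
  by (rule countable_subset[of _ "\<rat> \<times> \<rat>"]) (auto simp: rat_ivls_def countable_rat)

lemma rat_ivls_less: "(a, b) \<in> rat_ivls \<Longrightarrow> a < b"
  by (simp add: rat_ivls_def)

definition ivl_int :: "(real \<Rightarrow> ennreal) \<Rightarrow> real \<Rightarrow> real \<Rightarrow> ennreal" where
  "ivl_int f a b = (\<integral>\<^sup>+x\<in>{a<..<b}. f x \<partial>lborel)"

text \<open>Positivity at every point and finite integrals over intervals give the averages in
  \<open>wmax\<close> positive finite denominators, and \<open>1 / v\<close> makes sense without an
  exceptional set.\<close>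

definition weight :: "(real \<Rightarrow> real) \<Rightarrow> bool" where
  "weight v \<longleftrightarrow> v \<in> borel_measurable borel \<and> (\<forall>x. 0 < v x) \<and> (\<forall>(a, b)\<in>rat_ivls. ivl_int v a b < \<infinity>)"

text \<open>The uncentred maximal function of the measure with density \<open>v\<close>. The
  indicator keeps the index set independent of \<open>x\<close>, so that this is a countable
  supremum of measurable functions.\<close>

definition wmax :: "(real \<Rightarrow> real) \<Rightarrow> (real \<Rightarrow> ennreal) \<Rightarrow> real \<Rightarrow> ennreal" where
  "wmax v f x = (SUP (a, b)\<in>rat_ivls.
     indicator {a<..<b} x * (ivl_int (\<lambda>y. f y * ennreal (v y)) a b / ivl_int v a b))"

lemma weight_measurable [measurable_dest]: "weight v \<Longrightarrow> v \<in> borel_measurable borel"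
  and weight_pos: "weight v \<Longrightarrow> 0 < v x"
  and weight_finite: "weight v \<Longrightarrow> (a, b) \<in> rat_ivls \<Longrightarrow> ivl_int v a b \<noteq> top"
  unfolding weight_def by (auto simp: less_top)

lemma AE_lborel_ex_interval:
  fixes a b :: real
  assumes "AE x in lborel. P x" "a < b"
  shows "\<exists>x\<in>{a<..<b}. P x"
proof (rule ccontr)
  assume n: "\<not> ?thesis"
  from assms(1) have "AE x in lborel. x \<notin> {a<..<b}" by eventually_elim (use n in auto)
  then have "emeasure lborel {a<..<b} = 0"
    by (subst (asm) AE_iff_measurable[of "{a<..<b}"]) auto
  then show False using \<open>a < b\<close> by simp
qed

lemma ivl_int_pos:
  assumes [measurable]: "v \<in> borel_measurable borel" and pos: "\<And>x. 0 < v x" and "a < b"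
  shows "ivl_int (\<lambda>x. ennreal (v x)) a b \<noteq> 0"
proof
  assume "ivl_int v a b = 0"
  then have "AE x in lborel. ennreal (v x) * indicator {a<..<b} x = 0"
    unfolding ivl_int_def by (subst (asm) nn_integral_0_iff_AE) auto
  from AE_lborel_ex_interval[OF this \<open>a < b\<close>] obtain x where "ennreal (v x) = 0" by auto
  with pos[of x] show False by (simp add: ennreal_eq_0_iff)
qed

lemma weight_ivl_int:
  assumes "weight v" "(a, b) \<in> rat_ivls"
  obtains m where "ivl_int v a b = ennreal m" "0 < m"
  using ivl_int_pos[of v a b] weight_finite[OF assms] weight_pos[OF assms(1)] rat_ivls_less[OF assms(2)]
    weight_measurable[OF assms(1)]
  by (cases "ivl_int v a b") (auto simp: less_le)

lemma ivl_int_mono: "(\<And>x. x \<in> {a<..<b} \<Longrightarrow> f x \<le> g x) \<Longrightarrow> ivl_int f a b \<le> ivl_int g a b"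
  unfolding ivl_int_def by (intro nn_integral_mono) (auto split: split_indicator)

lemma ivl_int_mono_AE:
  "AE x in lborel. x \<in> {a<..<b} \<longrightarrow> f x \<le> g x \<Longrightarrow> ivl_int f a b \<le> ivl_int g a b"
  unfolding ivl_int_def by (intro nn_integral_mono_AE) (auto split: split_indicator elim: eventually_mono)

lemma ivl_int_cmult:
  "f \<in> borel_measurable borel \<Longrightarrow> ivl_int (\<lambda>x. c * f x) a b = c * ivl_int f a b"
  unfolding ivl_int_def by (simp add: nn_integral_cmult mult.assoc)

lemma ivl_int_const: "a \<le> b \<Longrightarrow> ivl_int (\<lambda>x. c) a b = c * ennreal (b - a)"
  unfolding ivl_int_def by (simp add: nn_integral_cmult_indicator)

lemma wmax_ge:
  assumes "(a, b) \<in> rat_ivls" "x \<in> {a<..<b}"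
  shows "ivl_int (\<lambda>y. f y * ennreal (v y)) a b / ivl_int v a b \<le> wmax v f x"
  unfolding wmax_def using assms by (intro SUP_upper2[of "(a, b)"]) auto

lemma wmax_le:
  assumes "\<And>a b. (a, b) \<in> rat_ivls \<Longrightarrow> x \<in> {a<..<b} \<Longrightarrow>
    ivl_int (\<lambda>y. f y * ennreal (v y)) a b / ivl_int v a b \<le> z"
  shows "wmax v f x \<le> z"
  unfolding wmax_def using assms by (intro SUP_least) (auto split: split_indicator)

lemma wmax_ge':
  assumes "weight v" "(a, b) \<in> rat_ivls" "x \<in> {a<..<b}"
  shows "ivl_int (\<lambda>y. f y * ennreal (v y)) a b \<le> wmax v f x * ivl_int v a b"
proof -
  obtain m where m: "ivl_int v a b = ennreal m" "0 < m" using weight_ivl_int assms by blast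
  have "ivl_int (\<lambda>y. f y * ennreal (v y)) a b
      = ivl_int (\<lambda>y. f y * ennreal (v y)) a b / ivl_int v a b * ivl_int v a b"
    using m by (simp add: ennreal_divide_times[symmetric] divide_ennreal_def mult.assoc ennreal_mult[symmetric] inverse_ennreal)
  also have "\<dots> \<le> wmax v f x * ivl_int v a b"
    by (intro mult_right_mono wmax_ge assms) auto
  finally show ?thesis .
qed

lemma borel_measurable_wmax [measurable]: "wmax v f \<in> borel_measurable borel"
  unfolding wmax_def by (intro borel_measurable_SUP countable_rat_ivls) (auto simp: split_beta)

text \<open>The factor 2 is the overlap in \<open>interval_subcover_overlap2\<close>. The covering
  argument compares no interval with a dilated one, so the constant is the same for all weights;
  Lerner's estimate relies on this.\<close>

lemma wmax_weak_type:
  assumes v: "weight v" and [measurable]: "f \<in> borel_measurable borel" and lam: "0 < l"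
  shows "(\<integral>\<^sup>+x. ennreal (v x) * indicator {x. ennreal l < wmax v f x} x \<partial>lborel)
    \<le> ennreal (2 / l) * (\<integral>\<^sup>+x. f x * ennreal (v x) \<partial>lborel)"
proof -
  note [measurable] = weight_measurable[OF v]
  define \<mu> where "\<mu> = density lborel (\<lambda>x. ennreal (v x))"
  have [measurable_cong, simp]: "sets \<mu> = sets borel" by (simp add: \<mu>_def)
  have em: "emeasure \<mu> A = (\<integral>\<^sup>+x. ennreal (v x) * indicator A x \<partial>lborel)" if "A \<in> sets borel" for A
    using that by (simp add: \<mu>_def emeasure_density)
  let ?B = "{(a, b)\<in>rat_ivls. ennreal l * ivl_int v a b \<le> ivl_int (\<lambda>y. f y * ennreal (v y)) a b}"
  let ?Z = "\<integral>\<^sup>+x. f x * ennreal (v x) \<partial>lborel"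
  have fin: "emeasure \<mu> (\<Union>(a, b)\<in>S. {a<..<b}) \<le> ennreal (2 / l) * ?Z" if S: "finite S" "S \<subseteq> ?B" for S
  proof -
    obtain T where T: "T \<subseteq> S" "(\<Union>(a, b)\<in>T. {a<..<b}) = (\<Union>(a, b)\<in>S. {a<..<b})"
      "\<And>x. card {I\<in>T. x \<in> {fst I<..<snd I}} \<le> 2"
      using interval_subcover_overlap2[OF S(1)] by blast
    have finT: "finite T" using T S finite_subset by auto
    have "emeasure \<mu> (\<Union>(a, b)\<in>S. {a<..<b}) = emeasure \<mu> (\<Union>I\<in>T. {fst I<..<snd I})"
      using T by (simp add: split_beta)
    also have "\<dots> \<le> (\<Sum>I\<in>T. emeasure \<mu> {fst I<..<snd I})"
      by (intro emeasure_subadditive_finite finT) auto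
    also have "\<dots> \<le> (\<Sum>I\<in>T. ennreal (1 / l) * ivl_int (\<lambda>y. f y * ennreal (v y)) (fst I) (snd I))"
    proof (intro sum_mono)
      fix I assume "I \<in> T"
      then have "ennreal l * ivl_int v (fst I) (snd I) \<le> ivl_int (\<lambda>y. f y * ennreal (v y)) (fst I) (snd I)"
        using T S by auto
      then have "ennreal (1 / l) * (ennreal l * ivl_int v (fst I) (snd I))
          \<le> ennreal (1 / l) * ivl_int (\<lambda>y. f y * ennreal (v y)) (fst I) (snd I)"
        by (rule mult_left_mono) simp
      then show "emeasure \<mu> {fst I<..<snd I} \<le> ennreal (1 / l) * ivl_int (\<lambda>y. f y * ennreal (v y)) (fst I) (snd I)"
        using lam by (simp add: em ivl_int_def mult.assoc[symmetric] ennreal_mult[symmetric])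
    qed
    also have "\<dots> = ennreal (1 / l) * (\<integral>\<^sup>+x. (\<Sum>I\<in>T. f x * ennreal (v x) * indicator {fst I<..<snd I} x) \<partial>lborel)"
      unfolding ivl_int_def by (subst nn_integral_sum) (auto simp: sum_distrib_left)
    also have "\<dots> \<le> ennreal (1 / l) * (\<integral>\<^sup>+x. 2 * (f x * ennreal (v x)) \<partial>lborel)"
    proof (intro mult_left_mono nn_integral_mono)
      fix x
      have "(\<Sum>I\<in>T. indicator {fst I<..<snd I} x :: ennreal) = of_nat (card {I\<in>T. x \<in> {fst I<..<snd I}})"
        using finT by (simp add: indicator_def sum.If_cases Int_def)
      also have "\<dots> \<le> of_nat 2" using T(3) by (rule of_nat_mono)
      finally have "f x * ennreal (v x) * (\<Sum>I\<in>T. indicator {fst I<..<snd I} x) \<le> f x * ennreal (v x) * 2"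
        by (intro mult_left_mono) auto
      then show "(\<Sum>I\<in>T. f x * ennreal (v x) * indicator {fst I<..<snd I} x) \<le> 2 * (f x * ennreal (v x))"
        by (simp add: sum_distrib_left mult_ac)
    qed simp
    also have "\<dots> = ennreal (1 / l) * 2 * ?Z" by (simp add: nn_integral_cmult mult.assoc)
    also have "ennreal (1 / l) * 2 = ennreal (2 / l)"
      using lam ennreal_mult[of "1 / l" 2] by simp
    finally show ?thesis .
  qed
  have sub: "{x. ennreal l < wmax v f x} \<subseteq> (\<Union>(a, b)\<in>?B. {a<..<b})"
  proof
    fix x assume "x \<in> {x. ennreal l < wmax v f x}"
    then obtain a b where ab: "(a, b) \<in> rat_ivls"
      "ennreal l < indicator {a<..<b} x * (ivl_int (\<lambda>y. f y * ennreal (v y)) a b / ivl_int v a b)"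
      unfolding wmax_def less_SUP_iff by auto
    then have x: "x \<in> {a<..<b}" by (auto split: split_indicator_asm)
    obtain m where m: "ivl_int v a b = ennreal m" "0 < m" using weight_ivl_int v ab by blast
    have "ennreal l * ivl_int v a b \<le> ivl_int (\<lambda>y. f y * ennreal (v y)) a b / ivl_int v a b * ivl_int v a b"
      using ab x by (intro mult_right_mono) auto
    also have "\<dots> = ivl_int (\<lambda>y. f y * ennreal (v y)) a b"
      using m by (simp add: divide_ennreal_def mult.assoc ennreal_mult[symmetric] inverse_ennreal)
    finally show "x \<in> (\<Union>(a, b)\<in>?B. {a<..<b})" using ab x by blast
  qed
  have cB: "countable ?B" by (rule countable_subset[OF _ countable_rat_ivls]) auto
  have "emeasure \<mu> (\<Union>(a, b)\<in>?B. {a<..<b}) \<le> ennreal (2 / l) * ?Z"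
  proof (cases "?B = {}")
    case False
    \<comment> \<open>The bound \<open>fin\<close> concerns finite families. An enumeration exhausts
      the countable family by finite ones, and continuity from below passes to the limit.\<close>
    define e where "e = from_nat_into ?B"
    have e: "range e = ?B" unfolding e_def using False cB by (rule range_from_nat_into)
    define A where "A n = (\<Union>(a, b)\<in>e ` {..n}. {a<..<b})" for n
    have "(\<Union>q\<in>range e. g q) = (\<Union>n. \<Union>q\<in>e ` {..n}. g q)" for g :: "_ \<Rightarrow> real set"
      by force
    then have "(\<Union>(a, b)\<in>?B. {a<..<b}) = (\<Union>n. A n)" unfolding A_def e[symmetric] .
    also have "emeasure \<mu> \<dots> = (SUP n. emeasure \<mu> (A n))"
    proof (rule SUP_emeasure_incseq[symmetric])
      show "incseq A" unfolding A_def incseq_def by (intro allI impI UN_mono image_mono) auto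
    qed (auto simp: A_def split_beta)
    also have "\<dots> \<le> ennreal (2 / l) * ?Z"
      unfolding A_def by (intro SUP_least fin) (use e in auto)
    finally show ?thesis .
  qed (simp only: UN_empty emeasure_empty zero_le)
  moreover have "(\<Union>(a, b)\<in>?B. {a<..<b}) \<in> sets \<mu>"
    by (auto simp: split_beta intro!: sets.countable_UN'[OF cB])
  ultimately have "emeasure \<mu> {x. ennreal l < wmax v f x} \<le> ennreal (2 / l) * ?Z"
    using emeasure_mono[OF sub] order_trans by blast
  then show ?thesis by (subst (asm) em) auto
qed

text \<open>The part of \<open>f\<close> that does not exceed \<open>c\<close> adds at most
  \<open>c\<close> to any average.\<close>

lemma wmax_truncate:
  assumes v: "weight v" and [measurable]: "f \<in> borel_measurable borel"
  shows "wmax v f x \<le> wmax v (\<lambda>y. f y * indicator {y. c < f y} y) x + c"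
proof (rule wmax_le)
  note [measurable] = weight_measurable[OF v]
  fix a b assume ab: "(a, b) \<in> rat_ivls" "x \<in> {a<..<b}"
  obtain m where m: "ivl_int v a b = ennreal m" "0 < m" using weight_ivl_int v ab by blast
  have "ivl_int (\<lambda>y. f y * ennreal (v y)) a b
     \<le> ivl_int (\<lambda>y. f y * indicator {y. c < f y} y * ennreal (v y) + c * ennreal (v y)) a b"
    by (intro ivl_int_mono) (auto split: split_indicator intro!: mult_right_mono)
  also have "\<dots> = ivl_int (\<lambda>y. f y * indicator {y. c < f y} y * ennreal (v y)) a b + c * ivl_int v a b"
    unfolding ivl_int_def by (simp add: distrib_right nn_integral_add nn_integral_cmult mult.assoc)
  finally have "ivl_int (\<lambda>y. f y * ennreal (v y)) a b / ivl_int v a b \<le>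
    (ivl_int (\<lambda>y. f y * indicator {y. c < f y} y * ennreal (v y)) a b + c * ivl_int v a b) / ivl_int v a b"
    by (rule divide_right_mono_ennreal)
  also have "\<dots> = ivl_int (\<lambda>y. f y * indicator {y. c < f y} y * ennreal (v y)) a b / ivl_int v a b + c"
    using m by (simp add: divide_ennreal_def distrib_right mult.assoc ennreal_mult[symmetric] inverse_ennreal)
  also have "\<dots> \<le> wmax v (\<lambda>y. f y * indicator {y. c < f y} y) x + c"
    using ab by (intro add_right_mono wmax_ge)
  finally show "ivl_int (\<lambda>y. f y * ennreal (v y)) a b / ivl_int v a b \<le>
    wmax v (\<lambda>y. f y * indicator {y. c < f y} y) x + c" .
qed

text \<open>Marcinkiewicz interpolation between the weak type bound and the trivial bound for
  bounded functions. The weak bound at level \<open>l / 2\<close>, applied to the part of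
  \<open>f\<close> above \<open>l / 2\<close>, gives the factor \<open>4 / l\<close>; integrating
  \<open>l powr (p - 2)\<close> up to \<open>2 * f x\<close> gives the rest of the constant.\<close>

lemma wmax_strong_type:
  assumes v: "weight v" and [measurable]: "f \<in> borel_measurable borel" and p: "1 < p"
  shows "(\<integral>\<^sup>+x. wmax v f x \<up> p * ennreal (v x) \<partial>lborel)
    \<le> ennreal (4 * p / (p - 1) * 2 powr (p - 1)) * (\<integral>\<^sup>+x. f x \<up> p * ennreal (v x) \<partial>lborel)"
proof -
  note [measurable] = weight_measurable[OF v]
  have v0: "0 \<le> v x" for x using weight_pos[OF v] by (simp add: less_imp_le)
  have "(\<integral>\<^sup>+x. wmax v f x \<up> p * ennreal (v x) \<partial>lborel)
    = (\<integral>\<^sup>+x. (\<integral>\<^sup>+l. ennreal (p * l powr (p - 1)) * indicator {0<..} l * indicator {l. ennreal l < wmax v f x} l * ennreal (v x) \<partial>lborel) \<partial>lborel)"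
    using p by (subst nn_integral_multc) (auto simp: nn_integral_powr_Ioc)
  also have "\<dots> = (\<integral>\<^sup>+l. (\<integral>\<^sup>+x. ennreal (p * l powr (p - 1)) * indicator {0<..} l * indicator {l. ennreal l < wmax v f x} l * ennreal (v x) \<partial>lborel) \<partial>lborel)"
    by (rule lborel_pair.Fubini'[symmetric]) measurable
  also have "\<dots> \<le> (\<integral>\<^sup>+l. (\<integral>\<^sup>+x. ennreal (4 * p * l powr (p - 2)) * indicator {0<..} l * indicator {l. ennreal l < 2 * f x} l * (f x * ennreal (v x)) \<partial>lborel) \<partial>lborel)"
  proof (rule nn_integral_mono)
    fix l :: real
    show "(\<integral>\<^sup>+x. ennreal (p * l powr (p - 1)) * indicator {0<..} l * indicator {l. ennreal l < wmax v f x} l * ennreal (v x) \<partial>lborel)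
      \<le> (\<integral>\<^sup>+x. ennreal (4 * p * l powr (p - 2)) * indicator {0<..} l * indicator {l. ennreal l < 2 * f x} l * (f x * ennreal (v x)) \<partial>lborel)"
    proof (cases "0 < l")
      case l: True
      let ?g = "\<lambda>y. f y * indicator {y. ennreal (l / 2) < f y} y"
      have split: "ennreal l = ennreal (l / 2) + ennreal (l / 2)"
        using l by (simp add: ennreal_plus[symmetric] del: ennreal_plus)
      have "(\<integral>\<^sup>+x. ennreal (p * l powr (p - 1)) * indicator {0<..} l * indicator {l. ennreal l < wmax v f x} l * ennreal (v x) \<partial>lborel)
        = ennreal (p * l powr (p - 1)) * (\<integral>\<^sup>+x. ennreal (v x) * indicator {x. ennreal l < wmax v f x} x \<partial>lborel)"
        using l by (subst nn_integral_cmult[symmetric]) (auto intro!: nn_integral_cong split: split_indicator)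
      also have "\<dots> \<le> ennreal (p * l powr (p - 1)) * (\<integral>\<^sup>+x. ennreal (v x) * indicator {x. ennreal (l / 2) < wmax v ?g x} x \<partial>lborel)"
      proof (rule mult_left_mono, rule nn_integral_mono)
        fix x
        \<comment> \<open>By \<open>wmax_truncate\<close> the low part of \<open>f\<close> accounts
          for at most half of the level, so the high part must account for the other half.\<close>
        have "ennreal (l / 2) < wmax v ?g x" if "ennreal l < wmax v f x"
        proof (rule ccontr)
          assume "\<not> ?thesis"
          then have "wmax v ?g x + ennreal (l / 2) \<le> ennreal l"
            unfolding split by (intro add_right_mono) simp
          with wmax_truncate[OF v, of f x "ennreal (l / 2)"] that show False by simp
        qed
        then show "ennreal (v x) * indicator {x. ennreal l < wmax v f x} x \<le> ennreal (v x) * indicator {x. ennreal (l / 2) < wmax v ?g x} x"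
          by (auto split: split_indicator)
      qed simp
      also have "\<dots> \<le> ennreal (p * l powr (p - 1)) * (ennreal (2 / (l / 2)) * (\<integral>\<^sup>+x. ?g x * ennreal (v x) \<partial>lborel))"
        using l by (intro mult_left_mono wmax_weak_type v) auto
      also have "\<dots> = ennreal (4 * p * l powr (p - 2)) * (\<integral>\<^sup>+x. ?g x * ennreal (v x) \<partial>lborel)"
      proof -
        have "l powr (p - 1) = l * l powr (p - 2)"
          using l powr_add[of l 1 "p - 2"] by simp
        then have "p * l powr (p - 1) * (2 / (l / 2)) = 4 * p * l powr (p - 2)" using l by simp
        then show ?thesis using l p by (simp add: mult.assoc[symmetric] ennreal_mult[symmetric] del: divide_divide_eq_right)
      qed
      also have "\<dots> = (\<integral>\<^sup>+x. ennreal (4 * p * l powr (p - 2)) * indicator {0<..} l * indicator {l. ennreal l < 2 * f x} l * (f x * ennreal (v x)) \<partial>lborel)"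
      proof -
        have "ennreal (l / 2) < f x \<longleftrightarrow> ennreal l < 2 * f x" for x
        proof (cases "f x")
          case (real r)
          then show ?thesis using l by (subst ennreal_numeral[symmetric]) (auto simp: ennreal_mult[symmetric] ennreal_less_iff simp del: ennreal_numeral)
        qed (auto simp: ennreal_mult_top)
        then show ?thesis using l
          by (subst nn_integral_cmult[symmetric]) (auto intro!: nn_integral_cong split: split_indicator)
      qed
      finally show ?thesis .
    qed simp
  qed
  also have "\<dots> = (\<integral>\<^sup>+x. (\<integral>\<^sup>+l. ennreal (4 * p * l powr (p - 2)) * indicator {0<..} l * indicator {l. ennreal l < 2 * f x} l * (f x * ennreal (v x)) \<partial>lborel) \<partial>lborel)"
    by (rule lborel_pair.Fubini') measurable
  also have "\<dots> = (\<integral>\<^sup>+x. ennreal (4 * p / (p - 1)) * (2 * f x) \<up> (p - 1) * (f x * ennreal (v x)) \<partial>lborel)"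
  proof (intro nn_integral_cong)
    fix x
    have "(\<integral>\<^sup>+l. ennreal (4 * p * l powr (p - 2)) * indicator {0<..} l * indicator {l. ennreal l < 2 * f x} l * (f x * ennreal (v x)) \<partial>lborel)
      = (\<integral>\<^sup>+l. ennreal (4 * p / (p - 1)) * (ennreal ((p - 1) * l powr (p - 1 - 1)) * indicator {0<..} l * indicator {l. ennreal l < 2 * f x} l) * (f x * ennreal (v x)) \<partial>lborel)"
      using p by (intro nn_integral_cong) (simp add: mult.assoc[symmetric] ennreal_mult[symmetric])
    also have "\<dots> = ennreal (4 * p / (p - 1)) * (2 * f x) \<up> (p - 1) * (f x * ennreal (v x))"
      using p nn_integral_powr_Ioc[of "p - 1" "2 * f x"] by (simp add: nn_integral_multc nn_integral_cmult)
    finally show "(\<integral>\<^sup>+l. ennreal (4 * p * l powr (p - 2)) * indicator {0<..} l * indicator {l. ennreal l < 2 * f x} l * (f x * ennreal (v x)) \<partial>lborel)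
      = ennreal (4 * p / (p - 1)) * (2 * f x) \<up> (p - 1) * (f x * ennreal (v x))" .
  qed
  also have "\<dots> = (\<integral>\<^sup>+x. ennreal (4 * p / (p - 1) * 2 powr (p - 1)) * (f x \<up> p * ennreal (v x)) \<partial>lborel)"
  proof (intro nn_integral_cong)
    fix x
    have "2 \<up> (p - 1) = ennreal (2 powr (p - 1))"
      using ennreal_powr_ennreal[of 2 "p - 1"] by simp
    moreover have "f x \<up> (p - 1) * f x = f x \<up> p"
      using ennreal_powr_add[of "f x" "p - 1" 1] by simp
    moreover have "ennreal (4 * p / (p - 1)) * (2 * f x) \<up> (p - 1) * (f x * ennreal (v x))
       = (ennreal (4 * p / (p - 1)) * 2 \<up> (p - 1)) * ((f x \<up> (p - 1) * f x) * ennreal (v x))"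
      by (simp add: ennreal_powr_mult mult_ac)
    ultimately show "ennreal (4 * p / (p - 1)) * (2 * f x) \<up> (p - 1) * (f x * ennreal (v x))
      = ennreal (4 * p / (p - 1) * 2 powr (p - 1)) * (f x \<up> p * ennreal (v x))"
      using p by (simp only: ennreal_mult'' powr_ge_zero)
  qed
  also have "\<dots> = ennreal (4 * p / (p - 1) * 2 powr (p - 1)) * (\<integral>\<^sup>+x. f x \<up> p * ennreal (v x) \<partial>lborel)"
    by (simp add: nn_integral_cmult)
  finally show ?thesis .
qed


section \<open>Muckenhoupt's theorem\<close>

text \<open>The A_p condition with constant at most \<open>K\<close>, multiplied by the
  \<open>p\<close>-th power of the length so that integrals replace averages. The dual weight is
  also required to be a weight, which makes the notion symmetric under duality.\<close>

definition muckenhoupt :: "real \<Rightarrow> real \<Rightarrow> (real \<Rightarrow> real) \<Rightarrow> bool" where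
  "muckenhoupt p K w \<longleftrightarrow> weight w \<and> weight (\<lambda>x. w x powr (- 1 / (p - 1))) \<and>
     (\<forall>(a, b)\<in>rat_ivls. ivl_int w a b * ivl_int (\<lambda>x. w x powr (- 1 / (p - 1))) a b \<up> (p - 1)
        \<le> ennreal K * ennreal ((b - a) powr p))"

lemma muckenhoupt_weight: "muckenhoupt p K w \<Longrightarrow> weight w"
  and muckenhoupt_dual_weight: "muckenhoupt p K w \<Longrightarrow> weight (\<lambda>x. w x powr (- 1 / (p - 1)))"
  and muckenhoupt_bound: "muckenhoupt p K w \<Longrightarrow> (a, b) \<in> rat_ivls \<Longrightarrow>
    ivl_int w a b * ivl_int (\<lambda>x. w x powr (- 1 / (p - 1))) a b \<up> (p - 1) \<le> ennreal K * ennreal ((b - a) powr p)"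
  unfolding muckenhoupt_def by auto

lemma weight_1: "weight (\<lambda>_. 1)"
  unfolding weight_def by (auto simp: ivl_int_const[of _ _ 1, simplified] rat_ivls_less less_imp_le)

lemma muckenhoupt_1: "1 < p \<Longrightarrow> muckenhoupt p 1 (\<lambda>_. 1)"
  unfolding muckenhoupt_def
proof (safe intro!: weight_1)
  fix a b assume p: "1 < p" and "(a, b) \<in> rat_ivls"
  then have ab: "a < b" by (simp add: rat_ivls_less)
  then have "ivl_int (\<lambda>_. ennreal 1) a b = ennreal (b - a)"
    using ivl_int_const[of a b 1] by simp
  moreover have "(b - a) * (b - a) powr (p - 1) = (b - a) powr p"
    using ab powr_add[of "b - a" 1 "p - 1"] by simp
  ultimately show "ivl_int (\<lambda>_. ennreal 1) a b * ivl_int (\<lambda>x. ennreal (1 powr (- 1 / (p - 1)))) a b \<up> (p - 1)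
    \<le> ennreal 1 * ennreal ((b - a) powr p)"
    using ab by (simp add: ennreal_powr_ennreal ennreal_mult[symmetric])
qed (use weight_1 in simp)

text \<open>Raising the defining inequality to the power \<open>1 / (p - 1)\<close> exchanges the
  two weights, because the dual of the dual weight, taken for the conjugate exponent, is
  \<open>w\<close> again.\<close>

lemma muckenhoupt_dual:
  assumes p: "1 < p" and w: "muckenhoupt p K w"
  shows "muckenhoupt (p / (p - 1)) (K powr (1 / (p - 1))) (\<lambda>x. w x powr (- 1 / (p - 1)))"
proof -
  have pp: "p / (p - 1) - 1 = 1 / (p - 1)" using p by (simp add: field_simps)
  have inv: "(w x powr (- 1 / (p - 1))) powr (- 1 / (p / (p - 1) - 1)) = w x" for x
  proof -
    have "- 1 / (p - 1) * (- 1 / (1 / (p - 1))) = 1" using p by (simp add: field_simps)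
    then show ?thesis
      unfolding pp powr_powr using p weight_pos[OF muckenhoupt_weight[OF w], of x] by (simp only: powr_one)
  qed
  show ?thesis
    unfolding muckenhoupt_def inv
  proof (safe intro!: muckenhoupt_weight[OF w] muckenhoupt_dual_weight[OF w])
    fix a b assume ab: "(a, b) \<in> rat_ivls"
    let ?W = "ivl_int w a b" and ?S = "ivl_int (\<lambda>x. w x powr (- 1 / (p - 1))) a b"
    have "?W \<up> (1 / (p - 1)) * ?S = (?W * ?S \<up> (p - 1)) \<up> (1 / (p - 1))"
      using p by (simp add: ennreal_powr_mult)
    also have "\<dots> \<le> (ennreal K * ennreal ((b - a) powr p)) \<up> (1 / (p - 1))"
      using p by (intro ennreal_powr_mono muckenhoupt_bound w ab) auto
    also have "\<dots> \<le> ennreal (K powr (1 / (p - 1))) * ennreal ((b - a) powr (p / (p - 1)))"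
      by (cases "0 \<le> K") (auto simp: ennreal_powr_mult ennreal_powr_ennreal powr_powr ennreal_neg)
    finally show "?S * ?W \<up> (p / (p - 1) - 1) \<le> ennreal (K powr (1 / (p - 1))) * ennreal ((b - a) powr (p / (p - 1)))"
      by (simp add: pp mult.commute)
  qed
qed

text \<open>Lerner's estimate, which reduces Muckenhoupt's theorem to the measure-independent bound \<open>wmax_strong_type\<close>.\<close>

lemma wmax_muckenhoupt_pointwise:
  assumes p: "1 < p" and w: "muckenhoupt p K w" and [measurable]: "f \<in> borel_measurable borel"
  defines "\<sigma> \<equiv> \<lambda>x. w x powr (- 1 / (p - 1))"
  defines "N \<equiv> wmax \<sigma> (\<lambda>y. f y * ennreal (1 / \<sigma> y))"
  shows "wmax (\<lambda>_. 1) f x \<up> (p - 1) \<le> ennreal K * wmax w (\<lambda>y. N y \<up> (p - 1) * ennreal (1 / w y)) x"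
proof -
  have ww: "weight w" and ws: "weight \<sigma>"
    using muckenhoupt_weight[OF w] muckenhoupt_dual_weight[OF w] by (auto simp: \<sigma>_def)
  note [measurable] = weight_measurable[OF ww] weight_measurable[OF ws]
  have [measurable]: "N \<in> borel_measurable borel" unfolding N_def by measurable
  note wpos = weight_pos[OF ww] and spos = weight_pos[OF ws]
  define H where "H = (\<lambda>y. N y \<up> (p - 1) * ennreal (1 / w y))"
  define z where "z = ennreal K * wmax w H x"
  have "wmax (\<lambda>_. 1) f x \<le> z \<up> (1 / (p - 1))"
  proof (rule wmax_le)
    fix a b assume ab: "(a, b) \<in> rat_ivls" "x \<in> {a<..<b}"
    define l where "l = b - a"
    have l: "0 < l" using rat_ivls_less[OF ab(1)] by (simp add: l_def)
    obtain W where W: "ivl_int w a b = ennreal W" "0 < W" using weight_ivl_int ww ab(1) by blast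
    obtain S where S: "ivl_int \<sigma> a b = ennreal S" "0 < S" using weight_ivl_int ws ab(1) by blast
    define X where "X = ivl_int f a b"
    have fs: "f y * ennreal (1 / \<sigma> y) * ennreal (\<sigma> y) = f y" for y
      using spos[of y] by (simp add: mult.assoc ennreal_mult[symmetric])
    \<comment> \<open>\<open>X / ennreal S\<close> is the average of \<open>f / \<sigma>\<close>
      with respect to \<open>\<sigma>\<close>, so it bounds \<open>N\<close> from below on the whole
      interval and not only at \<open>x\<close>. It can therefore be integrated over the interval,
      and the factor \<open>1 / w\<close> in \<open>H\<close> turns the result into an integral
      against \<open>w\<close>.\<close>
    have XS: "X / ennreal S \<le> N y" if "y \<in> {a<..<b}" for y
      using wmax_ge[OF ab(1) that, of "\<lambda>y. f y * ennreal (1 / \<sigma> y)" \<sigma>]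
      by (simp only: fs S X_def N_def)
    have "(X / ennreal S) \<up> (p - 1) * ennreal l = ivl_int (\<lambda>_. (X / ennreal S) \<up> (p - 1)) a b"
      using l by (simp add: ivl_int_const l_def)
    also have "\<dots> \<le> ivl_int (\<lambda>y. H y * ennreal (w y)) a b"
    proof (rule ivl_int_mono)
      fix y assume "y \<in> {a<..<b}"
      then have "(X / ennreal S) \<up> (p - 1) \<le> N y \<up> (p - 1)"
        using p by (intro ennreal_powr_mono XS) auto
      also have "\<dots> = H y * ennreal (w y)"
        unfolding H_def using wpos[of y] by (simp add: mult.assoc ennreal_mult[symmetric])
      finally show "(X / ennreal S) \<up> (p - 1) \<le> H y * ennreal (w y)" .
    qed
    also have "\<dots> \<le> wmax w H x * ennreal W"
      using wmax_ge'[OF ww ab, of H] by (simp only: W)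
    finally have 1: "(X / ennreal S) \<up> (p - 1) * ennreal l \<le> wmax w H x * ennreal W" .
    have 2: "ennreal W * ennreal S \<up> (p - 1) \<le> ennreal K * ennreal (l powr p)"
      using muckenhoupt_bound[OF w ab(1)] W S by (simp add: \<sigma>_def l_def)
    have X: "X = X / ennreal S * ennreal S"
      using S by (simp add: divide_ennreal_def mult.assoc ennreal_mult[symmetric] inverse_ennreal)
    have "X \<up> (p - 1) * ennreal l = ((X / ennreal S) \<up> (p - 1) * ennreal l) * ennreal S \<up> (p - 1)"
      by (subst X) (simp add: ennreal_powr_mult mult_ac)
    also have "\<dots> \<le> (wmax w H x * ennreal W) * ennreal S \<up> (p - 1)"
      by (intro mult_right_mono 1) simp
    also have "\<dots> = wmax w H x * (ennreal W * ennreal S \<up> (p - 1))" by (simp add: mult_ac)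
    also have "\<dots> \<le> wmax w H x * (ennreal K * ennreal (l powr p))"
      by (intro mult_left_mono 2) simp
    finally have 3: "X \<up> (p - 1) * ennreal l \<le> z * ennreal (l powr p)" by (simp add: z_def mult_ac)
    have "(X / ennreal l) \<up> (p - 1) = X \<up> (p - 1) * ennreal (l powr (- (p - 1)))"
      unfolding powr_minus
      using l by (simp add: divide_ennreal_def inverse_ennreal ennreal_powr_mult ennreal_powr_ennreal inverse_powr)
    also have "l powr (- (p - 1)) = l * l powr (- p)" using l powr_add[of l 1 "- p"] by simp
    also have "X \<up> (p - 1) * ennreal (l * l powr (- p)) = (X \<up> (p - 1) * ennreal l) * ennreal (l powr (- p))"
      using l by (simp add: ennreal_mult mult.assoc)
    also have "\<dots> \<le> (z * ennreal (l powr p)) * ennreal (l powr (- p))"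
      by (intro mult_right_mono 3) simp
    also have "\<dots> = z" using l by (simp add: mult.assoc ennreal_mult[symmetric] powr_add[symmetric])
    finally have "X / ennreal l \<le> z \<up> (1 / (p - 1))"
      using p by (simp add: ennreal_le_powr_iff)
    moreover have "ivl_int (\<lambda>y. f y * ennreal 1) a b / ivl_int (\<lambda>y. ennreal 1) a b = X / ennreal l"
      using l by (simp add: X_def ivl_int_const[of a b 1, simplified] l_def)
    ultimately show "ivl_int (\<lambda>y. f y * ennreal 1) a b / ivl_int (\<lambda>y. ennreal 1) a b \<le> z \<up> (1 / (p - 1))"
      by simp
  qed
  then show ?thesis using p by (simp add: ennreal_le_powr_iff z_def H_def)
qed

text \<open>The power of \<open>K\<close> comes from the pointwise estimate; the other two factors
  are the constants of \<open>wmax_strong_type\<close> for the exponents \<open>p / (p - 1)\<close>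
  and \<open>p\<close>.\<close>

definition muckenhoupt_const :: "real \<Rightarrow> real \<Rightarrow> real" where
  "muckenhoupt_const p K = K powr (p / (p - 1)) * (4 * (p / (p - 1)) / (p / (p - 1) - 1) * 2 powr (p / (p - 1) - 1))
     * (4 * p / (p - 1) * 2 powr (p - 1))"

text \<open>The pointwise estimate is raised to the conjugate exponent \<open>p'\<close>. Then the
  maximal operator of \<open>w\<close> is bounded with exponent \<open>p'\<close> and that of
  \<open>\<sigma>\<close> with exponent \<open>p\<close>. Both bounds are the same for all weights,
  so \<open>w\<close> enters the constant only through \<open>K\<close>.\<close>

lemma muckenhoupt_theorem:
  assumes p: "1 < p" and w: "muckenhoupt p K w" and [measurable]: "f \<in> borel_measurable borel"
  shows "(\<integral>\<^sup>+x. wmax (\<lambda>_. 1) f x \<up> p * ennreal (w x) \<partial>lborel)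
    \<le> ennreal (muckenhoupt_const p K) * (\<integral>\<^sup>+x. f x \<up> p * ennreal (w x) \<partial>lborel)"
proof -
  define \<sigma> where "\<sigma> = (\<lambda>x. w x powr (- 1 / (p - 1)))"
  define N where "N = wmax \<sigma> (\<lambda>y. f y * ennreal (1 / \<sigma> y))"
  define H where "H = (\<lambda>y. N y \<up> (p - 1) * ennreal (1 / w y))"
  define p' where "p' = p / (p - 1)"
  have p': "1 < p'" "(p - 1) * p' = p" using p by (auto simp: p'_def field_simps)
  have ww: "weight w" and ws: "weight \<sigma>"
    using muckenhoupt_weight[OF w] muckenhoupt_dual_weight[OF w] by (auto simp: \<sigma>_def)
  note [measurable] = weight_measurable[OF ww] weight_measurable[OF ws]
  have [measurable]: "N \<in> borel_measurable borel" unfolding N_def by measurable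
  have [measurable]: "H \<in> borel_measurable borel" unfolding H_def by measurable
  note wpos = weight_pos[OF ww] and spos = weight_pos[OF ws]
  define C1 C2 where "C1 = 4 * p' / (p' - 1) * 2 powr (p' - 1)" and "C2 = 4 * p / (p - 1) * 2 powr (p - 1)"
  have const: "muckenhoupt_const p K = K powr p' * C1 * C2"
    unfolding muckenhoupt_const_def p'_def C1_def C2_def ..
  have C: "0 \<le> C1" "0 \<le> C2" using p p' by (auto simp: C1_def C2_def)
  have "(\<integral>\<^sup>+x. wmax (\<lambda>_. 1) f x \<up> p * ennreal (w x) \<partial>lborel)
     \<le> (\<integral>\<^sup>+x. ennreal (K powr p') * (wmax w H x \<up> p' * ennreal (w x)) \<partial>lborel)"
  proof (rule nn_integral_mono)
    fix x
    have "wmax (\<lambda>_. 1) f x \<up> p = (wmax (\<lambda>_. 1) f x \<up> (p - 1)) \<up> p'"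
      by (simp add: ennreal_powr_powr p')
    also have "\<dots> \<le> (ennreal K * wmax w H x) \<up> p'"
      using wmax_muckenhoupt_pointwise[OF p w, of f x] p'
      by (intro ennreal_powr_mono) (auto simp: H_def N_def \<sigma>_def)
    also have "\<dots> \<le> ennreal (K powr p') * wmax w H x \<up> p'"
      by (cases "0 \<le> K") (auto simp: ennreal_powr_mult ennreal_powr_ennreal ennreal_neg)
    finally have "wmax (\<lambda>_. 1) f x \<up> p * ennreal (w x) \<le> ennreal (K powr p') * wmax w H x \<up> p' * ennreal (w x)"
      by (rule mult_right_mono) simp
    then show "wmax (\<lambda>_. 1) f x \<up> p * ennreal (w x) \<le> ennreal (K powr p') * (wmax w H x \<up> p' * ennreal (w x))"
      by (simp add: mult.assoc)
  qed
  also have "\<dots> = ennreal (K powr p') * (\<integral>\<^sup>+x. wmax w H x \<up> p' * ennreal (w x) \<partial>lborel)"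
    by (simp add: nn_integral_cmult)
  also have "\<dots> \<le> ennreal (K powr p') * (ennreal C1 * (\<integral>\<^sup>+x. H x \<up> p' * ennreal (w x) \<partial>lborel))"
    unfolding C1_def by (intro mult_left_mono wmax_strong_type ww p') auto
  also have "(\<integral>\<^sup>+x. H x \<up> p' * ennreal (w x) \<partial>lborel) = (\<integral>\<^sup>+x. N x \<up> p * ennreal (\<sigma> x) \<partial>lborel)"
  proof (rule nn_integral_cong)
    fix x
    \<comment> \<open>Here the measure changes from density \<open>w\<close> to density
      \<open>\<sigma>\<close>; the identity
      \<open>(1 / \<sigma> x) powr p * \<sigma> x = w x\<close> below changes it back.\<close>
    have "(1 / w x) powr p' * w x = \<sigma> x"
    proof -
      have "(1 / w x) powr p' * w x = w x powr (- p') * w x powr 1"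
        using wpos[of x] by (simp add: powr_minus powr_divide divide_simps)
      also have "\<dots> = w x powr (- p' + 1)" by (rule powr_add[symmetric])
      also have "- p' + 1 = - 1 / (p - 1)" using p by (simp add: p'_def field_simps)
      finally show ?thesis by (simp add: \<sigma>_def)
    qed
    then show "H x \<up> p' * ennreal (w x) = N x \<up> p * ennreal (\<sigma> x)"
      unfolding H_def using wpos[of x] p'
      by (simp add: ennreal_powr_mult ennreal_powr_powr ennreal_powr_ennreal mult.assoc ennreal_mult[symmetric])
  qed
  also have "ennreal (K powr p') * (ennreal C1 * (\<integral>\<^sup>+x. N x \<up> p * ennreal (\<sigma> x) \<partial>lborel))
    \<le> ennreal (K powr p') * (ennreal C1 * (ennreal C2 * (\<integral>\<^sup>+x. (f x * ennreal (1 / \<sigma> x)) \<up> p * ennreal (\<sigma> x) \<partial>lborel)))"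
    unfolding C2_def N_def by (intro mult_left_mono wmax_strong_type ws p) auto
  also have "(\<integral>\<^sup>+x. (f x * ennreal (1 / \<sigma> x)) \<up> p * ennreal (\<sigma> x) \<partial>lborel) = (\<integral>\<^sup>+x. f x \<up> p * ennreal (w x) \<partial>lborel)"
  proof (rule nn_integral_cong)
    fix x
    have "(1 / \<sigma> x) powr p * \<sigma> x = w x"
    proof -
      have "(1 / \<sigma> x) powr p * \<sigma> x = \<sigma> x powr (- p) * \<sigma> x powr 1"
        using spos[of x] by (simp add: powr_minus powr_divide divide_simps)
      also have "\<dots> = \<sigma> x powr (- p + 1)" by (rule powr_add[symmetric])
      also have "\<dots> = w x powr (- 1 / (p - 1) * (- p + 1))" by (simp add: \<sigma>_def powr_powr)
      also have "- 1 / (p - 1) * (- p + 1) = 1" using p by (simp add: field_simps)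
      finally show ?thesis using wpos[of x] by simp
    qed
    then show "(f x * ennreal (1 / \<sigma> x)) \<up> p * ennreal (\<sigma> x) = f x \<up> p * ennreal (w x)"
      using spos[of x] by (simp add: ennreal_powr_mult ennreal_powr_ennreal mult.assoc ennreal_mult[symmetric])
  qed
  finally show ?thesis
    using C const by (simp only: const ennreal_mult powr_ge_zero mult_nonneg_nonneg mult.assoc)
qed

section \<open>Muckenhoupt weights from A_1 weights\<close>

text \<open>The A_1 condition: an average of \<open>u\<close> is at most \<open>K\<close> times
  almost every value on the interval. The exceptional null set is allowed because the weights built
  later agree with their majorants only almost everywhere.\<close>

definition A1_weight :: "real \<Rightarrow> (real \<Rightarrow> real) \<Rightarrow> bool" where
  "A1_weight K u \<longleftrightarrow> weight u \<and>
     (\<forall>(a, b)\<in>rat_ivls. AE x in lborel. x \<in> {a<..<b} \<longrightarrow> ivl_int u a b \<le> ennreal (K * (b - a) * u x))"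

text \<open>The easy half of the factorisation of Muckenhoupt weights. On an interval both A_1
  weights are bounded below by multiples of their averages. This bounds the negative power of
  \<open>u\<close> in the weight and of \<open>v\<close> in its dual by constants, and the integrals
  of \<open>v\<close> and \<open>u\<close> remain.\<close>

lemma muckenhoupt_of_A1:
  assumes u: "A1_weight K u" and v: "A1_weight L v" and q: "1 < q"
  shows "muckenhoupt q (K powr (q - 1) * L) (\<lambda>x. u x powr (1 - q) * v x)"
proof -
  have wu: "weight u" and wv: "weight v" using u v by (auto simp: A1_weight_def)
  note [measurable] = weight_measurable[OF wu] weight_measurable[OF wv]
  note up = weight_pos[OF wu] and vp = weight_pos[OF wv]
  define w where "w = (\<lambda>x. u x powr (1 - q) * v x)"
  define \<sigma> where "\<sigma> = (\<lambda>x. w x powr (- 1 / (q - 1)))"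
  have \<sigma>: "\<sigma> x = u x * v x powr (- 1 / (q - 1))" for x
  proof -
    have "(1 - q) * (- 1 / (q - 1)) = 1" using q by (simp add: field_simps)
    then show ?thesis using up[of x] vp[of x]
      unfolding \<sigma>_def w_def by (simp only: powr_mult powr_powr) simp
  qed
  have [measurable]: "w \<in> borel_measurable borel" "\<sigma> \<in> borel_measurable borel"
    unfolding w_def \<sigma>_def by measurable
  have wpos: "0 < w x" and spos: "0 < \<sigma> x" for x
    using up[of x] vp[of x] by (auto simp: w_def \<sigma>_def)
  have key: "ivl_int w a b \<noteq> top \<and> ivl_int \<sigma> a b \<noteq> top \<and>
     ivl_int w a b * ivl_int \<sigma> a b \<up> (q - 1) \<le> ennreal (K powr (q - 1) * L) * ennreal ((b - a) powr q)"
    if ab: "(a, b) \<in> rat_ivls" for a b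
  proof -
    define l where "l = b - a"
    have l: "0 < l" using rat_ivls_less[OF ab(1)] by (simp add: l_def)
    obtain U where U: "ivl_int u a b = ennreal U" "0 < U" using weight_ivl_int wu ab by blast
    obtain V where V: "ivl_int v a b = ennreal V" "0 < V" using weight_ivl_int wv ab by blast
    have AU: "AE x in lborel. x \<in> {a<..<b} \<longrightarrow> U \<le> K * l * u x"
    proof -
      have "AE x in lborel. x \<in> {a<..<b} \<longrightarrow> ivl_int u a b \<le> ennreal (K * (b - a) * u x)"
        using u ab unfolding A1_weight_def by auto
      then show ?thesis
        by eventually_elim (use U in \<open>auto simp: l_def ennreal_le_iff2\<close>)
    qed
    have AV: "AE x in lborel. x \<in> {a<..<b} \<longrightarrow> V \<le> L * l * v x"
    proof -
      have "AE x in lborel. x \<in> {a<..<b} \<longrightarrow> ivl_int v a b \<le> ennreal (L * (b - a) * v x)"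
        using v ab unfolding A1_weight_def by auto
      then show ?thesis
        by eventually_elim (use V in \<open>auto simp: l_def ennreal_le_iff2\<close>)
    qed
    have ex: "\<exists>x\<in>{a<..<b}. P x" if "AE x in lborel. x \<in> {a<..<b} \<longrightarrow> P x" for P
      using AE_lborel_ex_interval[OF that rat_ivls_less[OF ab]] by blast
    \<comment> \<open>An inequality valid almost everywhere holds at some point of the interval;
      there \<open>U\<close> and \<open>u x\<close> are positive, which forces \<open>K\<close> to
      be positive.\<close>
    have K: "0 < K"
    proof -
      obtain x where "U \<le> K * l * u x" using ex[OF AU] by auto
      then have "0 < K * (l * u x)" using U by (simp add: mult.assoc)
      then show ?thesis using mult_pos_pos[OF l up[of x]] by (simp add: zero_less_mult_iff[of K])
    qed
    have L: "0 < L"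
    proof -
      obtain x where "V \<le> L * l * v x" using ex[OF AV] by auto
      then have "0 < L * (l * v x)" using V by (simp add: mult.assoc)
      then show ?thesis using mult_pos_pos[OF l vp[of x]] by (simp add: zero_less_mult_iff[of L])
    qed
    define u0 v0 where "u0 = U / (K * l)" and "v0 = V / (L * l)"
    have pos0: "0 < u0" "0 < v0" using U V K L l by (auto simp: u0_def v0_def)
    have "ivl_int w a b \<le> ivl_int (\<lambda>x. ennreal (u0 powr (1 - q)) * ennreal (v x)) a b"
    proof (rule ivl_int_mono_AE)
      show "AE x in lborel. x \<in> {a<..<b} \<longrightarrow> ennreal (w x) \<le> ennreal (u0 powr (1 - q)) * ennreal (v x)"
        using AU
      proof eventually_elim
        case (elim x)
        show ?case
        proof
          assume "x \<in> {a<..<b}"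
          then have "u0 \<le> u x" using elim K l by (auto simp: u0_def divide_simps mult_ac)
          then have "u x powr (1 - q) \<le> u0 powr (1 - q)" using pos0 q by (intro powr_mono2') auto
          then show "ennreal (w x) \<le> ennreal (u0 powr (1 - q)) * ennreal (v x)"
            using vp[of x] by (simp add: w_def ennreal_mult[symmetric] ennreal_leI mult_right_mono)
        qed
      qed
    qed
    also have "\<dots> = ennreal (u0 powr (1 - q) * V)"
      using V by (simp add: ivl_int_cmult ennreal_mult)
    finally have W: "ivl_int w a b \<le> ennreal (u0 powr (1 - q) * V)" .
    have "ivl_int \<sigma> a b \<le> ivl_int (\<lambda>x. ennreal (v0 powr (- 1 / (q - 1))) * ennreal (u x)) a b"
    proof (rule ivl_int_mono_AE)
      show "AE x in lborel. x \<in> {a<..<b} \<longrightarrow> ennreal (\<sigma> x) \<le> ennreal (v0 powr (- 1 / (q - 1))) * ennreal (u x)"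
        using AV
      proof eventually_elim
        case (elim x)
        show ?case
        proof
          assume "x \<in> {a<..<b}"
          then have "v0 \<le> v x" using elim L l by (auto simp: v0_def divide_simps mult_ac)
          then have "v x powr (- 1 / (q - 1)) \<le> v0 powr (- 1 / (q - 1))"
            using pos0 q by (intro powr_mono2') auto
          then show "ennreal (\<sigma> x) \<le> ennreal (v0 powr (- 1 / (q - 1))) * ennreal (u x)"
            using up[of x] by (simp add: \<sigma> ennreal_mult[symmetric] ennreal_leI mult_right_mono mult.commute)
        qed
      qed
    qed
    also have "\<dots> = ennreal (v0 powr (- 1 / (q - 1)) * U)"
      using U by (simp add: ivl_int_cmult ennreal_mult)
    finally have S: "ivl_int \<sigma> a b \<le> ennreal (v0 powr (- 1 / (q - 1)) * U)" .
    have "ivl_int w a b * ivl_int \<sigma> a b \<up> (q - 1)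
        \<le> ennreal (u0 powr (1 - q) * V) * ennreal (v0 powr (- 1 / (q - 1)) * U) \<up> (q - 1)"
      using q by (intro mult_mono W ennreal_powr_mono S) auto
    also have "\<dots> = ennreal (u0 powr (1 - q) * V * (v0 powr (- 1 / (q - 1)) * U) powr (q - 1))"
      using U V ennreal_powr_ennreal[of "v0 powr (- 1 / (q - 1)) * U" "q - 1"]
        ennreal_mult[of "u0 powr (1 - q) * V" "(v0 powr (- 1 / (q - 1)) * U) powr (q - 1)"]
      by (simp del: ennreal_mult')
    also have "u0 powr (1 - q) * V * (v0 powr (- 1 / (q - 1)) * U) powr (q - 1) = K powr (q - 1) * L * (b - a) powr q"
    proof -
      have "(v0 powr (- 1 / (q - 1)) * U) powr (q - 1) = v0 powr (-1) * U powr (q - 1)"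
        using U q by (simp add: powr_mult powr_powr)
      also have "\<dots> = L * l / V * U powr (q - 1)"
        using V L l by (simp add: v0_def powr_minus)
      finally have 1: "(v0 powr (- 1 / (q - 1)) * U) powr (q - 1) = L * l / V * U powr (q - 1)" .
      have "u0 powr (1 - q) = inverse (u0 powr (q - 1))" using powr_minus[of u0 "q - 1"] by simp
      also have "\<dots> = K powr (q - 1) * l powr (q - 1) / U powr (q - 1)"
        using K l U by (simp add: u0_def powr_divide powr_mult)
      finally have 2: "u0 powr (1 - q) = K powr (q - 1) * l powr (q - 1) / U powr (q - 1)" .
      have "l powr (q - 1) * l = l powr q" using l powr_add[of l "q - 1" 1] by simp
      then show ?thesis unfolding 1 2 l_def[symmetric] using U V by (simp add: field_simps)
    qed
    also have "ennreal (K powr (q - 1) * L * (b - a) powr q) = ennreal (K powr (q - 1) * L) * ennreal ((b - a) powr q)"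
      using L by (simp add: ennreal_mult)
    finally show ?thesis using W S by (auto simp: top_unique)
  qed
  have wx: "u x powr (1 - q) * v x = w x" and \<sigma>x: "w x powr (- 1 / (q - 1)) = \<sigma> x" for x
    by (simp_all add: w_def \<sigma>_def)
  show ?thesis
    unfolding muckenhoupt_def wx \<sigma>x weight_def
    using key wpos spos by (auto simp: less_top)
qed

section \<open>Extrapolation\<close>

lemma suminf_ennreal_half: "(\<Sum>k. ennreal ((1 / 2) ^ k)) = ennreal 2"
proof (rule suminf_ennreal_eq)
  show "(\<lambda>k. (1 / 2 :: real) ^ k) sums 2" using geometric_sums[of "1 / 2 :: real"] by simp
qed simp

lemma pow_powr: "0 < y \<Longrightarrow> (y ^ k) powr p = (y powr p) ^ k" for y :: real
  by (induction k) (simp_all add: powr_mult)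

text \<open>
  With \<open>R = \<Sum>\<^sub>k (4A)\<^sup>-\<^sup>k T\<^sup>k h\<close>, the pointwise bound \<open>R \<le> 2 sup\<^sub>k (2A)\<^sup>-\<^sup>k T\<^sup>k h\<close> makes Minkowski's inequality unnecessary.
\<close>

lemma rubio_de_francia:
  fixes T :: "(real \<Rightarrow> ennreal) \<Rightarrow> real \<Rightarrow> ennreal"
  assumes p: "1 < p" and A: "0 < A"
    and W [measurable]: "W \<in> borel_measurable borel"
    and h [measurable]: "h \<in> borel_measurable borel"
    and meas: "\<And>f. f \<in> borel_measurable borel \<Longrightarrow> T f \<in> borel_measurable borel"
    and bound: "\<And>f. f \<in> borel_measurable borel \<Longrightarrow>
      (\<integral>\<^sup>+x. T f x \<up> p * W x \<partial>lborel) \<le> ennreal (A powr p) * (\<integral>\<^sup>+x. f x \<up> p * W x \<partial>lborel)"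
    and sub: "\<And>c f x. (\<And>k::nat. f k \<in> borel_measurable borel) \<Longrightarrow>
      T (\<lambda>y. \<Sum>k. c k * f k y) x \<le> (\<Sum>k. c k * T (f k) x)"
  obtains R where "R \<in> borel_measurable borel" "\<And>x. h x \<le> R x" "\<And>x. T R x \<le> ennreal (4 * A) * R x"
    "(\<integral>\<^sup>+x. R x \<up> p * W x \<partial>lborel) \<le> ennreal (2 powr (p + 1)) * (\<integral>\<^sup>+x. h x \<up> p * W x \<partial>lborel)"
proof -
  define t where "t k = (T ^^ k) h" for k
  have t0: "t 0 = h" and tS: "t (Suc k) = T (t k)" for k by (simp_all add: t_def)
  have [measurable]: "t k \<in> borel_measurable borel" for k
    by (induction k) (simp_all add: t0 tS meas)
  have tb: "(\<integral>\<^sup>+x. t k x \<up> p * W x \<partial>lborel) \<le> ennreal ((A powr p) ^ k) * (\<integral>\<^sup>+x. h x \<up> p * W x \<partial>lborel)" for k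
  proof (induction k)
    case (Suc k)
    have "(\<integral>\<^sup>+x. t (Suc k) x \<up> p * W x \<partial>lborel) \<le> ennreal (A powr p) * (\<integral>\<^sup>+x. t k x \<up> p * W x \<partial>lborel)"
      unfolding tS by (intro bound) measurable
    also have "\<dots> \<le> ennreal (A powr p) * (ennreal ((A powr p) ^ k) * (\<integral>\<^sup>+x. h x \<up> p * W x \<partial>lborel))"
      by (intro mult_left_mono Suc) simp
    finally show ?case by (simp add: mult.assoc[symmetric] ennreal_mult[symmetric])
  qed (simp add: t0)
  define c where "c k = ennreal ((1 / (4 * A)) ^ k)" for k
  define R where "R x = (\<Sum>k. c k * t k x)" for x
  have [measurable]: "R \<in> borel_measurable borel" unfolding R_def by measurable
  have hR: "h x \<le> R x" for x
    using sum_le_suminf[OF summableI, of "{0}" "\<lambda>k. c k * t k x"] by (simp add: R_def c_def t0)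
  have TR: "T R x \<le> ennreal (4 * A) * R x" for x
  proof -
    have "T R x \<le> (\<Sum>k. c k * T (t k) x)"
      unfolding R_def by (rule sub) measurable
    \<comment> \<open>\<open>T\<close> shifts the series by one index, and successive coefficients
      have the quotient \<open>4 * A\<close>.\<close>
    also have "(\<lambda>k. c k * T (t k) x) = (\<lambda>k. ennreal (4 * A) * (c (Suc k) * t (Suc k) x))"
    proof
      fix k
      have "ennreal (4 * A) * c (Suc k) = c k"
        using A by (simp add: c_def ennreal_mult[symmetric])
      then show "c k * T (t k) x = ennreal (4 * A) * (c (Suc k) * t (Suc k) x)"
        by (simp add: tS mult.assoc[symmetric])
    qed
    also have "(\<Sum>k. ennreal (4 * A) * (c (Suc k) * t (Suc k) x)) = ennreal (4 * A) * (\<Sum>k. c (Suc k) * t (Suc k) x)"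
      by simp
    also have "\<dots> \<le> ennreal (4 * A) * R x"
    proof (rule mult_left_mono)
      have "R x = (\<Sum>k. c (k + 1) * t (k + 1) x) + (\<Sum>k<1. c k * t k x)"
        unfolding R_def by (rule suminf_offset[OF summableI])
      then show "(\<Sum>k. c (Suc k) * t (Suc k) x) \<le> R x" by simp
    qed simp
    finally show ?thesis .
  qed
  \<comment> \<open>\<open>(4 * A) ^ k\<close> is split as \<open>2 ^ k * (2 * A) ^ k\<close>. The
    first factor sums the series against the supremum of the \<open>b j x\<close>, the second beats
    the growth \<open>A ^ k\<close> of the norms of the iterates.\<close>
  define b where "b k x = ennreal ((1 / (2 * A)) ^ k) * t k x" for k x
  have [measurable]: "b k \<in> borel_measurable borel" for k unfolding b_def by measurable
  have Rb: "R x \<up> p \<le> ennreal (2 powr p) * (\<Sum>k. b k x \<up> p)" for x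
  proof -
    have "R x \<le> (\<Sum>k. ennreal ((1 / 2) ^ k) * (SUP j. b j x))"
      unfolding R_def
    proof (intro suminf_le summableI)
      fix k
      have "c k * t k x = ennreal ((1 / 2) ^ k) * b k x"
        using A by (simp add: b_def c_def mult.assoc[symmetric] ennreal_mult[symmetric] power_mult_distrib[symmetric])
      also have "\<dots> \<le> ennreal ((1 / 2) ^ k) * (SUP j. b j x)"
        by (intro mult_left_mono SUP_upper) auto
      finally show "c k * t k x \<le> ennreal ((1 / 2) ^ k) * (SUP j. b j x)" .
    qed
    also have "\<dots> = ennreal 2 * (SUP j. b j x)"
      by (simp only: ennreal_suminf_multc suminf_ennreal_half)
    finally have "R x \<up> p \<le> (ennreal 2 * (SUP j. b j x)) \<up> p"
      using p by (intro ennreal_powr_mono) auto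
    also have "\<dots> = ennreal (2 powr p) * (SUP j. b j x) \<up> p"
      using ennreal_powr_ennreal[of 2 p] by (simp add: ennreal_powr_mult)
    also have "\<dots> \<le> ennreal (2 powr p) * (\<Sum>k. b k x \<up> p)"
    proof (intro mult_left_mono ennreal_powr_SUP_le)
      fix j
      show "b j x \<up> p \<le> (\<Sum>k. b k x \<up> p)"
        using sum_le_suminf[OF summableI, of "{j}" "\<lambda>k. b k x \<up> p"] by simp
    qed (use p in auto)
    finally show ?thesis .
  qed
  have "(\<integral>\<^sup>+x. R x \<up> p * W x \<partial>lborel) \<le> (\<integral>\<^sup>+x. ennreal (2 powr p) * (\<Sum>k. b k x \<up> p * W x) \<partial>lborel)"
    by (intro nn_integral_mono) (use mult_right_mono[OF Rb] in \<open>simp add: mult.assoc\<close>)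
  also have "\<dots> = ennreal (2 powr p) * (\<Sum>k. (\<integral>\<^sup>+x. b k x \<up> p * W x \<partial>lborel))"
    by (simp add: nn_integral_cmult nn_integral_suminf del: ennreal_suminf_multc)
  also have "\<dots> \<le> ennreal (2 powr p) * (\<Sum>k. ennreal ((1 / 2) ^ k) * (\<integral>\<^sup>+x. h x \<up> p * W x \<partial>lborel))"
  proof (intro mult_left_mono suminf_le summableI)
    fix k
    \<comment> \<open>The decay per step is \<open>(1 / 2) powr p\<close>, which is at most
      \<open>1 / 2\<close> as \<open>p > 1\<close>. This second geometric series supplies the last
      factor 2 in \<open>2 powr (p + 1)\<close>.\<close>
    have pk: "((1 / (2 * A)) ^ k) powr p * (A powr p) ^ k \<le> (1 / 2) ^ k"
    proof -
      have "((1 / (2 * A)) ^ k) powr p = ((1 / (2 * A)) powr p) ^ k"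
        using A by (intro pow_powr) simp
      then have "((1 / (2 * A)) ^ k) powr p * (A powr p) ^ k = (((1 / (2 * A)) * A) powr p) ^ k"
        using A by (subst powr_mult) (auto simp: power_mult_distrib)
      also have "\<dots> = ((1 / 2) powr p) ^ k" using A by simp
      also have "\<dots> \<le> ((1 / 2) powr 1) ^ k"
        using p by (intro power_mono powr_mono') auto
      finally show ?thesis by simp
    qed
    have "(\<integral>\<^sup>+x. b k x \<up> p * W x \<partial>lborel) = ennreal (((1 / (2 * A)) ^ k) powr p) * (\<integral>\<^sup>+x. t k x \<up> p * W x \<partial>lborel)"
      using A by (simp add: b_def ennreal_powr_mult ennreal_powr_ennreal nn_integral_cmult mult.assoc)
    also have "\<dots> \<le> ennreal (((1 / (2 * A)) ^ k) powr p) * (ennreal ((A powr p) ^ k) * (\<integral>\<^sup>+x. h x \<up> p * W x \<partial>lborel))"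
      by (intro mult_left_mono tb) simp
    also have "\<dots> = ennreal (((1 / (2 * A)) ^ k) powr p * (A powr p) ^ k) * (\<integral>\<^sup>+x. h x \<up> p * W x \<partial>lborel)"
      by (simp add: mult.assoc ennreal_mult)
    also have "\<dots> \<le> ennreal ((1 / 2) ^ k) * (\<integral>\<^sup>+x. h x \<up> p * W x \<partial>lborel)"
      by (intro mult_right_mono ennreal_leI pk) simp
    finally show "(\<integral>\<^sup>+x. b k x \<up> p * W x \<partial>lborel) \<le> ennreal ((1 / 2) ^ k) * (\<integral>\<^sup>+x. h x \<up> p * W x \<partial>lborel)" .
  qed simp
  also have "\<dots> = ennreal (2 powr p) * (ennreal 2 * (\<integral>\<^sup>+x. h x \<up> p * W x \<partial>lborel))"
    by (simp only: ennreal_suminf_multc suminf_ennreal_half)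
  also have "\<dots> = ennreal (2 powr (p + 1)) * (\<integral>\<^sup>+x. h x \<up> p * W x \<partial>lborel)"
    by (simp add: powr_add ennreal_mult mult.assoc)
  finally show ?thesis using that[of R] hR TR by simp
qed

section \<open>The Hardy-Littlewood operator on the line and A_1 weights\<close>

abbreviation hlmax :: "(real \<Rightarrow> ennreal) \<Rightarrow> real \<Rightarrow> ennreal" where
  "hlmax \<equiv> wmax (\<lambda>_. 1)"

lemma hlmax_ge:
  assumes "(a, b) \<in> rat_ivls" "x \<in> {a<..<b}"
  shows "ivl_int f a b \<le> hlmax f x * ennreal (b - a)"
  using wmax_ge'[OF weight_1 assms, of f] rat_ivls_less[OF assms(1)]
  by (simp add: ivl_int_const[of a b 1, simplified])

lemma hlmax_suminf:
  assumes [measurable]: "\<And>k::nat. f k \<in> borel_measurable borel"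
  shows "hlmax (\<lambda>y. \<Sum>k. c k * f k y) x \<le> (\<Sum>k. c k * hlmax (f k) x)"
proof (rule wmax_le)
  fix a b assume ab: "(a, b) \<in> rat_ivls" "x \<in> {a<..<b}"
  have "ivl_int (\<lambda>y. (\<Sum>k. c k * f k y) * ennreal 1) a b
    = (\<integral>\<^sup>+y. (\<Sum>k. c k * (f k y * indicator {a<..<b} y)) \<partial>lborel)"
    unfolding ivl_int_def by (simp add: mult.assoc[symmetric] flip: ennreal_suminf_multc)
  also have "\<dots> = (\<Sum>k. c k * ivl_int (f k) a b)"
    unfolding ivl_int_def by (simp add: nn_integral_suminf nn_integral_cmult)
  finally have "ivl_int (\<lambda>y. (\<Sum>k. c k * f k y) * ennreal 1) a b / ivl_int (\<lambda>_. ennreal 1) a b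
     = (\<Sum>k. c k * (ivl_int (f k) a b / ivl_int (\<lambda>_. ennreal 1) a b))"
    by (simp add: divide_ennreal_def mult.assoc[symmetric])
  also have "\<dots> \<le> (\<Sum>k. c k * hlmax (f k) x)"
    using wmax_ge[OF ab, of _ "\<lambda>_. 1"] by (intro suminf_le summableI mult_left_mono) auto
  finally show "ivl_int (\<lambda>y. (\<Sum>k. c k * f k y) * ennreal 1) a b / ivl_int (\<lambda>_. ennreal 1) a b
    \<le> (\<Sum>k. c k * hlmax (f k) x)" .
qed

text \<open>A zero of the maximal function at one point makes the integrals of \<open>f\<close> over
  all large intervals vanish. This makes the majorants of \<open>rubio_de_francia\<close> positive
  everywhere.\<close>

lemma hlmax_pos:
  assumes [measurable]: "f \<in> borel_measurable borel" and ne: "\<not> (AE x in lborel. f x = 0)"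
  shows "hlmax f x \<noteq> 0"
proof
  assume z: "hlmax f x = 0"
  obtain m :: nat where m: "\<bar>x\<bar> < real m" using reals_Archimedean2 by blast
  have "AE y in lborel. y \<in> {- real (m + k)<..<real (m + k)} \<longrightarrow> f y = 0" for k
  proof -
    have "(- real (m + k), real (m + k)) \<in> rat_ivls" "x \<in> {- real (m + k)<..<real (m + k)}"
      using m by (auto simp: rat_ivls_def)
    from hlmax_ge[OF this, of f] z have "ivl_int f (- real (m + k)) (real (m + k)) = 0" by simp
    then have "AE y in lborel. f y * indicator {- real (m + k)<..<real (m + k)} y = 0"
      unfolding ivl_int_def by (subst (asm) nn_integral_0_iff_AE) auto
    then show ?thesis by eventually_elim (auto split: split_indicator_asm)
  qed
  then have "AE y in lborel. \<forall>k. y \<in> {- real (m + k)<..<real (m + k)} \<longrightarrow> f y = 0"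
    unfolding AE_all_countable by blast
  then have "AE y in lborel. f y = 0"
  proof eventually_elim
    case (elim y)
    obtain k :: nat where "\<bar>y\<bar> < real k" using reals_Archimedean2 by blast
    then have "y \<in> {- real (m + k)<..<real (m + k)}" by (auto simp: abs_less_iff)
    then show ?case using elim by blast
  qed
  with ne show False by simp
qed

text \<open>Turns a majorant with values in [0, \<infinity>] into a real weight that is positive
  everywhere: \<open>hlmax_pos\<close> excludes zeros, and infinite values, which occur on a null
  set, are replaced by 1.\<close>

lemma A1_weight_of_hlmax:
  assumes [measurable]: "R \<in> borel_measurable borel" and ne: "\<not> (AE x in lborel. R x = 0)"
    and fin: "AE x in lborel. R x \<noteq> top" and c: "0 < c"
    and le: "\<And>x. hlmax R x \<le> ennreal c * R x"
  obtains u where "A1_weight c u" "AE x in lborel. ennreal (u x) = R x"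
proof -
  define u where "u x = (if R x = top then 1 else enn2real (R x))" for x
  have R0: "R x \<noteq> 0" for x using le[of x] hlmax_pos[OF assms(1) ne, of x] by auto
  have upos: "0 < u x" for x
    using R0[of x] by (cases "R x") (auto simp: u_def less_le)
  have ue: "ennreal (u x) = R x" if "R x \<noteq> top" for x using that by (cases "R x") (auto simp: u_def)
  have [measurable]: "u \<in> borel_measurable borel" unfolding u_def by measurable
  have AEu: "AE x in lborel. ennreal (u x) = R x"
    using fin by eventually_elim (rule ue)
  have ivl: "ivl_int u a b = ivl_int R a b" for a b
    unfolding ivl_int_def using AEu by (intro nn_integral_cong_AE) (auto elim: eventually_mono)
  have key: "ivl_int u a b \<le> ennreal (c * (b - a) * u x)" if "R x \<noteq> top" "(a, b) \<in> rat_ivls" "x \<in> {a<..<b}" for a b x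
  proof -
    have "ivl_int u a b \<le> hlmax R x * ennreal (b - a)"
      unfolding ivl by (intro hlmax_ge that)
    also have "\<dots> \<le> ennreal c * ennreal (u x) * ennreal (b - a)"
      unfolding ue[OF that(1)] by (intro mult_right_mono le) simp
    also have "\<dots> = ennreal (c * (b - a) * u x)"
      using c upos[of x] rat_ivls_less[OF that(2)] by (simp add: ennreal_mult[symmetric] less_imp_le mult_ac)
    finally show ?thesis .
  qed
  have "A1_weight c u"
    unfolding A1_weight_def weight_def
  proof (safe intro!: upos)
    fix a b assume ab: "(a, b) \<in> rat_ivls"
    show "AE x in lborel. x \<in> {a<..<b} \<longrightarrow> ivl_int u a b \<le> ennreal (c * (b - a) * u x)"
      using fin by eventually_elim (use key ab in auto)
    have "\<exists>x\<in>{a<..<b}. R x \<noteq> top"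
      by (rule AE_lborel_ex_interval[OF fin rat_ivls_less[OF ab]])
    then obtain x where "x \<in> {a<..<b}" "R x \<noteq> top" by blast
    then show "ivl_int u a b < \<infinity>" using key[of x a b] ab by (auto intro: le_less_trans)
  qed simp
  then show ?thesis using that AEu by blast
qed

text \<open>The \<open>p\<close>-th root puts the constant into the form \<open>A powr p\<close>
  that \<open>rubio_de_francia\<close> expects, and the maximum with 1 makes it positive.\<close>

definition hlmax_norm :: "real \<Rightarrow> real \<Rightarrow> real" where
  "hlmax_norm p K = max 1 (muckenhoupt_const p K powr (1 / p))"

lemma muckenhoupt_const_nonneg: "1 < p \<Longrightarrow> 0 \<le> muckenhoupt_const p K"
proof -
  assume p: "1 < p"
  then have "p / (p - 1) - 1 = 1 / (p - 1)" by (simp add: field_simps)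
  then show ?thesis using p by (simp add: muckenhoupt_const_def)
qed

lemma hlmax_muckenhoupt:
  assumes p: "1 < p" and w: "muckenhoupt p K w" and [measurable]: "f \<in> borel_measurable borel"
  shows "(\<integral>\<^sup>+x. hlmax f x \<up> p * ennreal (w x) \<partial>lborel)
    \<le> ennreal (hlmax_norm p K powr p) * (\<integral>\<^sup>+x. f x \<up> p * ennreal (w x) \<partial>lborel)"
proof -
  have "muckenhoupt_const p K = (muckenhoupt_const p K powr (1 / p)) powr p"
    using p muckenhoupt_const_nonneg[OF p] by (simp add: powr_powr)
  also have "\<dots> \<le> hlmax_norm p K powr p"
    using p unfolding hlmax_norm_def by (intro powr_mono2) auto
  finally have "ennreal (muckenhoupt_const p K) \<le> ennreal (hlmax_norm p K powr p)" by (rule ennreal_leI)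
  then show ?thesis
    by (intro order_trans[OF muckenhoupt_theorem[OF p w]] mult_right_mono) auto
qed

text \<open>The argument of \<open>c\<close> is what \<open>muckenhoupt_of_A1\<close> yields for two
  A_1 constants equal to four times an operator norm, as produced by
  \<open>rubio_de_francia\<close>. The factor \<open>8 powr p\<close> collects the norms of the two
  majorants.\<close>

definition extrapolation_const :: "real \<Rightarrow> real \<Rightarrow> (real \<Rightarrow> real) \<Rightarrow> real \<Rightarrow> real" where
  "extrapolation_const p q c K =
     max 1 (c ((4 * hlmax_norm p K) powr (q - 1) * (4 * hlmax_norm (p / (p - 1)) (K powr (1 / (p - 1)))))) powr (p / q) * 8 powr p"

text \<open>Let \<open>R\<close> majorise \<open>G\<close> in L^p(w), and let \<open>R'\<close>
  majorise the dual function \<open>h\<close> of \<open>F\<close> in L^p'(w), such that R and R' w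
  are A_1 weights. Then R^(1-q) R' w is a Muckenhoupt weight for the exponent \<open>q\<close>.
  Hoelder's inequality, used twice, reduces the claim to \<open>H\<close> for this weight and to the
  integral of R R' w. The construction treats \<open>p < q\<close> and \<open>p > q\<close> alike.
  By finiteness of the left side, a power of it can be cancelled at the end.\<close>

lemma extrapolation_finite:
  assumes p: "1 < p" and q: "1 < q" and w: "muckenhoupt p K w"
    and [measurable]: "F \<in> borel_measurable borel" "G \<in> borel_measurable borel"
    and H: "\<And>K w. muckenhoupt q K w \<Longrightarrow>
      (\<integral>\<^sup>+x. F x \<up> q * ennreal (w x) \<partial>lborel) \<le> ennreal (c K) * (\<integral>\<^sup>+x. G x \<up> q * ennreal (w x) \<partial>lborel)"
    and fin: "(\<integral>\<^sup>+x. F x \<up> p * ennreal (w x) \<partial>lborel) \<noteq> top"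
  shows "(\<integral>\<^sup>+x. F x \<up> p * ennreal (w x) \<partial>lborel)
    \<le> ennreal (extrapolation_const p q c K) * (\<integral>\<^sup>+x. G x \<up> p * ennreal (w x) \<partial>lborel)"
proof -
  define Fn where "Fn = (\<integral>\<^sup>+x. F x \<up> p * ennreal (w x) \<partial>lborel)"
  define Gn where "Gn = (\<integral>\<^sup>+x. G x \<up> p * ennreal (w x) \<partial>lborel)"
  have ww: "weight w" by (rule muckenhoupt_weight[OF w])
  note [measurable] = weight_measurable[OF ww]
  note wpos = weight_pos[OF ww]
  have wne: "ennreal (w x) \<noteq> 0" for x using wpos[of x] by (simp add: ennreal_eq_0_iff)
  define p' q' where "p' = p / (p - 1)" and "q' = q / (q - 1)"
  have p': "1 < p'" "1 / p + 1 / p' = 1" "(p - 1) * p' = p"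
    using p by (auto simp: p'_def field_simps)
  have q': "1 < q'" "1 / q + 1 / q' = 1" "1 / q' * q = q - 1"
    using q by (auto simp: q'_def field_simps)
  define A where "A = hlmax_norm p K"
  define B where "B = hlmax_norm p' (K powr (1 / (p - 1)))"
  have AB: "0 < A" "0 < B" by (auto simp: A_def B_def hlmax_norm_def)
  define D where "D = max 1 (c ((4 * A) powr (q - 1) * (4 * B)))"
  have D: "1 \<le> D" by (simp add: D_def)
  have const: "extrapolation_const p q c K = D powr (p / q) * 8 powr p"
    unfolding extrapolation_const_def D_def A_def B_def p'_def ..
  have cpos: "0 < D powr (p / q) * 8 powr p" using D by simp
  consider "Fn = 0" | "AE x in lborel. G x = 0" | "Gn = top"
    | "Fn \<noteq> 0" "\<not> (AE x in lborel. G x = 0)" "Gn \<noteq> top" by blast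
  then have "Fn \<le> ennreal (D powr (p / q) * 8 powr p) * Gn"
  proof cases
    \<comment> \<open>\<open>R\<close> must not vanish almost everywhere, so this case is separate:
      \<open>H\<close> for the constant weight 1 forces \<open>F\<close> to vanish as well.\<close>
    case 2
    have "(\<integral>\<^sup>+x. G x \<up> q * ennreal 1 \<partial>lborel) = 0"
      using 2 by (subst nn_integral_0_iff_AE) (auto elim: eventually_mono)
    then have "(\<integral>\<^sup>+x. F x \<up> q * ennreal 1 \<partial>lborel) = 0"
      using H[OF muckenhoupt_1[OF q]] by simp
    then have "AE x in lborel. F x = 0" by (subst (asm) nn_integral_0_iff_AE) auto
    then have "Fn = 0" unfolding Fn_def by (subst nn_integral_0_iff_AE) (auto elim: eventually_mono)
    then show ?thesis by simp
  next
    case 3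
    then show ?thesis using D by (auto simp: ennreal_mult_top)
  next
    case 4
    obtain R where [measurable]: "R \<in> borel_measurable borel" and R: "\<And>x. G x \<le> R x"
      "\<And>x. hlmax R x \<le> ennreal (4 * A) * R x"
      "(\<integral>\<^sup>+x. R x \<up> p * ennreal (w x) \<partial>lborel) \<le> ennreal (2 powr (p + 1)) * Gn"
      unfolding Gn_def
      by (rule rubio_de_francia[OF p AB(1), of "\<lambda>x. ennreal (w x)" G hlmax])
         (auto simp: A_def hlmax_muckenhoupt[OF p w] hlmax_suminf)
    \<comment> \<open>The function that recovers the norm of \<open>F\<close> by duality:
      \<open>F x * h x = F x \<up> p\<close>, and the integral of \<open>h x \<up> p'\<close>
      against \<open>w\<close> is again \<open>Fn\<close>.\<close>
    define h where "h x = F x \<up> (p - 1)" for x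
    have [measurable]: "h \<in> borel_measurable borel" unfolding h_def by measurable
    have hn: "(\<integral>\<^sup>+x. h x \<up> p' * ennreal (w x) \<partial>lborel) = Fn"
      by (simp add: h_def ennreal_powr_powr p' Fn_def)
    \<comment> \<open>The maximal operator conjugated by \<open>w\<close>. It is bounded on L^p'(w)
      because the dual weight is a Muckenhoupt weight for \<open>p'\<close>, and the bound for
      \<open>T R'\<close> says that R' w is an A_1 weight.\<close>
    define T where "T g x = hlmax (\<lambda>y. g y * ennreal (w y)) x * ennreal (1 / w x)" for g x
    obtain R' where [measurable]: "R' \<in> borel_measurable borel" and R': "\<And>x. h x \<le> R' x"
      "\<And>x. T R' x \<le> ennreal (4 * B) * R' x"
      "(\<integral>\<^sup>+x. R' x \<up> p' * ennreal (w x) \<partial>lborel) \<le> ennreal (2 powr (p' + 1)) * Fn"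
      unfolding hn[symmetric]
    proof (rule rubio_de_francia[OF p'(1) AB(2), of "\<lambda>x. ennreal (w x)" h T])
      fix f :: "real \<Rightarrow> ennreal" assume [measurable]: "f \<in> borel_measurable borel"
      show "T f \<in> borel_measurable borel" unfolding T_def by measurable
      have s: "(1 / w x) powr p' * w x = w x powr (- 1 / (p - 1))" for x
      proof -
        have "(1 / w x) powr p' * w x = w x powr (- p') * w x powr 1"
          using wpos[of x] by (simp add: powr_minus powr_divide divide_simps)
        also have "\<dots> = w x powr (- p' + 1)" by (rule powr_add[symmetric])
        also have "- p' + 1 = - 1 / (p - 1)" using p by (simp add: p'_def field_simps)
        finally show ?thesis .
      qed
      have s': "(1 / w x) powr p' * w x * w x powr p' = w x" for x
        using wpos[of x] by (simp add: powr_divide)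
      have "(\<integral>\<^sup>+x. T f x \<up> p' * ennreal (w x) \<partial>lborel)
        = (\<integral>\<^sup>+x. hlmax (\<lambda>y. f y * ennreal (w y)) x \<up> p' * ennreal (w x powr (- 1 / (p - 1))) \<partial>lborel)"
        using wpos by (intro nn_integral_cong)
          (simp add: T_def ennreal_powr_mult ennreal_powr_ennreal less_imp_le mult.assoc ennreal_mult[symmetric] s)
      also have "\<dots> \<le> ennreal (B powr p') * (\<integral>\<^sup>+x. (f x * ennreal (w x)) \<up> p' * ennreal (w x powr (- 1 / (p - 1))) \<partial>lborel)"
        unfolding B_def using muckenhoupt_dual[OF p w] p'(1)
        by (intro hlmax_muckenhoupt) (auto simp: p'_def)
      also have "(\<integral>\<^sup>+x. (f x * ennreal (w x)) \<up> p' * ennreal (w x powr (- 1 / (p - 1))) \<partial>lborel)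
        = (\<integral>\<^sup>+x. f x \<up> p' * ennreal (w x) \<partial>lborel)"
      proof (rule nn_integral_cong)
        fix x
        have "ennreal (w x) \<up> p' * ennreal (w x powr (- 1 / (p - 1))) = ennreal ((1 / w x) powr p' * w x * w x powr p')"
          unfolding s[symmetric] using wpos[of x]
          by (simp add: ennreal_powr_ennreal less_imp_le ennreal_mult[symmetric] mult_ac del: ennreal_mult')
        also have "\<dots> = ennreal (w x)" by (simp only: s')
        finally show "(f x * ennreal (w x)) \<up> p' * ennreal (w x powr (- 1 / (p - 1))) = f x \<up> p' * ennreal (w x)"
          by (simp add: ennreal_powr_mult mult.assoc)
      qed
      finally show "(\<integral>\<^sup>+x. T f x \<up> p' * ennreal (w x) \<partial>lborel) \<le> ennreal (B powr p') * (\<integral>\<^sup>+x. f x \<up> p' * ennreal (w x) \<partial>lborel)" .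
    next
      fix c x and f :: "nat \<Rightarrow> real \<Rightarrow> ennreal" assume [measurable]: "\<And>k. f k \<in> borel_measurable borel"
      have "T (\<lambda>y. \<Sum>k. c k * f k y) x = hlmax (\<lambda>y. \<Sum>k. c k * (f k y * ennreal (w y))) x * ennreal (1 / w x)"
        unfolding T_def by (simp add: mult.assoc[symmetric] flip: ennreal_suminf_multc)
      also have "\<dots> \<le> (\<Sum>k. c k * hlmax (\<lambda>y. f k y * ennreal (w y)) x) * ennreal (1 / w x)"
        by (intro mult_right_mono hlmax_suminf) auto
      also have "\<dots> = (\<Sum>k. c k * T (f k) x)"
        unfolding T_def by (simp add: mult.assoc[symmetric] flip: ennreal_suminf_multc)
      finally show "T (\<lambda>y. \<Sum>k. c k * f k y) x \<le> (\<Sum>k. c k * T (f k) x)" .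
    qed (use that in auto)
    have AE_fin: "AE x in lborel. g x \<noteq> top"
      if [measurable]: "g \<in> borel_measurable borel" and "(\<integral>\<^sup>+x. g x \<up> s * ennreal (w x) \<partial>lborel) \<noteq> top" for g s
    proof -
      have "AE x in lborel. g x \<up> s * ennreal (w x) \<noteq> top"
        using that(2) by (intro nn_integral_PInf_AE[unfolded infinity_ennreal_def]) measurable
      then show ?thesis by eventually_elim (use wne in \<open>auto simp: ennreal_mult_eq_top_iff\<close>)
    qed
    have R_fin: "AE x in lborel. R x \<noteq> top"
      using R(3) 4 by (intro AE_fin[of _ p]) (auto simp: top_unique ennreal_mult_eq_top_iff)
    have R'_fin: "AE x in lborel. R' x \<noteq> top"
      using R'(3) fin by (intro AE_fin[of _ p']) (auto simp: top_unique ennreal_mult_eq_top_iff Fn_def)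
    have "\<not> (AE x in lborel. R x = 0)"
    proof
      assume "AE x in lborel. R x = 0"
      then have "AE x in lborel. G x = 0"
        by eventually_elim (use R(1) in \<open>metis le_zero_eq\<close>)
      then show False using 4 by simp
    qed
    then obtain u where u: "A1_weight (4 * A) u" "AE x in lborel. ennreal (u x) = R x"
      using A1_weight_of_hlmax[of R "4 * A"] R_fin R(2) AB by auto
    have "\<not> (AE x in lborel. R' x * ennreal (w x) = 0)"
    proof
      assume "AE x in lborel. R' x * ennreal (w x) = 0"
      then have "AE x in lborel. F x \<up> p * ennreal (w x) = 0"
      proof eventually_elim
        case (elim x)
        then have "R' x = 0" using wne[of x] by auto
        then have "F x \<up> (p - 1) = 0" using R'(1)[of x] by (simp add: h_def)
        then show ?case by simp
      qed
      then have "Fn = 0" unfolding Fn_def by (subst nn_integral_0_iff_AE) auto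
      then show False using 4 by simp
    qed
    moreover have "AE x in lborel. R' x * ennreal (w x) \<noteq> top"
      using R'_fin by eventually_elim (auto simp: ennreal_mult_eq_top_iff)
    moreover have "hlmax (\<lambda>y. R' y * ennreal (w y)) x \<le> ennreal (4 * B) * (R' x * ennreal (w x))" for x
    proof -
      have "hlmax (\<lambda>y. R' y * ennreal (w y)) x = T R' x * ennreal (w x)"
        unfolding T_def using wpos[of x] by (simp add: mult.assoc ennreal_mult[symmetric])
      also have "\<dots> \<le> ennreal (4 * B) * R' x * ennreal (w x)" by (intro mult_right_mono R') simp
      finally show ?thesis by (simp add: mult.assoc)
    qed
    ultimately obtain v where v: "A1_weight (4 * B) v" "AE x in lborel. ennreal (v x) = R' x * ennreal (w x)"
      using A1_weight_of_hlmax[of "\<lambda>x. R' x * ennreal (w x)" "4 * B"] AB by auto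
    have wu: "weight u" and wv: "weight v" using u v by (auto simp: A1_weight_def)
    note [measurable] = weight_measurable[OF wu] weight_measurable[OF wv]
    note upos = weight_pos[OF wu] and vpos = weight_pos[OF wv]
    define \<omega> where "\<omega> x = u x powr (1 - q) * v x" for x
    have [measurable]: "\<omega> \<in> borel_measurable borel" unfolding \<omega>_def by measurable
    have \<omega>: "muckenhoupt q ((4 * A) powr (q - 1) * (4 * B)) \<omega>"
      unfolding \<omega>_def by (rule muckenhoupt_of_A1[OF u(1) v(1) q])
    define X where "X = (\<integral>\<^sup>+x. ennreal (u x) * ennreal (v x) \<partial>lborel)"
    have "Fn \<le> (\<integral>\<^sup>+x. F x * ennreal (v x) \<partial>lborel)"
      unfolding Fn_def
    proof (rule nn_integral_mono_AE)
      show "AE x in lborel. F x \<up> p * ennreal (w x) \<le> F x * ennreal (v x)"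
        using v(2)
      proof eventually_elim
        case (elim x)
        have "F x \<up> p = F x * h x" using ennreal_powr_add[of "F x" 1 "p - 1"] by (simp add: h_def)
        then have "F x \<up> p * ennreal (w x) \<le> F x * R' x * ennreal (w x)"
          using R'(1)[of x] by (simp add: mult_left_mono mult_right_mono)
        then show ?case by (simp add: elim mult.assoc)
      qed
    qed
    \<comment> \<open>The powers of \<open>u\<close> and \<open>v\<close> are distributed so that
      Hoelder's inequality with \<open>q\<close> and \<open>q'\<close> produces the weight
      \<open>\<omega>\<close> in the first factor and \<open>X\<close> in the second.\<close>
    also have "\<dots> = (\<integral>\<^sup>+x. (F x * ennreal (u x powr (- 1 / q') * v x powr (1 / q))) * ennreal (u x powr (1 / q') * v x powr (1 / q')) \<partial>lborel)"
    proof (rule nn_integral_cong)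
      fix x
      have "u x powr (- 1 / q') * v x powr (1 / q) * (u x powr (1 / q') * v x powr (1 / q'))
        = (u x powr (- 1 / q') * u x powr (1 / q')) * (v x powr (1 / q) * v x powr (1 / q'))"
        by (simp add: mult_ac)
      also have "\<dots> = v x" unfolding powr_add[symmetric] using upos[of x] vpos[of x] q' by simp
      finally show "F x * ennreal (v x) = (F x * ennreal (u x powr (- 1 / q') * v x powr (1 / q))) * ennreal (u x powr (1 / q') * v x powr (1 / q'))"
        by (simp add: mult.assoc ennreal_mult[symmetric])
    qed
    also have "\<dots> \<le> (\<integral>\<^sup>+x. (F x * ennreal (u x powr (- 1 / q') * v x powr (1 / q))) \<up> q \<partial>lborel) \<up> (1 / q)
        * (\<integral>\<^sup>+x. ennreal (u x powr (1 / q') * v x powr (1 / q')) \<up> q' \<partial>lborel) \<up> (1 / q')"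
      by (intro Holder_nn_integral q q') auto
    also have "(\<integral>\<^sup>+x. ennreal (u x powr (1 / q') * v x powr (1 / q')) \<up> q' \<partial>lborel) = X"
      unfolding X_def
    proof (rule nn_integral_cong)
      fix x
      show "ennreal (u x powr (1 / q') * v x powr (1 / q')) \<up> q' = ennreal (u x) * ennreal (v x)"
        using upos[of x] vpos[of x] q' by (simp add: ennreal_powr_ennreal powr_mult powr_powr ennreal_mult[symmetric])
    qed
    also have "(\<integral>\<^sup>+x. (F x * ennreal (u x powr (- 1 / q') * v x powr (1 / q))) \<up> q \<partial>lborel)
        = (\<integral>\<^sup>+x. F x \<up> q * ennreal (\<omega> x) \<partial>lborel)"
    proof (rule nn_integral_cong)
      fix x
      have "- 1 / q' * q = 1 - q" using q'(3) by simp
      then have "(u x powr (- 1 / q') * v x powr (1 / q)) powr q = \<omega> x"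
        using upos[of x] vpos[of x] q unfolding \<omega>_def by (simp only: powr_mult powr_powr) simp
      then show "(F x * ennreal (u x powr (- 1 / q') * v x powr (1 / q))) \<up> q = F x \<up> q * ennreal (\<omega> x)"
        using ennreal_powr_ennreal[of "u x powr (- 1 / q') * v x powr (1 / q)" q]
        by (simp add: ennreal_powr_mult del: ennreal_mult')
    qed
    finally have 1: "Fn \<le> (\<integral>\<^sup>+x. F x \<up> q * ennreal (\<omega> x) \<partial>lborel) \<up> (1 / q) * X \<up> (1 / q')" .
    have "(\<integral>\<^sup>+x. F x \<up> q * ennreal (\<omega> x) \<partial>lborel)
       \<le> ennreal (c ((4 * A) powr (q - 1) * (4 * B))) * (\<integral>\<^sup>+x. G x \<up> q * ennreal (\<omega> x) \<partial>lborel)"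
      by (rule H[OF \<omega>])
    also have "\<dots> \<le> ennreal D * (\<integral>\<^sup>+x. G x \<up> q * ennreal (\<omega> x) \<partial>lborel)"
      unfolding D_def by (intro mult_right_mono ennreal_leI) auto
    also have "\<dots> \<le> ennreal D * X"
      unfolding X_def
    proof (intro mult_left_mono nn_integral_mono_AE)
      show "AE x in lborel. G x \<up> q * ennreal (\<omega> x) \<le> ennreal (u x) * ennreal (v x)"
        using u(2)
      proof eventually_elim
        case (elim x)
        have "G x \<up> q \<le> ennreal (u x) \<up> q" using R(1)[of x] q elim by (intro ennreal_powr_mono) auto
        then have "G x \<up> q * ennreal (\<omega> x) \<le> ennreal (u x powr q) * ennreal (\<omega> x)"
          using upos[of x] by (intro mult_right_mono) (auto simp: ennreal_powr_ennreal)
        also have "\<dots> = ennreal (u x powr q * u x powr (1 - q) * v x)"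
          using vpos[of x] by (simp add: \<omega>_def ennreal_mult[symmetric] mult.assoc)
        also have "u x powr q * u x powr (1 - q) = u x" unfolding powr_add[symmetric] using upos[of x] by simp
        finally show ?case using upos[of x] vpos[of x] by (simp add: ennreal_mult[symmetric])
      qed
    qed simp
    finally have 2: "(\<integral>\<^sup>+x. F x \<up> q * ennreal (\<omega> x) \<partial>lborel) \<le> ennreal D * X" .
    have "Fn \<le> (ennreal D * X) \<up> (1 / q) * X \<up> (1 / q')"
      using q by (intro order_trans[OF 1] mult_right_mono ennreal_powr_mono 2) auto
    also have "\<dots> = ennreal (D powr (1 / q)) * (X \<up> (1 / q) * X \<up> (1 / q'))"
      using D by (simp add: ennreal_powr_mult ennreal_powr_ennreal mult.assoc)
    also have "X \<up> (1 / q) * X \<up> (1 / q') = X" unfolding ennreal_powr_add q' by simp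
    finally have 3: "Fn \<le> ennreal (D powr (1 / q)) * X" .
    have "X = (\<integral>\<^sup>+x. (R x * ennreal (w x) \<up> (1 / p)) * (R' x * ennreal (w x) \<up> (1 / p')) \<partial>lborel)"
      unfolding X_def
    proof (rule nn_integral_cong_AE)
      have "ennreal (w x) \<up> (1 / p) * ennreal (w x) \<up> (1 / p') = ennreal (w x)" for x
        unfolding ennreal_powr_add p' by simp
      then have "(R x * ennreal (w x) \<up> (1 / p)) * (R' x * ennreal (w x) \<up> (1 / p')) = R x * (R' x * ennreal (w x))" for x
        by (metis mult.assoc mult.left_commute)
      then show "AE x in lborel. ennreal (u x) * ennreal (v x) = (R x * ennreal (w x) \<up> (1 / p)) * (R' x * ennreal (w x) \<up> (1 / p'))"
        using u(2) v(2) by (auto elim: eventually_elim2)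
    qed
    also have "\<dots> \<le> (\<integral>\<^sup>+x. (R x * ennreal (w x) \<up> (1 / p)) \<up> p \<partial>lborel) \<up> (1 / p) * (\<integral>\<^sup>+x. (R' x * ennreal (w x) \<up> (1 / p')) \<up> p' \<partial>lborel) \<up> (1 / p')"
      by (intro Holder_nn_integral p p') auto
    also have "\<dots> = (\<integral>\<^sup>+x. R x \<up> p * ennreal (w x) \<partial>lborel) \<up> (1 / p) * (\<integral>\<^sup>+x. R' x \<up> p' * ennreal (w x) \<partial>lborel) \<up> (1 / p')"
      using p p' by (simp add: ennreal_powr_mult)
    also have "\<dots> \<le> (ennreal (2 powr (p + 1)) * Gn) \<up> (1 / p) * (ennreal (2 powr (p' + 1)) * Fn) \<up> (1 / p')"
      using p p' by (intro mult_mono ennreal_powr_mono R R') auto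
    also have "\<dots> = ennreal (2 powr ((p + 1) / p) * 2 powr ((p' + 1) / p')) * (Gn \<up> (1 / p) * Fn \<up> (1 / p'))"
      by (simp add: ennreal_powr_mult ennreal_powr_ennreal powr_powr ennreal_mult mult_ac)
    also have "2 powr ((p + 1) / p) * 2 powr ((p' + 1) / p') = (8 :: real)"
    proof -
      have "(p + 1) / p + (p' + 1) / p' = 2 + (1 / p + 1 / p')" using p p' by (simp add: add_divide_distrib)
      then show ?thesis unfolding powr_add[symmetric] p' by simp
    qed
    finally have XFG: "X \<le> ennreal 8 * (Gn \<up> (1 / p) * Fn \<up> (1 / p'))" .
    have 5: "Fn \<le> ennreal (D powr (1 / q) * 8) * (Gn \<up> (1 / p) * Fn \<up> (1 / p'))"
    proof -
      have "Fn \<le> ennreal (D powr (1 / q)) * (ennreal 8 * (Gn \<up> (1 / p) * Fn \<up> (1 / p')))"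
        by (intro order_trans[OF 3] mult_left_mono XFG) simp
      then show ?thesis by (simp add: ennreal_mult mult.assoc)
    qed
    \<comment> \<open>Here \<open>fin\<close> enters: as \<open>Fn\<close> is positive and finite,
      \<open>f powr (1 / p')\<close> can be cancelled.\<close>
    obtain f where f: "Fn = ennreal f" "0 < f" using fin 4 by (cases Fn) (auto simp: Fn_def)
    obtain g where g: "Gn = ennreal g" "0 \<le> g" using 4 by (cases Gn) auto
    have "f \<le> D powr (1 / q) * 8 * (g powr (1 / p) * f powr (1 / p'))"
      using 5 f g by (simp add: ennreal_powr_ennreal ennreal_mult[symmetric] del: ennreal_mult')
    then have "f powr (1 / p) * f powr (1 / p') \<le> (D powr (1 / q) * 8 * g powr (1 / p)) * f powr (1 / p')"
      unfolding powr_add[symmetric] p' using f by (simp add: mult.assoc)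
    then have "f powr (1 / p) \<le> D powr (1 / q) * 8 * g powr (1 / p)" using f by simp
    then have "(f powr (1 / p)) powr p \<le> (D powr (1 / q) * 8 * g powr (1 / p)) powr p"
      using p by (intro powr_mono2) auto
    then have "f \<le> D powr (p / q) * 8 powr p * g"
      using p f g D by (simp add: powr_powr powr_mult)
    then show ?thesis using f g cpos by (simp add: ennreal_mult[symmetric] del: ennreal_mult')
  qed simp
  then show ?thesis by (simp add: const Fn_def Gn_def)
qed

text \<open>Truncating \<open>F\<close> in height and in support makes the left side finite, since
  \<open>w\<close> is locally integrable, and preserves \<open>H\<close>. Monotone convergence
  removes the truncation.\<close>

lemma extrapolation:
  assumes p: "1 < p" and q: "1 < q" and w: "muckenhoupt p K w"
    and [measurable]: "F \<in> borel_measurable borel" "G \<in> borel_measurable borel"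
    and H: "\<And>K w. muckenhoupt q K w \<Longrightarrow>
      (\<integral>\<^sup>+x. F x \<up> q * ennreal (w x) \<partial>lborel) \<le> ennreal (c K) * (\<integral>\<^sup>+x. G x \<up> q * ennreal (w x) \<partial>lborel)"
  shows "(\<integral>\<^sup>+x. F x \<up> p * ennreal (w x) \<partial>lborel)
    \<le> ennreal (extrapolation_const p q c K) * (\<integral>\<^sup>+x. G x \<up> p * ennreal (w x) \<partial>lborel)"
    (is "_ \<le> ?r")
proof -
  have ww: "weight w" by (rule muckenhoupt_weight[OF w])
  note [measurable] = weight_measurable[OF ww]
  define Fn where "Fn n x = min (F x) (of_nat n) * indicator {- real n<..<real n} x" for n x
  have [measurable]: "Fn n \<in> borel_measurable borel" for n unfolding Fn_def by measurable
  have FnF: "Fn n x \<le> F x" for n x by (auto simp: Fn_def split: split_indicator)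
  have le: "(\<integral>\<^sup>+x. Fn n x \<up> p * ennreal (w x) \<partial>lborel) \<le> ?r" for n
  proof (rule extrapolation_finite[OF p q w])
    fix K w assume "muckenhoupt q K w"
    have "(\<integral>\<^sup>+x. Fn n x \<up> q * ennreal (w x) \<partial>lborel) \<le> (\<integral>\<^sup>+x. F x \<up> q * ennreal (w x) \<partial>lborel)"
      using q by (intro nn_integral_mono mult_right_mono ennreal_powr_mono FnF) auto
    also have "\<dots> \<le> ennreal (c K) * (\<integral>\<^sup>+x. G x \<up> q * ennreal (w x) \<partial>lborel)" by (rule H) fact
    finally show "(\<integral>\<^sup>+x. Fn n x \<up> q * ennreal (w x) \<partial>lborel) \<le> ennreal (c K) * (\<integral>\<^sup>+x. G x \<up> q * ennreal (w x) \<partial>lborel)" .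
  next
    show "(\<integral>\<^sup>+x. Fn n x \<up> p * ennreal (w x) \<partial>lborel) \<noteq> top"
    proof (cases "n = 0")
      case False
      then have I: "(- real n, real n) \<in> rat_ivls" by (auto simp: rat_ivls_def)
      have "(\<integral>\<^sup>+x. Fn n x \<up> p * ennreal (w x) \<partial>lborel)
        \<le> (\<integral>\<^sup>+x. ennreal (real n powr p) * (ennreal (w x) * indicator {- real n<..<real n} x) \<partial>lborel)"
      proof (intro nn_integral_mono)
        fix x
        have "Fn n x \<up> p \<le> (ennreal (real n) * indicator {- real n<..<real n} x) \<up> p"
          using p by (intro ennreal_powr_mono) (auto simp: Fn_def ennreal_of_nat_eq_real_of_nat intro!: mult_right_mono)
        then have "Fn n x \<up> p * ennreal (w x) \<le> (ennreal (real n) * indicator {- real n<..<real n} x) \<up> p * ennreal (w x)"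
          by (rule mult_right_mono) simp
        then show "Fn n x \<up> p * ennreal (w x) \<le> ennreal (real n powr p) * (ennreal (w x) * indicator {- real n<..<real n} x)"
          by (simp add: ennreal_powr_indicator ennreal_powr_ennreal mult_ac)
      qed
      also have "\<dots> = ennreal (real n powr p) * ivl_int w (- real n) (real n)"
        unfolding ivl_int_def by (simp add: nn_integral_cmult)
      also have "\<dots> < top" using weight_finite[OF ww I] by (simp add: ennreal_mult_less_top less_top)
      finally show ?thesis by simp
    qed (simp add: Fn_def)
  qed measurable
  have "incseq (\<lambda>n x. Fn n x \<up> p * ennreal (w x))"
    unfolding incseq_def le_fun_def
  proof (intro allI impI mult_right_mono ennreal_powr_mono)
    fix m n :: nat and x assume "m \<le> n"
    then show "Fn m x \<le> Fn n x"
      unfolding Fn_def by (intro mult_mono min.mono order_refl of_nat_mono) (auto split: split_indicator)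
  qed (use p in auto)
  then have "(\<integral>\<^sup>+x. (SUP n. Fn n x \<up> p * ennreal (w x)) \<partial>lborel) = (SUP n. (\<integral>\<^sup>+x. Fn n x \<up> p * ennreal (w x) \<partial>lborel))"
    by (intro nn_integral_monotone_convergence_SUP) auto
  also have "\<dots> \<le> ?r" by (intro SUP_least le)
  finally have S: "(\<integral>\<^sup>+x. (SUP n. Fn n x \<up> p * ennreal (w x)) \<partial>lborel) \<le> ?r" .
  have "F x \<up> p * ennreal (w x) \<le> (SUP n. Fn n x \<up> p * ennreal (w x))" for x
  proof -
    have "F x \<le> (SUP n. Fn n x)"
    proof (rule dense_le)
      fix y assume y: "y < F x"
      then obtain r where r: "y = ennreal r" "0 \<le> r" by (cases y) auto
      obtain n :: nat where n: "max \<bar>x\<bar> r < real n" using reals_Archimedean2 by blast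
      have "y \<le> Fn n x"
        using n y r by (auto simp: Fn_def ennreal_of_nat_eq_real_of_nat split: split_indicator)
      then show "y \<le> (SUP n. Fn n x)" by (rule SUP_upper2[OF UNIV_I])
    qed
    then have "F x \<up> p \<le> (SUP n. Fn n x) \<up> p" using p by (intro ennreal_powr_mono) auto
    also have "\<dots> \<le> (SUP n. Fn n x \<up> p)" using p by (intro ennreal_powr_SUP_le) (auto intro: SUP_upper)
    finally have "F x \<up> p * ennreal (w x) \<le> (SUP n. Fn n x \<up> p) * ennreal (w x)" by (rule mult_right_mono) simp
    then show ?thesis by (simp add: SUP_mult_right_ennreal)
  qed
  then show ?thesis using S by (intro order_trans[OF nn_integral_mono S]) auto
qed

section \<open>Mixed norms\<close>

lemma vec_upd_nth: "vec_upd x i s $ k = (if k = i then s else x $ k)"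
  by (simp add: vec_upd_def)

lemma vec_upd_same [simp]: "vec_upd x i s $ i = s"
  and vec_upd_other [simp]: "k \<noteq> i \<Longrightarrow> vec_upd x i s $ k = x $ k"
  by (simp_all add: vec_upd_nth)

lemma vec_upd_upd [simp]: "vec_upd (vec_upd x i s) i t = vec_upd x i t"
  by (simp add: vec_eq_iff vec_upd_nth)

lemma vec_upd_commute: "i \<noteq> k \<Longrightarrow> vec_upd (vec_upd x i s) k t = vec_upd (vec_upd x k t) i s"
  by (simp add: vec_eq_iff vec_upd_nth)

lemma borel_measurable_nth' [measurable (raw)]:
  fixes f :: "'a \<Rightarrow> real ^ 'n"
  shows "f \<in> borel_measurable M \<Longrightarrow> (\<lambda>x. f x $ i) \<in> borel_measurable M"
  by (simp add: cart_eq_inner_axis)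

lemma borel_measurable_vec_upd [measurable (raw)]:
  fixes f :: "'a \<Rightarrow> real ^ 'n"
  assumes [measurable]: "f \<in> borel_measurable M" "g \<in> borel_measurable M"
  shows "(\<lambda>z. vec_upd (f z) i (g z)) \<in> borel_measurable M"
proof -
  have "vec_upd x i s = x + (s - x $ i) *\<^sub>R axis i 1" for x :: "real ^ 'n" and s
    by (simp add: vec_eq_iff vec_upd_nth axis_def)
  then show ?thesis by simp
qed

lemma borel_measurable_line:
  fixes F :: "real ^ 'n \<Rightarrow> ennreal"
  assumes [measurable]: "F \<in> borel_measurable borel"
  shows "(\<lambda>s. F (vec_upd x i s)) \<in> borel_measurable borel"
  by measurable

definition int_at :: "'n \<Rightarrow> (real ^ 'n \<Rightarrow> ennreal) \<Rightarrow> real ^ 'n \<Rightarrow> ennreal" where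
  "int_at i F x = (\<integral>\<^sup>+s. F (vec_upd x i s) \<partial>lborel)"

text \<open>Taking the root at once makes every step a norm in one variable;
  \<open>mixed_iter\<close> instead merges the root with the power belonging to the next
  variable.\<close>

definition pnorm :: "'n \<Rightarrow> real \<Rightarrow> (real ^ 'n \<Rightarrow> ennreal) \<Rightarrow> real ^ 'n \<Rightarrow> ennreal" where
  "pnorm i q F x = (\<integral>\<^sup>+s. F (vec_upd x i s) \<up> q \<partial>lborel) \<up> (1 / q)"

primrec iter_int :: "'n list \<Rightarrow> (real ^ 'n \<Rightarrow> ennreal) \<Rightarrow> real ^ 'n \<Rightarrow> ennreal" where
  "iter_int [] F = F"
| "iter_int (i # is) F = iter_int is (int_at i F)"

primrec iter_norm :: "real ^ 'n \<Rightarrow> 'n list \<Rightarrow> (real ^ 'n \<Rightarrow> ennreal) \<Rightarrow> real ^ 'n \<Rightarrow> ennreal" where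
  "iter_norm p [] F = F"
| "iter_norm p (i # is) F = iter_norm p is (pnorm i (p $ i) F)"

lemma ennreal_max_0: "ennreal (max 0 c) = ennreal c"
  by (auto simp: max_def ennreal_neg)

lemma iter_int_append: "iter_int (xs @ ys) F = iter_int ys (iter_int xs F)"
  by (induction xs arbitrary: F) auto

lemma iter_norm_append: "iter_norm p (xs @ ys) F = iter_norm p ys (iter_norm p xs F)"
  by (induction xs arbitrary: F) auto

lemma borel_measurable_int_at [measurable]:
  assumes [measurable]: "F \<in> borel_measurable borel"
  shows "int_at i F \<in> borel_measurable borel"
  unfolding int_at_def by measurable

lemma borel_measurable_pnorm [measurable]:
  assumes [measurable]: "F \<in> borel_measurable borel"
  shows "pnorm i q F \<in> borel_measurable borel"
  unfolding pnorm_def by measurable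

lemma borel_measurable_iter_norm [measurable]:
  "F \<in> borel_measurable borel \<Longrightarrow> iter_norm p is F \<in> borel_measurable borel"
  by (induction "is" arbitrary: F) auto

lemma mixed_iter_eq_iter_norm:
  assumes "\<And>i. 0 < p $ i" "0 < q"
  shows "mixed_iter p is q F = iter_norm p is (\<lambda>x. F x \<up> (1 / q))"
  using assms(2)
proof (induction "is" arbitrary: q F)
  case (Cons i js)
  then show ?case
    using assms(1)[of i] by (simp add: nn_integral_completion pnorm_def[abs_def] ennreal_powr_powr)
qed simp

lemma mixed_norm_eq_iter_norm:
  assumes "\<And>i. 0 < p $ i"
  shows "mixed_norm p F = iter_norm p (sorted_list_of_set UNIV) F 0"
  using assms by (simp add: mixed_norm_def mixed_iter_eq_iter_norm)

lemma int_at_mono: "(\<And>x. F x \<le> G x) \<Longrightarrow> int_at i F x \<le> int_at i G x"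
  unfolding int_at_def by (intro nn_integral_mono)

lemma pnorm_mono: "0 < q \<Longrightarrow> (\<And>x. F x \<le> G x) \<Longrightarrow> pnorm i q F x \<le> pnorm i q G x"
  unfolding pnorm_def by (intro ennreal_powr_mono nn_integral_mono) auto

lemma iter_int_mono: "(\<And>x. F x \<le> G x) \<Longrightarrow> iter_int is F x \<le> iter_int is G x"
  by (induction "is" arbitrary: F G) (simp_all add: int_at_mono)

lemma iter_norm_mono:
  "(\<And>i. 0 < p $ i) \<Longrightarrow> (\<And>x. F x \<le> G x) \<Longrightarrow> iter_norm p is F x \<le> iter_norm p is G x"
  by (induction "is" arbitrary: F G) (simp_all add: pnorm_mono)

lemma int_at_cmult:
  assumes [measurable]: "F \<in> borel_measurable borel"
  shows "int_at i (\<lambda>x. c * F x) = (\<lambda>x. c * int_at i F x)"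
  unfolding int_at_def by (simp add: nn_integral_cmult fun_eq_iff)

lemma iter_int_cmult:
  "F \<in> borel_measurable borel \<Longrightarrow> iter_int is (\<lambda>x. c * F x) = (\<lambda>x. c * iter_int is F x)"
  by (induction "is" arbitrary: F) (simp_all add: int_at_cmult)

lemma pnorm_cmult:
  assumes [measurable]: "F \<in> borel_measurable borel" and q: "0 < q"
  shows "pnorm i q (\<lambda>x. c * F x) = (\<lambda>x. c * pnorm i q F x)"
  unfolding pnorm_def using q by (simp add: ennreal_powr_mult nn_integral_cmult fun_eq_iff)

lemma iter_norm_cmult:
  "F \<in> borel_measurable borel \<Longrightarrow> (\<And>i. 0 < p $ i) \<Longrightarrow>
    iter_norm p is (\<lambda>x. c * F x) = (\<lambda>x. c * iter_norm p is F x)"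
  by (induction "is" arbitrary: F) (simp_all add: pnorm_cmult)

text \<open>Induction over the variables: where \<open>int_at i g\<close> vanishes, \<open>g\<close>
  vanishes almost everywhere on the line in direction \<open>i\<close>, so the norms of
  \<open>F\<close> and \<open>F'\<close> in this variable agree. In this way null sets of the whole
  space become negligible for a norm that is not an integral against a single measure.\<close>

lemma iter_norm_cong_null:
  assumes "g \<in> borel_measurable borel" "\<And>y. g y = 0 \<Longrightarrow> F y = F' y" "iter_int is g x = 0"
  shows "iter_norm p is F x = iter_norm p is F' x"
  using assms
proof (induction "is" arbitrary: g F F')
  case (Cons i js)
  have [measurable]: "g \<in> borel_measurable borel" by (rule Cons.prems)
  show ?case
    unfolding iter_norm.simps
  proof (rule Cons.IH[of "int_at i g"])
    fix y assume "int_at i g y = 0"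
    then have "AE s in lborel. g (vec_upd y i s) = 0"
      unfolding int_at_def by (subst (asm) nn_integral_0_iff_AE) auto
    then show "pnorm i (p $ i) F y = pnorm i (p $ i) F' y"
      unfolding pnorm_def
      by (intro arg_cong[where f = "\<lambda>z. z \<up> (1 / p $ i)"] nn_integral_cong_AE)
         (auto elim!: eventually_mono dest: Cons.prems(2))
  qed (use Cons.prems in auto)
qed simp

section \<open>Lebesgue measure and iterated integrals\<close>

text \<open>Both measures agree on boxes. From the product indexed by the coordinates, one variable
  at a time can be split off in any order.\<close>

lemma lborel_vec: "lborel = distr (Pi\<^sub>M UNIV (\<lambda>_. lborel)) borel (\<lambda>y. (\<chi> k. y k) :: real ^ 'n)"
  (is "_ = distr ?P _ ?f")
proof (rule lborel_eqI)
  interpret product_sigma_finite "\<lambda>_::'n. lborel :: real measure" ..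
  have inner: "?f y \<bullet> axis i 1 = y i" for y and i :: 'n by (simp add: inner_axis)
  have [measurable]: "?f \<in> borel_measurable ?P"
  proof (rule borel_measurable_euclidean_space[THEN iffD2], rule ballI)
    fix b :: "real ^ 'n" assume "b \<in> Basis"
    then obtain i where "b = axis i 1" by (auto simp: Basis_vec_def)
    then show "(\<lambda>y. ?f y \<bullet> b) \<in> borel_measurable ?P" by (simp add: inner)
  qed
  fix l u :: "real ^ 'n" assume lu: "\<And>b. b \<in> Basis \<Longrightarrow> l \<bullet> b \<le> u \<bullet> b"
  have lu': "l $ i \<le> u $ i" for i using lu[of "axis i 1"] by (simp add: inner_axis)
  have "emeasure (distr ?P borel ?f) (box l u) = emeasure ?P (?f -` box l u \<inter> space ?P)"
    by (rule emeasure_distr) auto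
  also have "?f -` box l u \<inter> space ?P = (\<Pi>\<^sub>E i\<in>UNIV. {l $ i<..<u $ i})"
    by (auto simp: mem_box_cart space_PiM PiE_iff)
  also have "emeasure ?P \<dots> = (\<Prod>i\<in>UNIV. ennreal (u $ i - l $ i))"
    using lu' by (subst emeasure_PiM) auto
  also have "\<dots> = ennreal (\<Prod>i\<in>UNIV. u $ i - l $ i)"
    using lu' by (simp add: prod_ennreal)
  also have "(\<Prod>i\<in>UNIV. u $ i - l $ i) = (\<Prod>b\<in>Basis. (u - l) \<bullet> b)"
  proof -
    have B: "(Basis :: (real ^ 'n) set) = (\<lambda>i. axis i 1) ` UNIV" by (auto simp: Basis_vec_def)
    have "inj (\<lambda>i::'n. axis i (1::real))" by (auto simp: inj_on_def axis_eq_axis)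
    then show ?thesis unfolding B by (subst prod.reindex) (auto simp: inner_axis)
  qed
  finally show "emeasure (distr ?P borel ?f) (box l u) = ennreal (\<Prod>b\<in>Basis. (u - l) \<bullet> b)" .
qed simp

lemma borel_measurable_vec_lambda_PiM:
  "(\<lambda>y. \<chi> k. if k \<in> I then y k else x k) \<in> borel_measurable (Pi\<^sub>M I (\<lambda>_. lborel :: real measure))"
  for x :: "'n::finite \<Rightarrow> real"
proof (rule borel_measurable_euclidean_space[THEN iffD2], rule ballI)
  fix b :: "real ^ 'n" assume "b \<in> Basis"
  then obtain i where "b = axis i 1" by (auto simp: Basis_vec_def)
  then show "(\<lambda>y. (\<chi> k. if k \<in> I then y k else x k) \<bullet> b) \<in> borel_measurable (Pi\<^sub>M I (\<lambda>_. lborel))"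
    using measurable_component_singleton[of i I "\<lambda>_. lborel :: real measure"]
    by (cases "i \<in> I") (simp_all add: inner_axis)
qed

text \<open>Fubini's theorem for some of the coordinates, the others being frozen at
  \<open>x\<close>; in this form it can be proved by induction on the list.\<close>

lemma iter_int_PiM:
  fixes F :: "real ^ 'n \<Rightarrow> ennreal"
  assumes "F \<in> borel_measurable borel" "distinct is"
  shows "iter_int is F x =
    (\<integral>\<^sup>+y. F (\<chi> k. if k \<in> set is then y k else x $ k) \<partial>Pi\<^sub>M (set is) (\<lambda>_. lborel))"
  using assms
proof (induction "is" arbitrary: F)
  case Nil
  have "(\<chi> k. x $ k) = x" by (simp add: vec_eq_iff)
  then show ?case by (simp add: nn_integral_empty PiM_empty nn_integral_count_space_finite)
next
  case (Cons i js)
  interpret product_sigma_finite "\<lambda>_::'n. lborel :: real measure" ..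
  have [measurable]: "F \<in> borel_measurable borel" by (rule Cons.prems)
  have i: "i \<notin> set js" using Cons.prems by simp
  have upd: "vec_upd (\<chi> k. if k \<in> set js then y k else x $ k) i s
      = (\<chi> k. if k \<in> insert i (set js) then (y(i := s)) k else x $ k)" for y s
    using i by (auto simp: vec_eq_iff vec_upd_nth)
  have "iter_int (i # js) F x = (\<integral>\<^sup>+y. int_at i F (\<chi> k. if k \<in> set js then y k else x $ k) \<partial>Pi\<^sub>M (set js) (\<lambda>_. lborel))"
    using Cons by simp
  also have "\<dots> = (\<integral>\<^sup>+y. (\<integral>\<^sup>+s. F (\<chi> k. if k \<in> insert i (set js) then (y(i := s)) k else x $ k) \<partial>lborel) \<partial>Pi\<^sub>M (set js) (\<lambda>_. lborel))"
    unfolding int_at_def upd ..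
  also have "\<dots> = (\<integral>\<^sup>+y. F (\<chi> k. if k \<in> insert i (set js) then y k else x $ k) \<partial>Pi\<^sub>M (insert i (set js)) (\<lambda>_. lborel))"
    by (rule product_nn_integral_insert[symmetric], simp, rule i,
        rule measurable_compose[OF borel_measurable_vec_lambda_PiM], measurable)
  finally show ?case by simp
qed

lemma nn_integral_eq_iter_int:
  fixes F :: "real ^ 'n \<Rightarrow> ennreal"
  assumes [measurable]: "F \<in> borel_measurable borel" and "is": "distinct is" "set is = UNIV"
  shows "(\<integral>\<^sup>+x. F x \<partial>lborel) = iter_int is F x"
proof -
  have [measurable]: "(\<lambda>y. \<chi> k. y k) \<in> borel_measurable (Pi\<^sub>M UNIV (\<lambda>_::'n. lborel :: real measure))"
    using borel_measurable_vec_lambda_PiM[of UNIV] by simp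
  have "(\<integral>\<^sup>+x. F x \<partial>lborel) = (\<integral>\<^sup>+y. F (\<chi> k. y k) \<partial>Pi\<^sub>M UNIV (\<lambda>_. lborel))"
    by (subst lborel_vec) (simp add: nn_integral_distr)
  then show ?thesis using iter_int_PiM[OF assms(1) "is"(1), of x] "is"(2) by simp
qed

text \<open>The bridge from Lebesgue measurable to Borel functions. Restrictions of the former to
  lines may fail to be measurable, so the estimates are made for a Borel representative.\<close>

lemma mixed_norm_cong_AE:
  assumes "\<And>i. 0 < p $ i" and "AE x in lborel. F x = F' x"
  shows "mixed_norm p F = mixed_norm p F'"
proof -
  obtain N where "{x \<in> space lborel. \<not> F x = F' x} \<subseteq> N" "emeasure lborel N = 0" "N \<in> sets lborel"
    using assms(2) by (rule AE_E)
  then have N: "N \<in> null_sets lborel" "{x. F x \<noteq> F' x} \<subseteq> N"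
    by (auto intro: null_setsI)
  have [measurable]: "N \<in> sets borel" using N by auto
  have "iter_int (sorted_list_of_set UNIV) (indicator N) 0 = (\<integral>\<^sup>+x. indicator N x \<partial>lborel)"
    by (rule nn_integral_eq_iter_int[symmetric]) auto
  also have "\<dots> = 0" using N by auto
  finally show ?thesis
    unfolding mixed_norm_eq_iter_norm[OF assms(1)] using N
    by (intro iter_norm_cong_null[of "indicator N"]) (auto split: split_indicator_asm)
qed

section \<open>Maximal operators in single variables on mixed spaces\<close>

definition hl_at :: "'n \<Rightarrow> (real ^ 'n \<Rightarrow> ennreal) \<Rightarrow> real ^ 'n \<Rightarrow> ennreal" where
  "hl_at k G x = hlmax (\<lambda>s. G (vec_upd x k s)) (x $ k)"

lemma borel_measurable_hl_at [measurable]: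
  assumes [measurable]: "G \<in> borel_measurable borel"
  shows "hl_at k G \<in> borel_measurable borel"
proof -
  have [measurable]: "(\<lambda>x. ivl_int (\<lambda>s. G (vec_upd x k s) * ennreal 1) a b) \<in> borel_measurable borel" for a b
    unfolding ivl_int_def by measurable
  have "(\<lambda>x. indicator {a<..<b} (x $ k) * (ivl_int (\<lambda>s. G (vec_upd x k s) * ennreal 1) a b / c)) \<in> borel_measurable borel"
    for a b c by measurable
  then show ?thesis
    unfolding hl_at_def[abs_def] wmax_def split_beta by (intro borel_measurable_SUP countable_rat_ivls)
qed

text \<open>
  The induction over the inner variables: integrating one more variable with the matching exponent
  is Fubini's theorem, and extrapolation then restores all exponents and all weights in \<open>x\<^sub>k\<close>.
\<close>

lemma hl_at_iter_norm_weighted: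
  fixes p :: "real ^ 'n"
  assumes p: "\<And>i. 1 < p $ i" and "k \<notin> set is"
  shows "\<exists>c. \<forall>q K w G x. 1 < q \<longrightarrow> muckenhoupt q K w \<longrightarrow> G \<in> borel_measurable borel \<longrightarrow>
    (\<integral>\<^sup>+s. iter_norm p is (hl_at k G) (vec_upd x k s) \<up> q * ennreal (w s) \<partial>lborel)
    \<le> ennreal (c q K) * (\<integral>\<^sup>+s. iter_norm p is G (vec_upd x k s) \<up> q * ennreal (w s) \<partial>lborel)"
  using assms(2)
proof (induction "is" rule: rev_induct)
  case Nil
  show ?case
  proof (intro exI[of _ "\<lambda>q K. hlmax_norm q K powr q"] allI impI)
    fix q K w and G :: "real ^ 'n \<Rightarrow> ennreal" and x
    assume q: "1 < q" "muckenhoupt q K w" and [measurable]: "G \<in> borel_measurable borel"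
    show "(\<integral>\<^sup>+s. iter_norm p [] (hl_at k G) (vec_upd x k s) \<up> q * ennreal (w s) \<partial>lborel)
      \<le> ennreal (hlmax_norm q K powr q) * (\<integral>\<^sup>+s. iter_norm p [] G (vec_upd x k s) \<up> q * ennreal (w s) \<partial>lborel)"
      unfolding iter_norm.simps hl_at_def vec_upd_upd vec_upd_same
      by (intro hlmax_muckenhoupt q) measurable
  qed
next
  case (snoc i js)
  then have ik: "i \<noteq> k" and k: "k \<notin> set js" by auto
  obtain c where c: "\<And>q K w G x. 1 < q \<Longrightarrow> muckenhoupt q K w \<Longrightarrow> G \<in> borel_measurable borel \<Longrightarrow>
    (\<integral>\<^sup>+s. iter_norm p js (hl_at k G) (vec_upd x k s) \<up> q * ennreal (w s) \<partial>lborel)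
    \<le> ennreal (c q K) * (\<integral>\<^sup>+s. iter_norm p js G (vec_upd x k s) \<up> q * ennreal (w s) \<partial>lborel)"
    using snoc.IH[OF k] by blast
  let ?q = "p $ i"
  have q0: "?q \<noteq> 0" using p[of i] by simp
  show ?case
  \<comment> \<open>For fixed \<open>x\<close> both iterated norms are functions of \<open>s\<close>
    alone, and \<open>extrapolation\<close> is applied to this pair. Its hypothesis is then to be
    checked for every weight \<open>w\<close>, but only at the exponent
    \<open>p $ i\<close>.\<close>
  proof (intro exI[of _ "\<lambda>q K. extrapolation_const q ?q (c ?q) K"] allI impI extrapolation p)
    fix q' K' w' and G :: "real ^ 'n \<Rightarrow> ennreal" and x K w
    assume [measurable]: "G \<in> borel_measurable borel" and w: "muckenhoupt ?q K w"
    note [measurable] = weight_measurable[OF muckenhoupt_weight[OF w]]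
    have fub: "(\<integral>\<^sup>+s. iter_norm p (js @ [i]) H (vec_upd x k s) \<up> ?q * ennreal (w s) \<partial>lborel)
      = (\<integral>\<^sup>+u. (\<integral>\<^sup>+s. iter_norm p js H (vec_upd (vec_upd x i u) k s) \<up> ?q * ennreal (w s) \<partial>lborel) \<partial>lborel)"
      if [measurable]: "H \<in> borel_measurable borel" for H
    proof -
      have "(\<integral>\<^sup>+s. iter_norm p (js @ [i]) H (vec_upd x k s) \<up> ?q * ennreal (w s) \<partial>lborel)
        = (\<integral>\<^sup>+s. (\<integral>\<^sup>+u. iter_norm p js H (vec_upd (vec_upd x i u) k s) \<up> ?q * ennreal (w s) \<partial>lborel) \<partial>lborel)"
        using q0 by (simp add: iter_norm_append pnorm_def nn_integral_multc vec_upd_commute[OF ik])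
      also have "\<dots> = (\<integral>\<^sup>+u. (\<integral>\<^sup>+s. iter_norm p js H (vec_upd (vec_upd x i u) k s) \<up> ?q * ennreal (w s) \<partial>lborel) \<partial>lborel)"
        by (rule lborel_pair.Fubini') measurable
      finally show ?thesis .
    qed
    have "(\<integral>\<^sup>+s. iter_norm p (js @ [i]) (hl_at k G) (vec_upd x k s) \<up> ?q * ennreal (w s) \<partial>lborel)
      \<le> (\<integral>\<^sup>+u. ennreal (c ?q K) * (\<integral>\<^sup>+s. iter_norm p js G (vec_upd (vec_upd x i u) k s) \<up> ?q * ennreal (w s) \<partial>lborel) \<partial>lborel)"
      unfolding fub[OF borel_measurable_hl_at[OF \<open>G \<in> _\<close>]] by (rule nn_integral_mono) (intro c p w, measurable)
    also have "\<dots> = ennreal (c ?q K) * (\<integral>\<^sup>+u. (\<integral>\<^sup>+s. iter_norm p js G (vec_upd (vec_upd x i u) k s) \<up> ?q * ennreal (w s) \<partial>lborel) \<partial>lborel)"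
      by (rule nn_integral_cmult) measurable
    finally show "(\<integral>\<^sup>+s. iter_norm p (js @ [i]) (hl_at k G) (vec_upd x k s) \<up> ?q * ennreal (w s) \<partial>lborel)
      \<le> ennreal (c ?q K) * (\<integral>\<^sup>+s. iter_norm p (js @ [i]) G (vec_upd x k s) \<up> ?q * ennreal (w s) \<partial>lborel)"
      by (simp only: fub[OF \<open>G \<in> _\<close>])
  qed ((assumption | intro borel_measurable_line borel_measurable_iter_norm borel_measurable_hl_at)+)
qed

text \<open>The list of variables is cut at \<open>k\<close>. Up to \<open>k\<close> the weighted
  estimate is used with weight 1 and exponent \<open>p $ k\<close>; for the later variables
  monotonicity and homogeneity of the norm suffice.\<close>

lemma mixed_norm_hl_at:
  fixes p :: "real ^ 'n::{finite,linorder}"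
  assumes p: "\<And>i. 1 < p $ i"
  shows "\<exists>C. \<forall>G. G \<in> borel_measurable borel \<longrightarrow> mixed_norm p (hl_at k G) \<le> ennreal C * mixed_norm p G"
proof -
  have p0: "0 < p $ i" for i using p[of i] by simp
  have "k \<in> set (sorted_list_of_set UNIV)" "distinct (sorted_list_of_set (UNIV :: 'n set))" by auto
  then obtain xs ys where xy: "sorted_list_of_set UNIV = xs @ k # ys" "k \<notin> set xs"
    by (metis in_set_conv_decomp_first)
  obtain c where c: "\<And>q K w G x. 1 < q \<Longrightarrow> muckenhoupt q K w \<Longrightarrow> G \<in> borel_measurable borel \<Longrightarrow>
    (\<integral>\<^sup>+s. iter_norm p xs (hl_at k G) (vec_upd x k s) \<up> q * ennreal (w s) \<partial>lborel)
    \<le> ennreal (c q K) * (\<integral>\<^sup>+s. iter_norm p xs G (vec_upd x k s) \<up> q * ennreal (w s) \<partial>lborel)"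
    using hl_at_iter_norm_weighted[OF p xy(2)] by blast
  define C where "C = max 0 (c (p $ k) 1) powr (1 / p $ k)"
  show ?thesis
  proof (intro exI[of _ C] allI impI)
    fix G :: "real ^ 'n::{finite,linorder} \<Rightarrow> ennreal" assume G [measurable]: "G \<in> borel_measurable borel"
    have "pnorm k (p $ k) (iter_norm p xs (hl_at k G)) x \<le> ennreal C * pnorm k (p $ k) (iter_norm p xs G) x" for x
    proof -
      have "pnorm k (p $ k) (iter_norm p xs (hl_at k G)) x
        \<le> (ennreal (c (p $ k) 1) * (\<integral>\<^sup>+s. iter_norm p xs G (vec_upd x k s) \<up> (p $ k) \<partial>lborel)) \<up> (1 / p $ k)"
        unfolding pnorm_def using p0[of k] c[OF p muckenhoupt_1[OF p] G, of x]
        by (intro ennreal_powr_mono) auto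
      also have "\<dots> \<le> ennreal C * pnorm k (p $ k) (iter_norm p xs G) x"
        unfolding pnorm_def C_def
        by (cases "0 \<le> c (p $ k) 1") (auto simp: ennreal_powr_mult ennreal_powr_ennreal ennreal_neg)
      finally show ?thesis .
    qed
    then have "mixed_norm p (hl_at k G) \<le> iter_norm p ys (\<lambda>x. ennreal C * pnorm k (p $ k) (iter_norm p xs G) x) 0"
      unfolding mixed_norm_eq_iter_norm[OF p0] xy iter_norm_append iter_norm.simps
      by (intro iter_norm_mono p0)
    also have "\<dots> = ennreal C * mixed_norm p G"
      unfolding mixed_norm_eq_iter_norm[OF p0] xy iter_norm_append iter_norm.simps
      by (subst iter_norm_cmult) (auto intro: p0)
    finally show "mixed_norm p (hl_at k G) \<le> ennreal C * mixed_norm p G" .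
  qed
qed

lemma borel_measurable_fold_hl_at [measurable]:
  "G \<in> borel_measurable borel \<Longrightarrow> fold hl_at ks G \<in> borel_measurable borel"
  by (induction ks arbitrary: G) auto

lemma mixed_norm_fold_hl_at:
  fixes p :: "real ^ 'n::{finite,linorder}"
  assumes p: "\<And>i. 1 < p $ i"
  shows "\<exists>C. \<forall>G. G \<in> borel_measurable borel \<longrightarrow> mixed_norm p (fold hl_at ks G) \<le> ennreal C * mixed_norm p G"
proof (induction ks)
  case Nil
  show ?case by (intro exI[of _ 1]) simp
next
  case (Cons k ks)
  obtain C1 where C1: "\<And>G. G \<in> borel_measurable borel \<Longrightarrow> mixed_norm p (fold hl_at ks G) \<le> ennreal C1 * mixed_norm p G"
    using Cons by blast
  obtain C2 where C2: "\<And>G. G \<in> borel_measurable borel \<Longrightarrow> mixed_norm p (hl_at k G) \<le> ennreal C2 * mixed_norm p G"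
    using mixed_norm_hl_at[OF p, of k] by blast
  show ?case
  proof (intro exI[of _ "max 0 C1 * max 0 C2"] allI impI)
    fix G :: "real ^ 'n::{finite,linorder} \<Rightarrow> ennreal" assume [measurable]: "G \<in> borel_measurable borel"
    have "mixed_norm p (fold hl_at (k # ks) G) \<le> ennreal C1 * mixed_norm p (hl_at k G)"
      by (simp add: C1)
    also have "\<dots> \<le> ennreal C1 * (ennreal C2 * mixed_norm p G)"
      by (intro mult_left_mono C2) auto
    also have "\<dots> \<le> ennreal (max 0 C1 * max 0 C2) * mixed_norm p G"
      by (simp add: ennreal_mult ennreal_max_0 mult.assoc)
    finally show "mixed_norm p (fold hl_at (k # ks) G) \<le> ennreal (max 0 C1 * max 0 C2) * mixed_norm p G" .
  qed
qed

lemma iter_int_eq_0: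
  assumes "\<And>y. y $ j = x $ j \<Longrightarrow> F y = 0" "j \<notin> set is"
  shows "iter_int is F x = 0"
  using assms
proof (induction "is" arbitrary: F)
  case (Cons i js)
  then have "int_at i F y = 0" if "y $ j = x $ j" for y
    unfolding int_at_def using that by simp
  then show ?case using Cons by simp
qed simp

text \<open>An integral over one side of the box is at most its length times the maximal function in
  that variable. Replacing a coordinate of \<open>x\<close> by another point of the side keeps it in
  the box, so the induction hypothesis applies along the whole side.\<close>

lemma iter_int_box_le:
  fixes G :: "real ^ 'n \<Rightarrow> ennreal" and a b :: "real ^ 'n"
  assumes G [measurable]: "G \<in> borel_measurable borel" and "distinct is"
    and ab: "\<And>i. (a $ i, b $ i) \<in> rat_ivls" and "x \<in> box a b"
  shows "iter_int is (\<lambda>y. G y * indicator (box a b) y) x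
    \<le> ennreal (\<Prod>i\<in>set is. b $ i - a $ i) * fold hl_at is G x"
  using assms(2,4)
proof (induction "is" arbitrary: x rule: rev_induct)
  case (snoc i js)
  let ?H = "\<lambda>y. G y * indicator (box a b) y"
  let ?c = "ennreal (\<Prod>i\<in>set js. b $ i - a $ i)"
  have less: "a $ j < b $ j" for j using ab rat_ivls_less by blast
  have i: "i \<notin> set js" "distinct js" using snoc.prems by auto
  have xi: "x $ i \<in> {a $ i<..<b $ i}" using snoc.prems by (auto simp: mem_box_cart)
  have "iter_int (js @ [i]) ?H x = (\<integral>\<^sup>+s. iter_int js ?H (vec_upd x i s) \<partial>lborel)"
    by (simp add: iter_int_append int_at_def)
  also have "\<dots> \<le> (\<integral>\<^sup>+s. ?c * (fold hl_at js G (vec_upd x i s) * indicator {a $ i<..<b $ i} s) \<partial>lborel)"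
  proof (rule nn_integral_mono)
    fix s
    show "iter_int js ?H (vec_upd x i s) \<le> ?c * (fold hl_at js G (vec_upd x i s) * indicator {a $ i<..<b $ i} s)"
    proof (cases "s \<in> {a $ i<..<b $ i}")
      case True
      then have "vec_upd x i s \<in> box a b"
        using snoc.prems by (auto simp: mem_box_cart vec_upd_nth)
      then show ?thesis using snoc.IH[OF i(2)] True by simp
    next
      case False
      have "iter_int js ?H (vec_upd x i s) = 0"
        using False i by (intro iter_int_eq_0[of i]) (auto simp: mem_box_cart split: split_indicator)
      then show ?thesis by simp
    qed
  qed
  also have "\<dots> = ?c * ivl_int (\<lambda>s. fold hl_at js G (vec_upd x i s)) (a $ i) (b $ i)"
    unfolding ivl_int_def by (rule nn_integral_cmult) measurable
  also have "\<dots> \<le> ?c * (hl_at i (fold hl_at js G) x * ennreal (b $ i - a $ i))"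
    unfolding hl_at_def by (intro mult_left_mono hlmax_ge ab xi) simp
  also have "\<dots> = ennreal (\<Prod>i\<in>set (js @ [i]). b $ i - a $ i) * fold hl_at (js @ [i]) G x"
    using i less by (simp add: ennreal_mult prod_nonneg less_imp_le mult_ac)
  finally show ?case .
qed (simp split: split_indicator)

text \<open>A ball of radius \<open>\<rho>\<close> fits into a box with rational corners and sides
  at most \<open>4 * \<rho>\<close>; the constant is the quotient of the volumes. Averages do not
  distinguish \<open>f\<close> from its Borel representative \<open>G\<close>.\<close>

lemma hl_maximal_le_fold_hl_at:
  fixes f :: "real ^ 'n \<Rightarrow> complex"
  assumes ks: "distinct ks" "set ks = UNIV" and G [measurable]: "G \<in> borel_measurable borel"
    and eq: "AE x in lborel. ennreal (cmod (f x)) = G x"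
  shows "hl_maximal f x \<le> ennreal (4 ^ CARD('n) / unit_ball_vol (real CARD('n))) * fold hl_at ks G x"
  unfolding hl_maximal_def
proof (intro SUP_least, safe)
  fix c \<rho> assume \<rho>: "0 < \<rho>" and x: "x \<in> ball c \<rho>"
  have "\<forall>i. \<exists>q\<in>\<rat>. c $ i - 2 * \<rho> < q \<and> q < c $ i - \<rho>"
    using \<rho> by (intro allI Rats_dense_in_real[of "c $ _ - 2 * \<rho>" "c $ _ - \<rho>", simplified]) simp
  then obtain a' where a': "\<And>i. a' i \<in> \<rat>" "\<And>i. c $ i - 2 * \<rho> < a' i" "\<And>i. a' i < c $ i - \<rho>" by metis
  have "\<forall>i. \<exists>q\<in>\<rat>. c $ i + \<rho> < q \<and> q < c $ i + 2 * \<rho>"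
    using \<rho> by (intro allI Rats_dense_in_real[of "c $ _ + \<rho>" "c $ _ + 2 * \<rho>", simplified]) simp
  then obtain b' where b': "\<And>i. b' i \<in> \<rat>" "\<And>i. c $ i + \<rho> < b' i" "\<And>i. b' i < c $ i + 2 * \<rho>" by metis
  define a b :: "real ^ 'n" where "a = (\<chi> i. a' i)" and "b = (\<chi> i. b' i)"
  have ab: "(a $ i, b $ i) \<in> rat_ivls" for i
    using a'(1,3)[of i] b'(1,2)[of i] \<rho> by (auto simp: rat_ivls_def a_def b_def)
  have len: "b $ i - a $ i \<le> 4 * \<rho>" for i using a'(2)[of i] b'(3)[of i] by (simp add: a_def b_def)
  have sub: "ball c \<rho> \<subseteq> box a b"
  proof
    fix y assume "y \<in> ball c \<rho>"
    then have "\<bar>(c - y) $ i\<bar> < \<rho>" for i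
      using component_le_norm_cart[of "c - y" i] by (simp add: dist_norm)
    then show "y \<in> box a b"
      using a'(3) b'(2) unfolding mem_box_cart a_def b_def
      by (smt (verit, del_insts) vec_lambda_beta vector_minus_component)
  qed
  define m where "m = unit_ball_vol (real CARD('n)) * \<rho> ^ CARD('n)"
  have m: "0 < m" using \<rho> by (simp add: m_def)
  have ball: "emeasure lebesgue (ball c \<rho>) = ennreal m"
    using \<rho> by (simp add: emeasure_ball m_def)
  have prod: "(\<Prod>i\<in>UNIV. b $ i - a $ i) \<le> (4 * \<rho>) ^ CARD('n)"
    using len ab rat_ivls_less prod_mono[of UNIV "\<lambda>i. b $ i - a $ i" "\<lambda>_. 4 * \<rho>"]
    by (simp add: less_imp_le)
  have "(\<integral>\<^sup>+y\<in>ball c \<rho>. ennreal (cmod (f y)) \<partial>lebesgue) = (\<integral>\<^sup>+y\<in>ball c \<rho>. G y \<partial>lborel)"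
    unfolding nn_integral_completion using eq by (intro nn_integral_cong_AE) (auto elim: eventually_mono)
  also have "\<dots> \<le> (\<integral>\<^sup>+y. G y * indicator (box a b) y \<partial>lborel)"
    using sub by (intro nn_integral_mono) (auto split: split_indicator)
  also have "\<dots> = iter_int ks (\<lambda>y. G y * indicator (box a b) y) x"
    by (intro nn_integral_eq_iter_int ks) measurable
  also have "\<dots> \<le> ennreal (\<Prod>i\<in>set ks. b $ i - a $ i) * fold hl_at ks G x"
    using sub x by (intro iter_int_box_le G ks ab) auto
  also have "\<dots> \<le> ennreal ((4 * \<rho>) ^ CARD('n)) * fold hl_at ks G x"
    unfolding ks by (intro mult_right_mono ennreal_leI prod) simp
  finally have "(\<integral>\<^sup>+y\<in>ball c \<rho>. ennreal (cmod (f y)) \<partial>lebesgue) / emeasure lebesgue (ball c \<rho>)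
    \<le> ennreal ((4 * \<rho>) ^ CARD('n)) * fold hl_at ks G x / ennreal m"
    unfolding ball by (rule divide_right_mono_ennreal)
  also have "\<dots> = ennreal ((4 * \<rho>) ^ CARD('n) / m) * fold hl_at ks G x"
    using m \<rho> by (subst divide_ennreal[symmetric]) (auto simp only: divide_ennreal_def mult_ac intro: less_imp_le zero_le_power)
  also have "(4 * \<rho>) ^ CARD('n) / m = 4 ^ CARD('n) / unit_ball_vol (real CARD('n))"
    using \<rho> by (simp add: m_def power_mult_distrib)
  finally show "(\<integral>\<^sup>+y\<in>ball c \<rho>. ennreal (cmod (f y)) \<partial>lebesgue) / emeasure lebesgue (ball c \<rho>)
    \<le> ennreal (4 ^ CARD('n) / unit_ball_vol (real CARD('n))) * fold hl_at ks G x" .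
qed

lemma mixed_norm_mono:
  "(\<And>i. 0 < p $ i) \<Longrightarrow> (\<And>x. F x \<le> G x) \<Longrightarrow> mixed_norm p F \<le> mixed_norm p G"
  by (simp add: mixed_norm_eq_iter_norm iter_norm_mono)

lemma mixed_norm_cmult:
  "(\<And>i. 0 < p $ i) \<Longrightarrow> F \<in> borel_measurable borel \<Longrightarrow> mixed_norm p (\<lambda>x. c * F x) = c * mixed_norm p F"
  by (simp add: mixed_norm_eq_iter_norm iter_norm_cmult)

lemma mixed_norm_hl_maximal:
  fixes p :: "real ^ 'n::{finite,linorder}"
  assumes p: "\<And>i. 1 < p $ i"
  shows "\<exists>C\<ge>0. \<forall>f. f \<in> borel_measurable lebesgue \<longrightarrow>
    mixed_norm p (hl_maximal f) \<le> ennreal C * mixed_norm p (\<lambda>x. ennreal (cmod (f x)))"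
proof -
  have p0: "0 < p $ i" for i using p[of i] by simp
  define ks where "ks = sorted_list_of_set (UNIV :: 'n set)"
  have ks: "distinct ks" "set ks = UNIV" by (auto simp: ks_def)
  obtain C where C: "\<And>G. G \<in> borel_measurable borel \<Longrightarrow> mixed_norm p (fold hl_at ks G) \<le> ennreal C * mixed_norm p G"
    using mixed_norm_fold_hl_at[OF p, of ks] by blast
  define D where "D = 4 ^ CARD('n) / unit_ball_vol (real CARD('n))"
  have D: "0 \<le> D" by (simp add: D_def less_imp_le)
  show ?thesis
  proof (intro exI[of _ "D * max 0 C"] conjI allI impI)
    fix f :: "real ^ 'n::{finite,linorder} \<Rightarrow> complex" assume "f \<in> borel_measurable lebesgue"
    then have m: "(\<lambda>x. ennreal (cmod (f x))) \<in> borel_measurable (completion lborel)" by measurable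
    obtain G where "G \<in> borel_measurable lborel" and eq: "AE x in lborel. ennreal (cmod (f x)) = G x"
      using completion_ex_borel_measurable[OF m] by blast
    then have [measurable]: "G \<in> borel_measurable borel" by simp
    have "mixed_norm p (hl_maximal f) \<le> mixed_norm p (\<lambda>x. ennreal D * fold hl_at ks G x)"
      unfolding D_def by (intro mixed_norm_mono p0 hl_maximal_le_fold_hl_at ks eq) measurable
    also have "\<dots> = ennreal D * mixed_norm p (fold hl_at ks G)" by (intro mixed_norm_cmult p0) measurable
    also have "\<dots> \<le> ennreal D * (ennreal C * mixed_norm p G)" by (intro mult_left_mono C) auto
    also have "\<dots> \<le> ennreal (D * max 0 C) * mixed_norm p G"
      using D by (simp add: ennreal_mult ennreal_max_0 mult.assoc)
    also have "mixed_norm p G = mixed_norm p (\<lambda>x. ennreal (cmod (f x)))"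
      by (intro mixed_norm_cong_AE p0) (use eq in \<open>auto elim: eventually_mono\<close>)
    finally show "mixed_norm p (hl_maximal f) \<le> ennreal (D * max 0 C) * mixed_norm p (\<lambda>x. ennreal (cmod (f x)))" .
  qed (use D in auto)
qed

section \<open>Dyadic cubes\<close>

text \<open>One factor 2 comes from the power \<open>q\<close>, the other is a bound for
  \<open>2 powr (1 / q)\<close>. Such a constant is harmless because the number of functions ever
  added is bounded by the number of neighbours of a cube.\<close>

lemma pnorm_add_le:
  assumes [measurable]: "F \<in> borel_measurable borel" "G \<in> borel_measurable borel" and q: "1 < q"
  shows "pnorm i q (\<lambda>x. F x + G x) x \<le> 4 * (pnorm i q F x + pnorm i q G x)"
proof -
  define A where "A = (\<integral>\<^sup>+s. F (vec_upd x i s) \<up> q \<partial>lborel)"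
  define B where "B = (\<integral>\<^sup>+s. G (vec_upd x i s) \<up> q \<partial>lborel)"
  have "(\<integral>\<^sup>+s. (F (vec_upd x i s) + G (vec_upd x i s)) \<up> q \<partial>lborel)
    \<le> (\<integral>\<^sup>+s. 2 \<up> q * (F (vec_upd x i s) \<up> q + G (vec_upd x i s) \<up> q) \<partial>lborel)"
    using q by (intro nn_integral_mono ennreal_powr_add_le) simp
  also have "\<dots> = 2 \<up> q * (A + B)"
    by (simp add: A_def B_def nn_integral_cmult nn_integral_add)
  finally have "pnorm i q (\<lambda>x. F x + G x) x \<le> (2 \<up> q * (A + B)) \<up> (1 / q)"
    unfolding pnorm_def using q by (intro ennreal_powr_mono) auto
  also have "\<dots> = 2 * (A + B) \<up> (1 / q)" using q by (simp add: ennreal_powr_mult)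
  also have "\<dots> \<le> 2 * (2 \<up> (1 / q) * (A \<up> (1 / q) + B \<up> (1 / q)))"
    using q by (intro mult_left_mono ennreal_powr_add_le) auto
  also have "\<dots> \<le> 2 * (2 * (A \<up> (1 / q) + B \<up> (1 / q)))"
  proof (intro mult_left_mono mult_right_mono)
    have "2 \<up> (1 / q) = ennreal (2 powr (1 / q))" using ennreal_powr_ennreal[of 2 "1 / q"] by simp
    also have "\<dots> \<le> ennreal (2 powr 1)" using q by (intro ennreal_leI powr_mono) auto
    finally show "2 \<up> (1 / q) \<le> 2" by simp
  qed auto
  also have "\<dots> = 4 * (pnorm i q F x + pnorm i q G x)"
    by (simp add: A_def B_def pnorm_def mult.assoc[symmetric])
  finally show ?thesis .
qed

lemma iter_norm_add_le:
  assumes "F \<in> borel_measurable borel" "G \<in> borel_measurable borel" and p: "\<And>i. 1 < p $ i"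
  shows "iter_norm p is (\<lambda>x. F x + G x) x \<le> 4 ^ length is * (iter_norm p is F x + iter_norm p is G x)"
  using assms(1,2)
proof (induction "is" arbitrary: F G)
  case (Cons i js)
  have [measurable]: "F \<in> borel_measurable borel" "G \<in> borel_measurable borel" by fact+
  have p0: "0 < p $ j" for j using p[of j] by simp
  have "iter_norm p (i # js) (\<lambda>x. F x + G x) x
    \<le> iter_norm p js (\<lambda>x. 4 * (pnorm i (p $ i) F x + pnorm i (p $ i) G x)) x"
    unfolding iter_norm.simps by (intro iter_norm_mono p0 pnorm_add_le p) measurable
  also have "\<dots> = 4 * iter_norm p js (\<lambda>x. pnorm i (p $ i) F x + pnorm i (p $ i) G x) x"
    by (subst iter_norm_cmult) (auto intro: p0)
  also have "\<dots> \<le> 4 * (4 ^ length js * (iter_norm p js (pnorm i (p $ i) F) x + iter_norm p js (pnorm i (p $ i) G) x))"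
    by (intro mult_left_mono Cons.IH) auto
  finally show ?case by (simp add: mult.assoc)
qed simp

lemma mixed_norm_add_le:
  fixes p :: "real ^ 'n::{finite,linorder}"
  assumes "F \<in> borel_measurable borel" "G \<in> borel_measurable borel" and p: "\<And>i. 1 < p $ i"
  shows "mixed_norm p (\<lambda>x. F x + G x) \<le> 4 ^ CARD('n) * (mixed_norm p F + mixed_norm p G)"
proof -
  have p0: "0 < p $ j" for j using p[of j] by simp
  show ?thesis
    using iter_norm_add_le[OF assms, of "sorted_list_of_set UNIV" 0]
    by (simp add: mixed_norm_eq_iter_norm[OF p0])
qed

lemma mixed_norm_sum_le:
  fixes p :: "real ^ 'n::{finite,linorder}"
  assumes p: "\<And>i. 1 < p $ i" and "finite E" "\<And>e. e \<in> E \<Longrightarrow> F e \<in> borel_measurable borel"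
  shows "mixed_norm p (\<lambda>x. \<Sum>e\<in>E. F e x) \<le> (4 ^ CARD('n)) ^ card E * (\<Sum>e\<in>E. mixed_norm p (F e))"
  using assms(2,3)
proof (induction E rule: finite_induct)
  case empty
  have p0: "0 < p $ j" for j using p[of j] by simp
  show ?case using mixed_norm_cmult[of p "\<lambda>_. 0" 0] p0 by simp
next
  case (insert e E)
  let ?c = "4 ^ CARD('n) :: ennreal"
  have [measurable]: "F d \<in> borel_measurable borel" if "d \<in> insert e E" for d by (rule insert.prems) fact
  have c: "1 \<le> ?c ^ card E" by (intro one_le_power) simp
  have "mixed_norm p (\<lambda>x. \<Sum>d\<in>insert e E. F d x) = mixed_norm p (\<lambda>x. F e x + (\<Sum>d\<in>E. F d x))"
    using insert by simp
  also have "\<dots> \<le> ?c * (mixed_norm p (F e) + mixed_norm p (\<lambda>x. \<Sum>d\<in>E. F d x))"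
    by (intro mixed_norm_add_le p) measurable
  also have "\<dots> \<le> ?c * (?c ^ card E * mixed_norm p (F e) + ?c ^ card E * (\<Sum>d\<in>E. mixed_norm p (F d)))"
    using insert mult_right_mono[OF c, of "mixed_norm p (F e)"] by (intro mult_left_mono add_mono) auto
  also have "\<dots> = ?c ^ card (insert e E) * (\<Sum>d\<in>insert e E. mixed_norm p (F d))"
    using insert by (simp add: distrib_left mult.assoc)
  finally show ?case .
qed

section \<open>Geometry of dyadic cubes\<close>

definition side :: "int \<Rightarrow> real" where
  "side j = 2 powi (- j)"

lemma side_pos [simp]: "0 < side j"
  by (simp add: side_def)

lemma side_eq_powr: "side j = 2 powr (- real_of_int j)"
  unfolding side_def by (subst powr_real_of_int'[symmetric]) auto

lemma side_diff: "side (j - int l) = 2 ^ l * side j"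
  unfolding side_def by (simp add: power_int_diff power_int_minus divide_inverse)

lemma mem_dyadic_cube:
  "x \<in> dyadic_cube j m \<longleftrightarrow> (\<forall>i. x $ i \<in> {side j * m $ i..<side j * (m $ i + 1)})"
  by (auto simp: dyadic_cube_def side_def)

lemma mem_dyadic_cube_floor: "x \<in> dyadic_cube j m \<longleftrightarrow> (\<forall>i. \<lfloor>x $ i / side j\<rfloor> = m $ i)"
  unfolding mem_dyadic_cube floor_eq_iff by (auto simp: field_simps)

lemma borel_dyadic_cube [measurable]: "dyadic_cube j m \<in> sets borel"
proof -
  have "dyadic_cube j m = {x \<in> space borel. \<forall>i\<in>UNIV. side j * m $ i \<le> x $ i \<and> x $ i < side j * (m $ i + 1)}"
    by (auto simp: mem_dyadic_cube)
  also have "\<dots> \<in> sets borel" by measurable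
  finally show ?thesis .
qed

lemma measure_dyadic_cube: "measure lebesgue (dyadic_cube j m :: (real ^ 'n) set) = side j ^ CARD('n)"
proof -
  define a b :: "real ^ 'n" where "a = (\<chi> i. side j * m $ i)" and "b = (\<chi> i. side j * (m $ i + 1))"
  have le: "a \<bullet> c \<le> b \<bullet> c" if "c \<in> Basis" for c
  proof -
    obtain i where "c = axis i 1" using \<open>c \<in> Basis\<close> by (auto simp: Basis_vec_def)
    then show ?thesis by (simp add: inner_axis a_def b_def)
  qed
  have sub: "box a b \<subseteq> dyadic_cube j m" "dyadic_cube j m \<subseteq> cbox a b"
    by (auto simp: mem_dyadic_cube mem_box_cart a_def b_def less_imp_le)
  have "emeasure lborel (box a b) = emeasure lborel (cbox a b)" using le by simp
  then have "emeasure lborel (dyadic_cube j m) = emeasure lborel (cbox a b)"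
    using sub emeasure_mono[OF sub(1), of lborel] emeasure_mono[OF sub(2), of lborel] by auto
  then have "measure lebesgue (dyadic_cube j m) = measure lborel (cbox a b)"
    by (simp add: measure_def)
  also have "\<dots> = (\<Prod>i\<in>UNIV. b $ i - a $ i)"
    by (rule content_cbox_cart) (use le in \<open>auto simp: box_ne_empty\<close>)
  also have "\<dots> = side j ^ CARD('n)"
    by (simp add: a_def b_def algebra_simps)
  finally show ?thesis .
qed

text \<open>The measure of a cube determines \<open>j\<close>, and then its lower corner determines
  \<open>m\<close>. The Morrey norm sums over cubes as sets whereas the estimates run over pairs of
  indices; this identifies the two.\<close>

lemma inj_dyadic_cube: "inj (\<lambda>(j, m :: int ^ 'n). dyadic_cube j m)"
proof (rule injI, clarsimp)
  fix j j' :: int and m m' :: "int ^ 'n" assume eq: "dyadic_cube j m = dyadic_cube j' m'"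
  then have "side j ^ CARD('n) = side j' ^ CARD('n)"
    using measure_dyadic_cube[of j m] measure_dyadic_cube[of j' m'] by simp
  then have "side j = side j'" by (rule power_eq_imp_eq_base) (auto intro: less_imp_le)
  then have j: "j = j'" by (simp add: side_eq_powr powr_inj)
  have "(\<chi> i. side j * m $ i) \<in> dyadic_cube j m" by (simp add: mem_dyadic_cube)
  moreover from this have "(\<chi> i. side j * m $ i) \<in> dyadic_cube j m'" using eq j by simp
  ultimately have "m = m'" unfolding mem_dyadic_cube_floor vec_eq_iff by simp
  then show "j = j' \<and> m = m'" using j by simp
qed

text \<open>Index of the ancestor at level \<open>j - int l\<close>, whose side is
  \<open>2 ^ l\<close> times longer. As \<open>div\<close> rounds downwards, this is right for
  negative coordinates too.\<close>

definition parent :: "nat \<Rightarrow> int ^ 'n \<Rightarrow> int ^ 'n" where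
  "parent l m = (\<chi> i. m $ i div 2 ^ l)"

text \<open>Zero is included: added to the index of a cube, the offsets give the cube itself and all
  cubes of its size that touch it.\<close>

definition offsets :: "(int ^ 'n) set" where
  "offsets = {e. \<forall>i. e $ i \<in> {-1..1}}"

lemma finite_int_box:
  fixes A :: "'n::finite \<Rightarrow> int set"
  assumes "\<And>i. finite (A i)"
  shows "finite {m :: int ^ 'n. \<forall>i. m $ i \<in> A i} \<and> card {m :: int ^ 'n. \<forall>i. m $ i \<in> A i} \<le> (\<Prod>i\<in>UNIV. card (A i))"
proof -
  have eq: "{m :: int ^ 'n. \<forall>i. m $ i \<in> A i} = vec_lambda ` (\<Pi>\<^sub>E i\<in>UNIV. A i)"
  proof
    show "{m :: int ^ 'n. \<forall>i. m $ i \<in> A i} \<subseteq> vec_lambda ` (\<Pi>\<^sub>E i\<in>UNIV. A i)"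
    proof
      fix m :: "int ^ 'n" assume "m \<in> {m. \<forall>i. m $ i \<in> A i}"
      then have "vec_nth m \<in> (\<Pi>\<^sub>E i\<in>UNIV. A i)" "m = vec_lambda (vec_nth m)" by auto
      then show "m \<in> vec_lambda ` (\<Pi>\<^sub>E i\<in>UNIV. A i)" by blast
    qed
  qed (auto simp: PiE_iff)
  have fin: "finite (\<Pi>\<^sub>E i\<in>UNIV. A i)" using assms by (intro finite_PiE) auto
  then show ?thesis unfolding eq using card_image_le[OF fin, of vec_lambda] by (simp add: card_PiE)
qed

lemma finite_offsets: "finite (offsets :: (int ^ 'n::finite) set)"
  unfolding offsets_def using finite_int_box[of "\<lambda>_::'n. {-1..1}"] by simp

lemma card_parent_fibre:
  fixes M :: "int ^ 'n"
  shows "finite {m. parent l m = M}" "card {m. parent l m = M} \<le> 2 ^ (l * CARD('n))"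
proof -
  have div_bounds: "2 ^ l * (k div 2 ^ l) \<le> k \<and> k < 2 ^ l * (k div 2 ^ l) + 2 ^ l" for k :: int
  proof -
    have "(0 :: int) < 2 ^ l" by simp
    then show ?thesis
      using mult_div_mod_eq[of "2 ^ l" k] pos_mod_sign[of "2 ^ l" k] pos_mod_bound[of "2 ^ l" k] by linarith
  qed
  have "{m. parent l m = M} \<subseteq> {m. \<forall>i. m $ i \<in> {2 ^ l * M $ i..<2 ^ l * M $ i + 2 ^ l}}"
  proof
    fix m assume "m \<in> {m. parent l m = M}"
    then have "M $ i = m $ i div 2 ^ l" for i by (auto simp: parent_def)
    then show "m \<in> {m. \<forall>i. m $ i \<in> {2 ^ l * M $ i..<2 ^ l * M $ i + 2 ^ l}}"
      using div_bounds by auto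
  qed
  moreover have "finite {m :: int ^ 'n. \<forall>i. m $ i \<in> {2 ^ l * M $ i..<2 ^ l * M $ i + 2 ^ l}} \<and>
    card {m :: int ^ 'n. \<forall>i. m $ i \<in> {2 ^ l * M $ i..<2 ^ l * M $ i + 2 ^ l}}
      \<le> (\<Prod>i\<in>UNIV. card {2 ^ l * M $ i..<2 ^ l * M $ i + 2 ^ l})"
    by (rule finite_int_box) simp
  moreover have "(\<Prod>i\<in>(UNIV::'n set). card {2 ^ l * M $ i..<2 ^ l * M $ i + 2 ^ l}) = 2 ^ (l * CARD('n))"
    by (simp add: power_mult nat_power_eq)
  ultimately show "finite {m. parent l m = M}" "card {m. parent l m = M} \<le> 2 ^ (l * CARD('n))"
    by (auto intro: finite_subset order_trans[OF card_mono])
qed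

text \<open>Measured in units of the larger side, the coordinates of \<open>x\<close> and
  \<open>y\<close> differ by less than 1, so their floors differ by at most 1.\<close>

lemma dyadic_neighbour:
  fixes x y :: "real ^ 'n"
  assumes x: "x \<in> dyadic_cube j m" and xy: "\<And>i. \<bar>y $ i - x $ i\<bar> < 2 ^ l * side j"
  shows "\<exists>e\<in>offsets. y \<in> dyadic_cube (j - int l) (parent l m + e)"
proof -
  define L where "L = side (j - int l)"
  have L: "L = 2 ^ l * side j" "0 < L" by (simp_all add: L_def side_diff[symmetric])
  define e where "e = (\<chi> i. \<lfloor>y $ i / L\<rfloor> - parent l m $ i)"
  have "e $ i \<in> {-1..1}" for i
  proof -
    have "\<lfloor>x $ i / L\<rfloor> = m $ i div 2 ^ l"
    proof -
      have "x $ i / L = x $ i / side j / real_of_int (2 ^ l)" by (simp add: L)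
      then have "\<lfloor>x $ i / L\<rfloor> = \<lfloor>x $ i / side j\<rfloor> div 2 ^ l"
        by (simp only: floor_divide_real_eq_div zero_le_power zero_le_numeral)
      then show ?thesis using x by (simp add: mem_dyadic_cube_floor)
    qed
    moreover have "\<bar>y $ i / L - x $ i / L\<bar> < 1"
      using xy[of i] L by (simp add: diff_divide_distrib[symmetric] abs_divide)
    ultimately show ?thesis unfolding e_def parent_def by simp linarith
  qed
  then have "e \<in> offsets" by (simp add: offsets_def)
  moreover have "y \<in> dyadic_cube (j - int l) (parent l m + e)"
    unfolding mem_dyadic_cube_floor by (simp add: e_def L_def)
  ultimately show ?thesis by blast
qed

section \<open>Integrals and mixed norms on a single cube\<close>

text \<open>Hoelder's inequality in each variable against the indicator of an interval of length
  \<open>L\<close>. The support condition is imposed coordinate by coordinate because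
  \<open>pnorm i (p $ i) F\<close> inherits it in this form for the remaining variables.\<close>

lemma iter_int_le_iter_norm:
  fixes p :: "real ^ 'n"
  assumes p: "\<And>i. 1 < p $ i" and "F \<in> borel_measurable borel"
    and "\<And>y i. i \<in> set is \<Longrightarrow> y $ i \<notin> {a i..<a i + L} \<Longrightarrow> F y = 0" and L: "0 < L"
    and "distinct is"
  shows "iter_int is F x \<le> ennreal (L powr (\<Sum>i\<in>set is. 1 - 1 / p $ i)) * iter_norm p is F x"
  using assms(2,3,5)
proof (induction "is" arbitrary: F)
  case Nil
  then show ?case using L by simp
next
  case (Cons i js)
  have [measurable]: "F \<in> borel_measurable borel" by fact
  have p0: "0 < p $ j" for j using p[of j] by simp
  have i: "i \<notin> set js" "distinct js" using Cons.prems by auto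
  define q where "q = p $ i / (p $ i - 1)"
  have q: "1 < q" "1 / p $ i + 1 / q = 1" "1 / q = 1 - 1 / p $ i"
    using p[of i] by (auto simp: q_def field_simps)
  have one: "int_at i F y \<le> ennreal (L powr (1 - 1 / p $ i)) * pnorm i (p $ i) F y" for y
  proof -
    have "int_at i F y = (\<integral>\<^sup>+s. F (vec_upd y i s) * indicator {a i..<a i + L} s \<partial>lborel)"
      unfolding int_at_def
    proof (rule nn_integral_cong)
      fix s
      have "F (vec_upd y i s) = 0" if "s \<notin> {a i..<a i + L}" using that by (intro Cons.prems(2)[of i]) auto
      then show "F (vec_upd y i s) = F (vec_upd y i s) * indicator {a i..<a i + L} s"
        by (cases "s \<in> {a i..<a i + L}") auto
    qed
    also have "\<dots> \<le> (\<integral>\<^sup>+s. F (vec_upd y i s) \<up> (p $ i) \<partial>lborel) \<up> (1 / p $ i) * (\<integral>\<^sup>+s. indicator {a i..<a i + L} s \<up> q \<partial>lborel) \<up> (1 / q)"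
      by (intro Holder_nn_integral p q) measurable
    also have "(\<integral>\<^sup>+s. indicator {a i..<a i + L} s \<up> q \<partial>lborel) = ennreal L"
      using ennreal_powr_indicator[of 1 "{a i..<a i + L}" _ q] L by simp
    finally show ?thesis using L by (simp add: pnorm_def ennreal_powr_ennreal q(3) mult.commute)
  qed
  have "iter_int (i # js) F x \<le> iter_int js (\<lambda>y. ennreal (L powr (1 - 1 / p $ i)) * pnorm i (p $ i) F y) x"
    unfolding iter_int.simps by (intro iter_int_mono one)
  also have "\<dots> = ennreal (L powr (1 - 1 / p $ i)) * iter_int js (pnorm i (p $ i) F) x"
    by (subst iter_int_cmult) auto
  also have "\<dots> \<le> ennreal (L powr (1 - 1 / p $ i)) * (ennreal (L powr (\<Sum>i\<in>set js. 1 - 1 / p $ i)) * iter_norm p js (pnorm i (p $ i) F) x)"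
  proof (intro mult_left_mono Cons.IH i)
    fix y k assume k: "k \<in> set js" "y $ k \<notin> {a k..<a k + L}"
    then have "F (vec_upd y i s) = 0" for s
      using i by (intro Cons.prems(2)[of k]) (auto simp: vec_upd_nth)
    then show "pnorm i (p $ i) F y = 0" by (simp add: pnorm_def)
  qed auto
  also have "\<dots> = ennreal (L powr (\<Sum>i\<in>set (i # js). 1 - 1 / p $ i)) * iter_norm p (i # js) F x"
    using i by (simp add: powr_add ennreal_mult mult.assoc)
  finally show ?case .
qed

text \<open>The bound is a product of functions of single coordinates, so each norm in one variable
  takes out one factor \<open>L powr (1 / p $ i)\<close> and leaves a bound of the same
  shape.\<close>

lemma iter_norm_box_le:
  fixes p :: "real ^ 'n"
  assumes p: "\<And>i. 0 < p $ i" and L: "0 < L" and "distinct is"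
    and "\<And>y. F y \<le> c * (\<Prod>i\<in>set is. indicator {a i..<a i + L} (y $ i))"
  shows "iter_norm p is F x \<le> c * ennreal (L powr (\<Sum>i\<in>set is. 1 / p $ i))"
  using assms(3,4)
proof (induction "is" arbitrary: F c)
  case Nil
  then show ?case using L by simp
next
  case (Cons i js)
  have i: "i \<notin> set js" "distinct js" using Cons.prems by auto
  have "pnorm i (p $ i) F y \<le> c * ennreal (L powr (1 / p $ i)) * (\<Prod>i\<in>set js. indicator {a i..<a i + L} (y $ i))" for y
  proof -
    define P :: ennreal where "P = (\<Prod>i\<in>set js. indicator {a i..<a i + L} (y $ i))"
    have F: "F (vec_upd y i s) \<le> (c * P) * indicator {a i..<a i + L} s" for s
    proof -
      have "(\<Prod>k\<in>set js. indicator {a k..<a k + L} (vec_upd y i s $ k)) = P"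
        unfolding P_def using i by (intro prod.cong) (auto simp: vec_upd_nth)
      then show ?thesis using Cons.prems(2)[of "vec_upd y i s"] i by (simp add: mult_ac)
    qed
    have "pnorm i (p $ i) F y \<le> (\<integral>\<^sup>+s. ((c * P) * indicator {a i..<a i + L} s) \<up> (p $ i) \<partial>lborel) \<up> (1 / p $ i)"
      unfolding pnorm_def using p[of i] by (intro ennreal_powr_mono nn_integral_mono F) auto
    also have "\<dots> = c * P * ennreal (L powr (1 / p $ i))"
      using L p[of i] by (simp add: ennreal_powr_indicator nn_integral_cmult_indicator ennreal_powr_mult[of _ "ennreal L"] ennreal_powr_ennreal ennreal_powr_powr)
    finally show ?thesis by (simp add: P_def mult_ac)
  qed
  then have "iter_norm p (i # js) F x \<le> c * ennreal (L powr (1 / p $ i)) * ennreal (L powr (\<Sum>i\<in>set js. 1 / p $ i))"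
    unfolding iter_norm.simps by (intro Cons.IH i)
  also have "\<dots> = c * ennreal (L powr (\<Sum>i\<in>set (i # js). 1 / p $ i))"
    using i by (simp add: powr_add ennreal_mult mult.assoc)
  finally show ?case .
qed

lemma nn_integral_dyadic_cube_le:
  fixes p :: "real ^ 'n::{finite,linorder}"
  assumes p: "\<And>i. 1 < p $ i" and [measurable]: "G \<in> borel_measurable borel"
  shows "(\<integral>\<^sup>+x. G x * indicator (dyadic_cube j m) x \<partial>lborel)
    \<le> ennreal (side j powr (real CARD('n) - (\<Sum>i\<in>UNIV. 1 / p $ i))) * mixed_norm p (\<lambda>x. G x * indicator (dyadic_cube j m) x)"
proof -
  have p0: "0 < p $ i" for i using p[of i] by simp
  let ?is = "sorted_list_of_set (UNIV :: 'n set)"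
  have "(\<integral>\<^sup>+x. G x * indicator (dyadic_cube j m) x \<partial>lborel) = iter_int ?is (\<lambda>x. G x * indicator (dyadic_cube j m) x) 0"
    by (rule nn_integral_eq_iter_int) auto
  also have "\<dots> \<le> ennreal (side j powr (\<Sum>i\<in>set ?is. 1 - 1 / p $ i)) * iter_norm p ?is (\<lambda>x. G x * indicator (dyadic_cube j m) x) 0"
    by (rule iter_int_le_iter_norm[OF p, where a = "\<lambda>i. side j * m $ i"])
       (auto simp: mem_dyadic_cube algebra_simps split: split_indicator)
  also have "\<dots> = ennreal (side j powr (real CARD('n) - (\<Sum>i\<in>UNIV. 1 / p $ i))) * mixed_norm p (\<lambda>x. G x * indicator (dyadic_cube j m) x)"
    by (simp add: mixed_norm_eq_iter_norm[OF p0] sum_subtractf)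
  finally show ?thesis .
qed

lemma mixed_norm_const_dyadic_cube:
  fixes p :: "real ^ 'n::{finite,linorder}"
  assumes p: "\<And>i. 0 < p $ i"
  shows "mixed_norm p (\<lambda>x. c * indicator (dyadic_cube j m) x) \<le> c * ennreal (side j powr (\<Sum>i\<in>UNIV. 1 / p $ i))"
proof -
  have "mixed_norm p (\<lambda>x. c * indicator (dyadic_cube j m) x)
    \<le> c * ennreal (side j powr (\<Sum>i\<in>set (sorted_list_of_set (UNIV :: 'n set)). 1 / p $ i))"
    unfolding mixed_norm_eq_iter_norm[OF p]
  proof (rule iter_norm_box_le[OF p, where a = "\<lambda>i. side j * m $ i"])
    fix y :: "real ^ 'n::{finite,linorder}"
    show "c * indicator (dyadic_cube j m) y \<le> c * (\<Prod>i\<in>set (sorted_list_of_set UNIV). indicator {side j * m $ i..<side j * m $ i + side j} (y $ i))"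
    proof (cases "y \<in> dyadic_cube j m")
      case True
      then have "(\<Prod>i\<in>(UNIV :: 'n set). indicator {side j * m $ i..<side j * m $ i + side j} (y $ i)) = (1 :: ennreal)"
        by (intro prod.neutral) (auto simp: mem_dyadic_cube algebra_simps)
      then show ?thesis by (auto split: split_indicator)
    qed simp
  qed auto
  then show ?thesis by simp
qed

section \<open>Mixed Bourgain--Morrey norms\<close>

text \<open>Every term is at most the \<open>a\<close>-th root of the sum of the \<open>a\<close>-th
  powers, for exponents below 1 as well as above.\<close>

lemma ennreal_powr_sum_le:
  fixes x :: "'e \<Rightarrow> ennreal"
  assumes "finite E" "0 < a"
  shows "(\<Sum>e\<in>E. x e) \<up> a \<le> of_nat (card E) \<up> a * (\<Sum>e\<in>E. x e \<up> a)"
proof -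
  have "x e \<le> (\<Sum>e\<in>E. x e \<up> a) \<up> (1 / a)" if "e \<in> E" for e
    using assms that member_le_sum[of e E "\<lambda>e. x e \<up> a"] by (simp add: ennreal_le_powr_iff)
  then have "(\<Sum>e\<in>E. x e) \<le> of_nat (card E) * (\<Sum>e\<in>E. x e \<up> a) \<up> (1 / a)"
    by (rule sum_bounded_above)
  then have "(\<Sum>e\<in>E. x e) \<up> a \<le> (of_nat (card E) * (\<Sum>e\<in>E. x e \<up> a) \<up> (1 / a)) \<up> a"
    using assms by (intro ennreal_powr_mono) auto
  then show ?thesis using assms by (simp add: ennreal_powr_mult)
qed

lemma borel_measurable_hl_maximal_borel [measurable]: "hl_maximal f \<in> borel_measurable borel"
  by (rule borel_measurableI_greater) (use open_hl_maximal_greater[of _ f] in \<open>simp add: borel_open\<close>)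

text \<open>A ball through \<open>x\<close> is assigned to the least generation \<open>l\<close>
  whose side is at least its diameter, and it lies in the neighbours of the ancestor of that
  generation. If \<open>l\<close> is 0, it meets only the neighbours of the cube itself. Otherwise
  minimality makes its volume comparable to that of the ancestor, and its average is controlled by
  the integrals over the neighbours of that ancestor.\<close>

lemma hl_maximal_dyadic_cube_le:
  fixes f :: "real ^ 'n \<Rightarrow> complex"
  assumes x: "x \<in> dyadic_cube j m" and [measurable]: "G \<in> borel_measurable borel"
    and eq: "AE y in lborel. ennreal (cmod (f y)) = G y"
  shows "hl_maximal f x \<le>
    hl_maximal (\<lambda>y. indicator (\<Union>e\<in>offsets. dyadic_cube j (m + e)) y *\<^sub>R f y) x +
    ennreal (4 ^ CARD('n) / unit_ball_vol (real CARD('n))) *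
      (\<Sum>e\<in>offsets. SUP l. ennreal (1 / side (j - int l) ^ CARD('n)) *
        (\<integral>\<^sup>+y. G y * indicator (dyadic_cube (j - int l) (parent l m + e)) y \<partial>lborel))"
    (is "_ \<le> hl_maximal ?g x + ennreal ?D * (\<Sum>e\<in>offsets. SUP l. ?A l e)")
  unfolding hl_maximal_def[of f]
proof (intro SUP_least, safe)
  fix c \<rho> assume \<rho>: "0 < \<rho>" and xc: "x \<in> ball c \<rho>"
  let ?X = "\<integral>\<^sup>+y\<in>ball c \<rho>. ennreal (cmod (f y)) \<partial>lebesgue"
  define P where "P l \<longleftrightarrow> 2 * \<rho> \<le> 2 ^ l * side j" for l :: nat
  have "\<exists>l. P l"
  proof -
    obtain l where "2 * \<rho> / side j < 2 ^ l" using real_arch_pow[of 2] by auto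
    then show ?thesis unfolding P_def by (intro exI[of _ l]) (simp add: divide_less_eq less_imp_le)
  qed
  define l where "l = (LEAST l. P l)"
  have l: "P l" unfolding l_def using \<open>\<exists>l. P l\<close> by (rule LeastI_ex)
  have cover: "\<exists>e\<in>offsets. y \<in> dyadic_cube (j - int l) (parent l m + e)" if "y \<in> ball c \<rho>" for y
  proof (rule dyadic_neighbour[OF x])
    fix i
    have "\<bar>(y - x) $ i\<bar> \<le> norm (y - x)" by (rule component_le_norm_cart)
    also have "\<dots> \<le> dist c y + dist c x" by (metis dist_commute dist_norm dist_triangle)
    also have "\<dots> < 2 ^ l * side j" using that xc l by (simp add: P_def)
    finally show "\<bar>y $ i - x $ i\<bar> < 2 ^ l * side j" by simp
  qed
  have "?X / emeasure lebesgue (ball c \<rho>) \<le> hl_maximal ?g x \<or>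
    ?X / emeasure lebesgue (ball c \<rho>) \<le> ennreal ?D * (\<Sum>e\<in>offsets. SUP l. ?A l e)"
  proof (cases l)
    case 0
    have "ball c \<rho> \<subseteq> (\<Union>e\<in>offsets. dyadic_cube j (m + e))"
      using cover by (auto simp: 0 parent_def)
    then have "?X = (\<integral>\<^sup>+y\<in>ball c \<rho>. ennreal (cmod (?g y)) \<partial>lebesgue)"
      by (intro nn_integral_cong) (auto split: split_indicator)
    then show ?thesis using \<rho> xc unfolding hl_maximal_def
      by (intro disjI1 SUP_upper2[of "(c, \<rho>)"]) auto
  next
    case (Suc l')
    define L where "L = side (j - int l)"
    have L: "0 < L" "L = 2 ^ l * side j" by (simp_all add: L_def side_diff[symmetric])
    \<comment> \<open>Failure of \<open>P\<close> one generation earlier bounds the side by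
      \<open>4 * \<rho>\<close>; this is the origin of \<open>4 ^ CARD('n)\<close>.\<close>
    have "\<not> P l'" using not_less_Least[of l' P] Suc by (simp add: l_def)
    then have "L < 4 * \<rho>" using Suc by (simp add: L P_def mult.commute)
    then have pw: "(L / 4) ^ CARD('n) \<le> \<rho> ^ CARD('n)" using L(1) by (intro power_mono) auto
    define v where "v = unit_ball_vol (real CARD('n))"
    have v: "0 < v" by (simp add: v_def)
    have ball: "emeasure lebesgue (ball c \<rho>) = ennreal (v * \<rho> ^ CARD('n))"
      using \<rho> by (simp add: emeasure_ball v_def)
    have "?X = (\<integral>\<^sup>+y\<in>ball c \<rho>. G y \<partial>lborel)"
      unfolding nn_integral_completion using eq by (intro nn_integral_cong_AE) (auto elim: eventually_mono)
    also have "\<dots> \<le> (\<integral>\<^sup>+y. (\<Sum>e\<in>offsets. G y * indicator (dyadic_cube (j - int l) (parent l m + e)) y) \<partial>lborel)"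
    proof (rule nn_integral_mono)
      fix y
      show "G y * indicator (ball c \<rho>) y \<le> (\<Sum>e\<in>offsets. G y * indicator (dyadic_cube (j - int l) (parent l m + e)) y)"
      proof (cases "y \<in> ball c \<rho>")
        case True
        then obtain e where e: "e \<in> offsets" "y \<in> dyadic_cube (j - int l) (parent l m + e)" using cover by blast
        have "G y * indicator (dyadic_cube (j - int l) (parent l m + e)) y \<le> (\<Sum>e\<in>offsets. G y * indicator (dyadic_cube (j - int l) (parent l m + e)) y)"
          by (intro member_le_sum e finite_offsets) simp
        then show ?thesis using e True by simp
      qed simp
    qed
    also have "\<dots> = (\<Sum>e\<in>offsets. (\<integral>\<^sup>+y. G y * indicator (dyadic_cube (j - int l) (parent l m + e)) y \<partial>lborel))"
      by (rule nn_integral_sum) measurable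
    finally have X: "?X \<le> (\<Sum>e\<in>offsets. (\<integral>\<^sup>+y. G y * indicator (dyadic_cube (j - int l) (parent l m + e)) y \<partial>lborel))" .
    have "?X / emeasure lebesgue (ball c \<rho>) = ?X * ennreal (1 / (v * \<rho> ^ CARD('n)))"
      unfolding ball using v \<rho> by (simp add: divide_ennreal_def inverse_ennreal divide_inverse)
    also have "\<dots> \<le> ?X * ennreal (?D * (1 / L ^ CARD('n)))"
    proof (intro mult_left_mono ennreal_leI)
      have "1 / (v * \<rho> ^ CARD('n)) \<le> 1 / (v * (L / 4) ^ CARD('n))"
        using v \<rho> L pw by (intro divide_left_mono mult_left_mono mult_pos_pos) auto
      also have "\<dots> = ?D * (1 / L ^ CARD('n))" using v by (simp add: v_def power_divide)
      finally show "1 / (v * \<rho> ^ CARD('n)) \<le> ?D * (1 / L ^ CARD('n))" .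
    qed simp
    also have "\<dots> = ennreal ?D * (ennreal (1 / L ^ CARD('n)) * ?X)"
      using v L(1) by (subst ennreal_mult) (auto simp: v_def mult_ac)
    also have "\<dots> \<le> ennreal ?D * (ennreal (1 / L ^ CARD('n)) * (\<Sum>e\<in>offsets. (\<integral>\<^sup>+y. G y * indicator (dyadic_cube (j - int l) (parent l m + e)) y \<partial>lborel)))"
      by (intro mult_left_mono X) auto
    also have "\<dots> = ennreal ?D * (\<Sum>e\<in>offsets. ?A l e)"
      by (simp add: sum_distrib_left L_def)
    also have "\<dots> \<le> ennreal ?D * (\<Sum>e\<in>offsets. SUP l. ?A l e)"
      by (intro mult_left_mono sum_mono SUP_upper) auto
    finally show ?thesis ..
  qed
  then show "?X / emeasure lebesgue (ball c \<rho>) \<le> hl_maximal ?g x + ennreal ?D * (\<Sum>e\<in>offsets. SUP l. ?A l e)"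
    by (auto intro: add_increasing add_increasing2)
qed

text \<open>A term of the Morrey norm before it is raised to the power \<open>r\<close>, so that
  finite and infinite \<open>r\<close> differ only in how the terms are combined.\<close>

definition morrey_coeff ::
  "real ^ 'n::{finite,linorder} \<Rightarrow> real \<Rightarrow> (real ^ 'n::{finite,linorder} \<Rightarrow> ennreal) \<Rightarrow> (real ^ 'n::{finite,linorder}) set \<Rightarrow> ennreal" where
  "morrey_coeff p t F Q = ennreal (measure lebesgue Q powr (1 / t - 1 / real CARD('n) * (\<Sum>i\<in>UNIV. 1 / p $ i)))
     * mixed_norm p (\<lambda>x. F x * indicator Q x)"

lemma morrey_coeff_dyadic_cube:
  fixes p :: "real ^ 'n::{finite,linorder}"
  shows "morrey_coeff p t F (dyadic_cube j m) =
    ennreal (side j powr (real CARD('n) / t - (\<Sum>i\<in>UNIV. 1 / p $ i))) * mixed_norm p (\<lambda>x. F x * indicator (dyadic_cube j m) x)"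
proof -
  have "(side j ^ CARD('n)) powr (1 / t - 1 / real CARD('n) * (\<Sum>i\<in>UNIV. 1 / p $ i))
    = side j powr (real CARD('n) * (1 / t - 1 / real CARD('n) * (\<Sum>i\<in>UNIV. 1 / p $ i)))"
    by (simp only: powr_realpow[symmetric] side_pos powr_powr)
  also have "real CARD('n) * (1 / t - 1 / real CARD('n) * (\<Sum>i\<in>UNIV. 1 / p $ i)) = real CARD('n) / t - (\<Sum>i\<in>UNIV. 1 / p $ i)"
    by (simp add: right_diff_distrib)
  finally show ?thesis by (simp add: morrey_coeff_def measure_dyadic_cube)
qed

text \<open>Let \<open>\<sigma>\<close> be the sum of the \<open>1 / p $ i\<close>. By Hoelder's
  inequality, the average over a cube of side \<open>L\<close> is at most
  \<open>L powr (- \<sigma>)\<close> times the mixed norm there. A constant on the small cube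
  contributes \<open>side j powr (n / t)\<close> times its value to the coefficient, while the large
  cube carries \<open>L powr (n / t - \<sigma>)\<close>. The quotient of the powers with exponent
  \<open>n / t\<close> is the decay factor.\<close>

lemma morrey_coeff_hl_maximal:
  fixes p :: "real ^ 'n::{finite,linorder}"
  assumes p: "\<And>i. 1 < p $ i" and t: "0 < t"
  shows "\<exists>C. C \<noteq> top \<and> (\<forall>f G j m. f \<in> borel_measurable lebesgue \<longrightarrow> G \<in> borel_measurable borel \<longrightarrow>
    (AE y in lborel. ennreal (cmod (f y)) = G y) \<longrightarrow>
    morrey_coeff p t (hl_maximal f) (dyadic_cube j m) \<le>
      C * (\<Sum>e\<in>offsets. SUP l. ennreal (2 powr (- (real l * real CARD('n) / t))) *
        morrey_coeff p t G (dyadic_cube (j - int l) (parent l m + e))))"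
proof -
  have p0: "0 < p $ i" for i using p[of i] by simp
  define n where "n = real CARD('n)"
  define \<sigma> where "\<sigma> = (\<Sum>i\<in>UNIV. 1 / p $ i)"
  define D where "D = 4 ^ CARD('n) / unit_ball_vol (real CARD('n))"
  define c :: ennreal where "c = (4 ^ CARD('n)) ^ card (offsets :: (int ^ 'n::{finite,linorder}) set)"
  obtain C0 where C0: "\<And>f. f \<in> borel_measurable lebesgue \<Longrightarrow>
    mixed_norm p (hl_maximal f) \<le> ennreal C0 * mixed_norm p (\<lambda>x. ennreal (cmod (f x)))"
    using mixed_norm_hl_maximal[OF p] by blast
  \<comment> \<open>The first factor is the quasi-triangle constant; \<open>ennreal C0 * c\<close>
    belongs to the part of \<open>f\<close> near the cube and \<open>ennreal D\<close> to the
    averages over the larger cubes.\<close>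
  define C where "C = 4 ^ CARD('n) * (ennreal C0 * c + ennreal D)"
  have "C \<noteq> top"
    unfolding C_def c_def by (simp add: ennreal_mult_eq_top_iff power_eq_top_ennreal)
  moreover have "morrey_coeff p t (hl_maximal f) (dyadic_cube j m) \<le>
      C * (\<Sum>e\<in>offsets. SUP l. ennreal (2 powr (- (real l * real CARD('n) / t))) *
        morrey_coeff p t G (dyadic_cube (j - int l) (parent l m + e)))"
    if f: "f \<in> borel_measurable lebesgue" and G [measurable]: "G \<in> borel_measurable borel"
      and eq: "AE y in lborel. ennreal (cmod (f y)) = G y" for f G j m
  proof -
    let ?Q = "dyadic_cube j m"
    let ?R = "\<lambda>l e. dyadic_cube (j - int l) (parent l m + e) :: (real ^ 'n::{finite,linorder}) set"
    let ?S = "\<lambda>e. SUP l. ennreal (2 powr (- (real l * real CARD('n) / t))) * morrey_coeff p t G (?R l e)"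
    let ?A = "\<lambda>l e. ennreal (1 / side (j - int l) ^ CARD('n)) * (\<integral>\<^sup>+y. G y * indicator (?R l e) y \<partial>lborel)"
    define N where "N = (\<Union>e\<in>offsets. dyadic_cube j (m + e) :: (real ^ 'n::{finite,linorder}) set)"
    have N [measurable]: "N \<in> sets borel" unfolding N_def by (intro sets.finite_UN finite_offsets) auto
    define g where "g y = indicator N y *\<^sub>R f y" for y
    have "N \<in> sets lebesgue" using N by simp
    then have g: "g \<in> borel_measurable lebesgue" unfolding g_def using f by (intro borel_measurable_scaleR borel_measurable_indicator) auto
    define w where "w = ennreal (side j powr (n / t - \<sigma>))"
    define T where "T = (\<Sum>e\<in>offsets. SUP l. ?A l e)"
    have local: "w * mixed_norm p (hl_maximal g) \<le> ennreal C0 * c * (\<Sum>e\<in>offsets. ?S e)"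
    proof -
      have "mixed_norm p (hl_maximal g) \<le> ennreal C0 * mixed_norm p (\<lambda>x. ennreal (cmod (g x)))"
        by (rule C0[OF g])
      also have "mixed_norm p (\<lambda>x. ennreal (cmod (g x))) = mixed_norm p (\<lambda>x. G x * indicator N x)"
        by (intro mixed_norm_cong_AE p0) (use eq in \<open>auto elim!: eventually_mono simp: g_def split: split_indicator\<close>)
      also have "\<dots> \<le> mixed_norm p (\<lambda>x. \<Sum>e\<in>offsets. G x * indicator (dyadic_cube j (m + e)) x)"
      proof (intro mixed_norm_mono p0)
        fix x
        show "G x * indicator N x \<le> (\<Sum>e\<in>offsets. G x * indicator (dyadic_cube j (m + e)) x)"
        proof (cases "x \<in> N")
          case True
          then obtain e where e: "e \<in> offsets" "x \<in> dyadic_cube j (m + e)" unfolding N_def by blast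
          have "G x * indicator (dyadic_cube j (m + e)) x \<le> (\<Sum>e\<in>offsets. G x * indicator (dyadic_cube j (m + e)) x)"
            by (intro member_le_sum e finite_offsets) simp
          then show ?thesis using e True by simp
        qed simp
      qed
      also have "\<dots> \<le> c * (\<Sum>e\<in>offsets. mixed_norm p (\<lambda>x. G x * indicator (dyadic_cube j (m + e)) x))"
        unfolding c_def by (intro mixed_norm_sum_le p finite_offsets) measurable
      finally have "w * mixed_norm p (hl_maximal g)
        \<le> w * (ennreal C0 * (c * (\<Sum>e\<in>offsets. mixed_norm p (\<lambda>x. G x * indicator (dyadic_cube j (m + e)) x))))"
        by (simp add: mult_left_mono)
      also have "\<dots> = ennreal C0 * c * (\<Sum>e\<in>offsets. morrey_coeff p t G (dyadic_cube j (m + e)))"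
        by (simp add: morrey_coeff_dyadic_cube sum_distrib_left w_def n_def \<sigma>_def mult_ac)
      \<comment> \<open>The neighbours of the cube itself are the term \<open>l = 0\<close> of the
        supremum.\<close>
      also have "\<dots> \<le> ennreal C0 * c * (\<Sum>e\<in>offsets. ?S e)"
        by (intro mult_left_mono sum_mono SUP_upper2[of 0]) (auto simp: parent_def)
      finally show ?thesis .
    qed
    have global: "w * mixed_norm p (\<lambda>x. ennreal D * T * indicator ?Q x) \<le> ennreal D * (\<Sum>e\<in>offsets. ?S e)"
    proof -
      have A: "ennreal (side j powr (n / t)) * ?A l e \<le> ennreal (2 powr (- (real l * real CARD('n) / t))) * morrey_coeff p t G (?R l e)" for l e
      proof -
        define L where "L = side (j - int l)"
        have L: "0 < L" by (simp add: L_def)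
        have Ls: "L = 2 powr real l * side j" by (simp add: L_def side_diff powr_realpow)
        have "ennreal (side j powr (n / t)) * ?A l e
          \<le> ennreal (side j powr (n / t)) * (ennreal (1 / L ^ CARD('n)) * (ennreal (L powr (n - \<sigma>)) * mixed_norm p (\<lambda>x. G x * indicator (?R l e) x)))"
          unfolding L_def n_def \<sigma>_def by (intro mult_left_mono nn_integral_dyadic_cube_le p G) auto
        also have "\<dots> = ennreal (side j powr (n / t) * (1 / L ^ CARD('n) * L powr (n - \<sigma>))) * mixed_norm p (\<lambda>x. G x * indicator (?R l e) x)"
          by (simp only: ennreal_mult powr_ge_zero mult_nonneg_nonneg divide_nonneg_nonneg zero_le_one
              zero_le_power less_imp_le[OF L] mult.assoc)
        also have "side j powr (n / t) * (1 / L ^ CARD('n) * L powr (n - \<sigma>)) = 2 powr (- (real l * n / t)) * L powr (n / t - \<sigma>)"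
        proof -
          have "1 / L ^ CARD('n) * L powr (n - \<sigma>) = L powr (- \<sigma>)"
            using L by (simp add: n_def powr_realpow[symmetric] powr_diff powr_minus field_simps)
          moreover have "L powr (n / t - \<sigma>) = L powr (n / t) * L powr (- \<sigma>)"
            unfolding powr_add[symmetric] by simp
          moreover have "L powr (n / t) = 2 powr (real l * n / t) * side j powr (n / t)"
            unfolding Ls by (simp add: powr_mult powr_powr)
          ultimately show ?thesis by (simp add: powr_minus)
        qed
        also have "ennreal (2 powr (- (real l * n / t)) * L powr (n / t - \<sigma>)) * mixed_norm p (\<lambda>x. G x * indicator (?R l e) x)
          = ennreal (2 powr (- (real l * real CARD('n) / t))) * morrey_coeff p t G (?R l e)"
          by (simp add: morrey_coeff_dyadic_cube ennreal_mult mult.assoc n_def \<sigma>_def L_def)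
        finally show ?thesis .
      qed
      have "w * mixed_norm p (\<lambda>x. ennreal D * T * indicator ?Q x) \<le> w * (ennreal D * T * ennreal (side j powr \<sigma>))"
        unfolding \<sigma>_def by (intro mult_left_mono mixed_norm_const_dyadic_cube p0) simp
      also have "\<dots> = ennreal D * ((w * ennreal (side j powr \<sigma>)) * T)" by (simp add: mult_ac)
      also have "w * ennreal (side j powr \<sigma>) = ennreal (side j powr (n / t))"
        unfolding w_def by (simp add: ennreal_mult[symmetric] powr_add[symmetric])
      also have "ennreal (side j powr (n / t)) * T = (\<Sum>e\<in>offsets. SUP l. ennreal (side j powr (n / t)) * ?A l e)"
        unfolding T_def by (simp only: sum_distrib_left SUP_mult_left_ennreal)
      also have "ennreal D * \<dots> \<le> ennreal D * (\<Sum>e\<in>offsets. ?S e)"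
        by (intro mult_left_mono sum_mono SUP_mono' A) simp
      finally show ?thesis .
    qed
    have "mixed_norm p (\<lambda>x. hl_maximal f x * indicator ?Q x) \<le> mixed_norm p (\<lambda>x. hl_maximal g x + ennreal D * T * indicator ?Q x)"
    proof (intro mixed_norm_mono p0)
      fix x
      show "hl_maximal f x * indicator ?Q x \<le> hl_maximal g x + ennreal D * T * indicator ?Q x"
        using hl_maximal_dyadic_cube_le[OF _ G eq, of x j m]
        by (cases "x \<in> ?Q") (simp_all add: D_def T_def g_def[abs_def] N_def)
    qed
    also have "\<dots> \<le> 4 ^ CARD('n) * (mixed_norm p (hl_maximal g) + mixed_norm p (\<lambda>x. ennreal D * T * indicator ?Q x))"
      by (intro mixed_norm_add_le p) measurable
    finally have "w * mixed_norm p (\<lambda>x. hl_maximal f x * indicator ?Q x) \<le> w * \<dots>" by (rule mult_left_mono) simp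
    also have "\<dots> = 4 ^ CARD('n) * (w * mixed_norm p (hl_maximal g) + w * mixed_norm p (\<lambda>x. ennreal D * T * indicator ?Q x))"
      by (simp add: distrib_left mult_ac)
    also have "\<dots> \<le> 4 ^ CARD('n) * (ennreal C0 * c * (\<Sum>e\<in>offsets. ?S e) + ennreal D * (\<Sum>e\<in>offsets. ?S e))"
      by (intro mult_left_mono add_mono local global) auto
    also have "\<dots> = C * (\<Sum>e\<in>offsets. ?S e)" by (simp add: C_def distrib_right mult.assoc)
    finally show ?thesis by (simp add: morrey_coeff_dyadic_cube w_def n_def \<sigma>_def)
  qed
  ultimately show ?thesis by blast
qed

section \<open>Summation over all cubes\<close>

lemma sum_le_infsum_ennreal:
  fixes h :: "'a \<Rightarrow> ennreal"
  shows "finite S \<Longrightarrow> S \<subseteq> A \<Longrightarrow> sum h S \<le> infsum h A"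
  by (subst nonneg_infsum_complete) (auto intro!: SUP_upper)

text \<open>For fixed \<open>l\<close> and \<open>e\<close>, the map of indices has fibres of at
  most \<open>2 ^ (l * CARD('n))\<close> elements. Grouping the finite sum by fibres therefore uses
  each term of the infinite sum at most that often.\<close>

lemma sum_parent_le_infsum:
  fixes h :: "(real ^ 'n) set \<Rightarrow> ennreal"
  assumes T: "finite T"
  shows "(\<Sum>(j, m)\<in>T. h (dyadic_cube (j - int l) (parent l m + e))) \<le> 2 ^ (l * CARD('n)) * infsum h dyadic_cubes"
proof -
  define \<phi> where "\<phi> = (\<lambda>(j, m). (j - int l, parent l m + e))"
  define b where "b = (\<lambda>(j, m). h (dyadic_cube j m))"
  have fibre: "card {q \<in> T. \<phi> q = y} \<le> 2 ^ (l * CARD('n))" for y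
  proof -
    obtain j' m' where y: "y = (j', m')" by force
    have "{q \<in> T. \<phi> q = y} \<subseteq> Pair (j' + int l) ` {m. parent l m = m' - e}"
      unfolding \<phi>_def y by (auto simp: eq_diff_eq)
    then have "card {q \<in> T. \<phi> q = y} \<le> card (Pair (j' + int l) ` {m. parent l m = m' - e})"
      by (intro card_mono finite_imageI card_parent_fibre)
    also have "\<dots> \<le> card {m. parent l m = m' - e}" by (intro card_image_le card_parent_fibre)
    also have "\<dots> \<le> 2 ^ (l * CARD('n))" by (rule card_parent_fibre)
    finally show ?thesis .
  qed
  have "(\<Sum>(j, m)\<in>T. h (dyadic_cube (j - int l) (parent l m + e))) = (\<Sum>q\<in>T. b (\<phi> q))"
    by (simp add: b_def \<phi>_def split_beta)
  also have "\<dots> = (\<Sum>y\<in>\<phi> ` T. \<Sum>q\<in>{q \<in> T. \<phi> q = y}. b (\<phi> q))" by (rule sum.image_gen[OF T])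
  also have "\<dots> = (\<Sum>y\<in>\<phi> ` T. of_nat (card {q \<in> T. \<phi> q = y}) * b y)"
    by (intro sum.cong) auto
  also have "\<dots> \<le> (\<Sum>y\<in>\<phi> ` T. of_nat (2 ^ (l * CARD('n))) * b y)"
    by (intro sum_mono mult_right_mono of_nat_mono fibre) simp
  also have "\<dots> = 2 ^ (l * CARD('n)) * (\<Sum>y\<in>\<phi> ` T. b y)"
    by (simp add: sum_distrib_left)
  also have "(\<Sum>y\<in>\<phi> ` T. b y) = (\<Sum>Q\<in>(\<lambda>(j, m). dyadic_cube j m) ` \<phi> ` T. h Q)"
    by (subst sum.reindex) (auto intro: inj_on_subset[OF inj_dyadic_cube] simp: b_def split_beta)
  also have "\<dots> \<le> infsum h dyadic_cubes"
    using T by (intro sum_le_infsum_ennreal) (auto simp: dyadic_cubes_def)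
  finally show ?thesis by (simp add: mult_left_mono)
qed

lemma bourgain_morrey_norm_infinity:
  "bourgain_morrey_norm p t \<infinity> F = (SUP Q\<in>dyadic_cubes. morrey_coeff p t F Q)"
  by (simp add: bourgain_morrey_norm_def morrey_coeff_def)

lemma bourgain_morrey_norm_ereal:
  fixes p :: "real ^ 'n::{finite,linorder}"
  assumes "0 < \<rho>"
  shows "bourgain_morrey_norm p t (ereal \<rho>) F = (\<Sum>\<^sub>\<infinity>Q\<in>dyadic_cubes. morrey_coeff p t F Q \<up> \<rho>) \<up> (1 / \<rho>)"
proof -
  have "ennreal (measure lebesgue Q powr (\<rho> / t - \<rho> / real CARD('n) * (\<Sum>i\<in>UNIV. 1 / p $ i)))
      * mixed_norm p (\<lambda>x. F x * indicator Q x) \<up> \<rho> = morrey_coeff p t F Q \<up> \<rho>" for Q :: "(real ^ 'n::{finite,linorder}) set"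
  proof -
    have "(1 / t - 1 / real CARD('n) * (\<Sum>i\<in>UNIV. 1 / p $ i)) * \<rho> = \<rho> / t - \<rho> / real CARD('n) * (\<Sum>i\<in>UNIV. 1 / p $ i)"
      by (simp add: left_diff_distrib)
    then show ?thesis
      unfolding morrey_coeff_def ennreal_powr_mult by (simp add: ennreal_powr_ennreal powr_powr)
  qed
  then show ?thesis by (simp add: bourgain_morrey_norm_def)
qed

text \<open>For infinite \<open>r\<close> it is enough that the decay factors are at most 1. For
  finite \<open>r\<close> the supremum over the generations is replaced by a sum of powers, and each
  generation is summed over all cubes separately.\<close>

lemma bourgain_morrey_norm_hl_maximal:
  fixes p :: "real ^ 'n::{finite,linorder}"
  assumes p: "\<And>i. 1 < p $ i" and t: "0 < t" and r: "ereal t < r"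
  shows "\<exists>C. C \<noteq> top \<and> (\<forall>f\<in>borel_measurable lebesgue.
    bourgain_morrey_norm p t r (hl_maximal f) \<le> C * bourgain_morrey_norm p t r (\<lambda>x. ennreal (cmod (f x))))"
proof -
  have p0: "0 < p $ i" for i using p[of i] by simp
  define n where "n = real CARD('n)"
  have n: "0 < n" by (simp add: n_def)
  let ?E = "offsets :: (int ^ 'n::{finite,linorder}) set"
  let ?d = "\<lambda>l. ennreal (2 powr (- (real l * real CARD('n) / t)))"
  obtain C where C: "C \<noteq> top" "\<And>f G j m. f \<in> borel_measurable lebesgue \<Longrightarrow> G \<in> borel_measurable borel \<Longrightarrow>
    (AE y in lborel. ennreal (cmod (f y)) = G y) \<Longrightarrow>
    morrey_coeff p t (hl_maximal f) (dyadic_cube j m) \<le>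
      C * (\<Sum>e\<in>?E. SUP l. ?d l * morrey_coeff p t G (dyadic_cube (j - int l) (parent l m + e)))"
    using morrey_coeff_hl_maximal[OF p t] by blast
  \<comment> \<open>One Borel representative serves the coefficients of all cubes at once.\<close>
  have borel_version: "\<exists>G. G \<in> borel_measurable borel \<and> (AE y in lborel. ennreal (cmod (f y)) = G y) \<and>
      (\<forall>Q\<in>dyadic_cubes. morrey_coeff p t (\<lambda>x. ennreal (cmod (f x))) Q = morrey_coeff p t G Q)"
    if "f \<in> borel_measurable lebesgue" for f :: "real ^ 'n::{finite,linorder} \<Rightarrow> complex"
  proof -
    have m: "(\<lambda>x. ennreal (cmod (f x))) \<in> borel_measurable (completion lborel)" using that by measurable
    obtain G where G: "G \<in> borel_measurable lborel" and eq: "AE x in lborel. ennreal (cmod (f x)) = G x"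
      using completion_ex_borel_measurable[OF m] by blast
    have "morrey_coeff p t (\<lambda>x. ennreal (cmod (f x))) Q = morrey_coeff p t G Q" for Q
      unfolding morrey_coeff_def
      by (intro arg_cong2[where f = "(*)"] refl mixed_norm_cong_AE p0) (use eq in \<open>auto elim: eventually_mono\<close>)
    then show ?thesis using G eq by auto
  qed
  have mem: "dyadic_cube j m \<in> dyadic_cubes" for j and m :: "int ^ 'n::{finite,linorder}" by (auto simp: dyadic_cubes_def)
  show ?thesis
  proof (cases r)
    case PInf
    show ?thesis
    proof (intro exI[of _ "C * of_nat (card ?E)"] conjI ballI)
      fix f :: "real ^ 'n::{finite,linorder} \<Rightarrow> complex" assume f: "f \<in> borel_measurable lebesgue"
      obtain G where G: "G \<in> borel_measurable borel" "AE y in lborel. ennreal (cmod (f y)) = G y"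
        "\<And>Q. Q \<in> dyadic_cubes \<Longrightarrow> morrey_coeff p t (\<lambda>x. ennreal (cmod (f x))) Q = morrey_coeff p t G Q"
        using borel_version[OF f] by blast
      define X where "X = (SUP Q\<in>dyadic_cubes. morrey_coeff p t G Q)"
      have X: "bourgain_morrey_norm p t r (\<lambda>x. ennreal (cmod (f x))) = X"
        unfolding PInf bourgain_morrey_norm_infinity X_def by (intro SUP_cong G) auto
      show "bourgain_morrey_norm p t r (hl_maximal f) \<le> C * of_nat (card ?E) * bourgain_morrey_norm p t r (\<lambda>x. ennreal (cmod (f x)))"
        unfolding X unfolding PInf bourgain_morrey_norm_infinity
      proof (rule SUP_least)
        fix Q :: "(real ^ 'n::{finite,linorder}) set" assume "Q \<in> dyadic_cubes"
        then obtain j m where Q: "Q = dyadic_cube j m" by (auto simp: dyadic_cubes_def)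
        have "morrey_coeff p t (hl_maximal f) Q \<le> C * (\<Sum>e\<in>?E. SUP l. ?d l * morrey_coeff p t G (dyadic_cube (j - int l) (parent l m + e)))"
          unfolding Q by (rule C(2)[OF f G(1,2)])
        also have "\<dots> \<le> C * (\<Sum>e\<in>?E. X)"
        proof (intro mult_left_mono sum_mono SUP_least)
          fix e and l :: nat
          have "(2 :: real) powr (- (real l * real CARD('n) / t)) \<le> 2 powr 0"
            using t by (intro powr_mono) auto
          then have "?d l \<le> 1" by (simp add: ennreal_le_1)
          moreover have "morrey_coeff p t G (dyadic_cube (j - int l) (parent l m + e)) \<le> X"
            unfolding X_def by (intro SUP_upper mem)
          ultimately have "?d l * morrey_coeff p t G (dyadic_cube (j - int l) (parent l m + e)) \<le> 1 * X"
            by (intro mult_mono) auto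
          then show "?d l * morrey_coeff p t G (dyadic_cube (j - int l) (parent l m + e)) \<le> X" by simp
        qed simp
        finally show "morrey_coeff p t (hl_maximal f) Q \<le> C * of_nat (card ?E) * X" by (simp add: mult.assoc)
      qed
    qed (use C(1) in \<open>simp add: ennreal_mult_eq_top_iff\<close>)
  next
    case (real \<rho>)
    then have \<rho>: "t < \<rho>" "0 < \<rho>" using r t by auto
    \<comment> \<open>The quotient of consecutive generations: \<open>2 powr n\<close> counts
      descendants, and \<open>2 powr (- n * \<rho> / t)\<close> is the decay of the coefficients
      after taking the power \<open>\<rho>\<close>. It is below 1 because
      \<open>t < \<rho>\<close>.\<close>
    define \<theta> where "\<theta> = 2 powr (n - n * \<rho> / t)"
    have \<theta>: "0 \<le> \<theta>" "\<theta> < 1"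
    proof -
      have "n * t < n * \<rho>" using n \<rho> by simp
      then have "n - n * \<rho> / t < 0" using t by (simp add: field_simps)
      then have "2 powr (n - n * \<rho> / t) < 2 powr 0" by (intro powr_less_mono) auto
      then show "\<theta> < 1" by (simp add: \<theta>_def)
    qed (simp add: \<theta>_def)
    have geom: "(\<Sum>l. ennreal (\<theta> ^ l)) = ennreal (1 / (1 - \<theta>))"
    proof (rule suminf_ennreal_eq)
      show "(\<lambda>l. \<theta> ^ l) sums (1 / (1 - \<theta>))" using \<theta> by (intro geometric_sums) auto
    qed (use \<theta> in simp)
    \<comment> \<open>The first cardinality comes from pulling the power \<open>\<rho>\<close> into
      the sum over offsets, the second counts the terms of this sum, and the last factor is the
      geometric series.\<close>
    define K where "K = C \<up> \<rho> * of_nat (card ?E) \<up> \<rho> * (of_nat (card ?E) * ennreal (1 / (1 - \<theta>)))"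
    have "K \<noteq> top" unfolding K_def using C(1) by (simp add: ennreal_mult_eq_top_iff)
    show ?thesis
    proof (intro exI[of _ "K \<up> (1 / \<rho>)"] conjI ballI)
      show "K \<up> (1 / \<rho>) \<noteq> top" using \<open>K \<noteq> top\<close> by simp
      fix f :: "real ^ 'n::{finite,linorder} \<Rightarrow> complex" assume f: "f \<in> borel_measurable lebesgue"
      obtain G where G: "G \<in> borel_measurable borel" "AE y in lborel. ennreal (cmod (f y)) = G y"
        "\<And>Q. Q \<in> dyadic_cubes \<Longrightarrow> morrey_coeff p t (\<lambda>x. ennreal (cmod (f x))) Q = morrey_coeff p t G Q"
        using borel_version[OF f] by blast
      define h where "h Q = morrey_coeff p t G Q \<up> \<rho>" for Q
      define X where "X = infsum h dyadic_cubes"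
      have X: "(\<Sum>\<^sub>\<infinity>Q\<in>dyadic_cubes. morrey_coeff p t (\<lambda>x. ennreal (cmod (f x))) Q \<up> \<rho>) = X"
        unfolding X_def h_def using G(3) by (intro infsum_cong) simp
      let ?R = "\<lambda>l e q. dyadic_cube (fst q - int l) (parent l (snd q) + e)"
      have coeff: "morrey_coeff p t (hl_maximal f) (dyadic_cube (fst q) (snd q)) \<up> \<rho>
        \<le> C \<up> \<rho> * of_nat (card ?E) \<up> \<rho> * (\<Sum>e\<in>?E. \<Sum>l. ?d l \<up> \<rho> * h (?R l e q))" for q
      proof -
        have "morrey_coeff p t (hl_maximal f) (dyadic_cube (fst q) (snd q)) \<up> \<rho>
          \<le> (C * (\<Sum>e\<in>?E. SUP l. ?d l * morrey_coeff p t G (?R l e q))) \<up> \<rho>"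
          using \<rho> by (intro ennreal_powr_mono C(2)[OF f G(1,2)]) auto
        also have "\<dots> \<le> C \<up> \<rho> * (of_nat (card ?E) \<up> \<rho> * (\<Sum>e\<in>?E. (SUP l. ?d l * morrey_coeff p t G (?R l e q)) \<up> \<rho>))"
          unfolding ennreal_powr_mult[of C] using \<rho> by (intro mult_left_mono ennreal_powr_sum_le finite_offsets) auto
        also have "\<dots> \<le> C \<up> \<rho> * (of_nat (card ?E) \<up> \<rho> * (\<Sum>e\<in>?E. \<Sum>l. ?d l \<up> \<rho> * h (?R l e q)))"
        proof (intro mult_left_mono sum_mono ennreal_powr_SUP_le \<rho>)
          fix e l
          show "(?d l * morrey_coeff p t G (?R l e q)) \<up> \<rho> \<le> (\<Sum>l. ?d l \<up> \<rho> * h (?R l e q))"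
            using sum_le_suminf[OF summableI, of "{l}" "\<lambda>l. ?d l \<up> \<rho> * h (?R l e q)"]
            by (simp add: ennreal_powr_mult h_def)
        qed auto
        finally show ?thesis by (simp add: mult.assoc)
      qed
      have dl: "?d l \<up> \<rho> * 2 ^ (l * CARD('n)) = ennreal (\<theta> ^ l)" for l
      proof -
        have "(2 :: ennreal) ^ (l * CARD('n)) = ennreal (2 powr (real l * n))"
          using ennreal_power[of 2 "l * CARD('n)"] by (simp add: n_def powr_realpow del: of_nat_mult flip: of_nat_mult)
        moreover have "?d l \<up> \<rho> = ennreal (2 powr (- (real l * n / t) * \<rho>))"
          by (simp add: ennreal_powr_ennreal powr_powr n_def)
        moreover have "2 powr (- (real l * n / t) * \<rho>) * 2 powr (real l * n) = \<theta> ^ l"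
        proof -
          have "- (real l * n / t) * \<rho> + real l * n = (n - n * \<rho> / t) * real l" by (simp add: algebra_simps)
          then show ?thesis unfolding powr_add[symmetric] \<theta>_def
            by (simp add: powr_powr[symmetric] powr_realpow)
        qed
        ultimately show ?thesis by (simp add: ennreal_mult[symmetric])
      qed
      have "(\<Sum>\<^sub>\<infinity>Q\<in>dyadic_cubes. morrey_coeff p t (hl_maximal f) Q \<up> \<rho>) \<le> K * X"
      proof (rule infsum_le_finite_sums)
        \<comment> \<open>Over a finite set of cubes, the sums over cubes, offsets and generations
          can be interchanged.\<close>
        fix S :: "(real ^ 'n::{finite,linorder}) set set" assume S: "finite S" "S \<subseteq> dyadic_cubes"
        define cube :: "int \<times> (int ^ 'n::{finite,linorder}) \<Rightarrow> (real ^ 'n::{finite,linorder}) set" where "cube = (\<lambda>(j, m). dyadic_cube j m)"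
        have inj: "inj cube" unfolding cube_def by (rule inj_dyadic_cube)
        define T where "T = cube -` S"
        have T: "finite T" unfolding T_def using S(1) inj by (rule finite_vimageI)
        have "S \<subseteq> range cube" using S by (force simp: cube_def dyadic_cubes_def)
        then have ST: "S = cube ` T" unfolding T_def by auto
        have "(\<Sum>Q\<in>S. morrey_coeff p t (hl_maximal f) Q \<up> \<rho>) = (\<Sum>q\<in>T. morrey_coeff p t (hl_maximal f) (dyadic_cube (fst q) (snd q)) \<up> \<rho>)"
          unfolding ST by (subst sum.reindex[OF inj_on_subset[OF inj subset_UNIV]]) (simp add: cube_def split_beta)
        also have "\<dots> \<le> (\<Sum>q\<in>T. C \<up> \<rho> * of_nat (card ?E) \<up> \<rho> * (\<Sum>e\<in>?E. \<Sum>l. ?d l \<up> \<rho> * h (?R l e q)))"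
          by (intro sum_mono coeff)
        also have "\<dots> = C \<up> \<rho> * of_nat (card ?E) \<up> \<rho> * (\<Sum>e\<in>?E. \<Sum>q\<in>T. \<Sum>l. ?d l \<up> \<rho> * h (?R l e q))"
          by (simp only: sum_distrib_left[symmetric] sum.swap[of _ T ?E])
        also have "\<dots> = C \<up> \<rho> * of_nat (card ?E) \<up> \<rho> * (\<Sum>e\<in>?E. \<Sum>l. ?d l \<up> \<rho> * (\<Sum>q\<in>T. h (?R l e q)))"
          by (simp only: suminf_sum[OF summableI, symmetric] sum_distrib_left[symmetric])
        also have "\<dots> \<le> C \<up> \<rho> * of_nat (card ?E) \<up> \<rho> * (\<Sum>e\<in>?E. \<Sum>l. ennreal (\<theta> ^ l) * X)"
        proof (intro mult_left_mono sum_mono suminf_le summableI)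
          fix e and l :: nat
          have "?d l \<up> \<rho> * (\<Sum>q\<in>T. h (?R l e q)) \<le> ?d l \<up> \<rho> * (2 ^ (l * CARD('n)) * X)"
            unfolding X_def using sum_parent_le_infsum[OF T, of h l e] by (intro mult_left_mono) (auto simp: split_beta)
          then show "?d l \<up> \<rho> * (\<Sum>q\<in>T. h (?R l e q)) \<le> ennreal (\<theta> ^ l) * X"
            by (simp only: mult.assoc[symmetric] dl)
        qed auto
        also have "\<dots> = K * X"
          unfolding ennreal_suminf_multc geom K_def by (simp add: mult.assoc)
        finally show "(\<Sum>Q\<in>S. morrey_coeff p t (hl_maximal f) Q \<up> \<rho>) \<le> K * X" .
      qed (rule nonneg_summable_on_complete, simp)
      then have "(\<Sum>\<^sub>\<infinity>Q\<in>dyadic_cubes. morrey_coeff p t (hl_maximal f) Q \<up> \<rho>) \<up> (1 / \<rho>) \<le> (K * X) \<up> (1 / \<rho>)"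
        using \<rho> by (intro ennreal_powr_mono) auto
      then show "bourgain_morrey_norm p t r (hl_maximal f) \<le> K \<up> (1 / \<rho>) * bourgain_morrey_norm p t r (\<lambda>x. ennreal (cmod (f x)))"
        unfolding real bourgain_morrey_norm_ereal[OF \<rho>(2)] X ennreal_powr_mult .
    qed
  qed (use r in auto)
qed

theorem theorem6p3:
  fixes p :: "real ^ 'n::{finite,linorder}" and t :: real and r :: ereal
  assumes p: "\<And>i. 1 < p $ i"
    and tr: "(1 < real CARD('n) / (\<Sum>i\<in>UNIV. 1 / p $ i) \<and>
              real CARD('n) / (\<Sum>i\<in>UNIV. 1 / p $ i) < t \<and> ereal t < r \<and> r < \<infinity>) \<or>
             (1 < real CARD('n) / (\<Sum>i\<in>UNIV. 1 / p $ i) \<and>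
              real CARD('n) / (\<Sum>i\<in>UNIV. 1 / p $ i) \<le> t \<and> ereal t < r \<and> r = \<infinity>)"
  shows "\<exists>C\<ge>0. \<forall>f\<in>bourgain_morrey p t r.
           bourgain_morrey_norm p t r (hl_maximal f)
             \<le> ennreal C * bourgain_morrey_norm p t r (\<lambda>x. ennreal (cmod (f x)))"
proof -
  \<comment> \<open>Either alternative makes \<open>t\<close> larger than 1.\<close>
  have t: "0 < t" "ereal t < r" using tr by auto
  obtain C where C: "C \<noteq> top" "\<And>f. f \<in> borel_measurable lebesgue \<Longrightarrow>
    bourgain_morrey_norm p t r (hl_maximal f) \<le> C * bourgain_morrey_norm p t r (\<lambda>x. ennreal (cmod (f x)))"
    using bourgain_morrey_norm_hl_maximal[OF p t] by blast
  have "ennreal (enn2real C) = C" using C(1) by (simp add: less_top)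
  then show ?thesis
    using C(2) by (intro exI[of _ "enn2real C"]) (auto simp: bourgain_morrey_def)
qed

end
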